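(* Let $\gamma>1$, $\alpha>\frac12$, let $(\rho_\pm,u_\pm)$ with $\rho_\pm>0$ be end states connected by a 2-rarefaction wave, and let $q\ge2$. There is $\eta_0>0$, depending only on $\alpha,\gamma,q,\rho_\pm,u_\pm$, such that for $0<\eta\le\eta_0$ and the corresponding smooth 2-rarefaction wave $(\bar\rho,\bar u)$ (all defined in the context) the following holds. Let the initial data $(\rho_0,m_0)$, with $(\rho_0,m_0)(x)\to(\rho_\pm,\rho_\pm u_\pm)$ as $x\to\pm\infty$, satisfy $\rho_0\ge0$, $m_0=0$ a.e. on $\{\rho_0=0\}$, $(\rho_0^{\alpha-\frac12})_x\in L^2(\mathbb R)$, $\rho_0\Psi(\rho_0,\bar\rho_0)\in L^1(\mathbb R)$, $\rho_0(\frac{m_0}{\rho_0}-\bar u_0)^2\in L^1(\mathbb R)$ and $\rho_0(\frac{m_0}{\rho_0}-\bar u_0)^3\in L^1(\mathbb R)$. Suppose that $(\rho,u)$ is a weak solution (towards $(\bar\rho,\bar u)$, in the sense defined in the context) of the Cauchy problem $$\rho_t+(\rho u)_x=0,\qquad (\rho u)_t+(\rho u^2+\rho^\gamma)_x=(\rho^\alpha u_x)_x,\qquad (\rho,\rho u)(0,x)=(\rho_0,m_0)(x),$$ and that there is a constant $C$ independent of $T$ such that for every $T>0$: $\rho\in C(\mathbb R\times(0,T))$, $0\le\rho\le C$ on $\mathbb R\times[0,T]$, and $$\sup_{t\in[0,T]}\int_{\mathbb R}\Big(|\sqrt\rho(u-\bar u)|^2+[(\rho^{\alpha-\frac12})_x]^2+\frac1{\gamma-1}\big[\rho^\gamma-\bar\rho^\gamma-\gamma\bar\rho^{\gamma-1}(\rho-\bar\rho)\big]\Big)dx$$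 $$+\int_0^T\int_{\mathbb R}\Big(\big[(\rho^{\frac{\gamma+\alpha-1}{2}}-\bar\rho^{\frac{\gamma+\alpha-1}{2}})_x\big]^2+\Lambda^2\Big)dx\,dt\le C,$$ where $\Lambda\in L^2(\mathbb R\times(0,T))$ satisfies, for all $\varphi\in C_0^\infty(\mathbb R\times(0,T))$, $$\int_0^T\!\!\int_{\mathbb R}\Lambda\varphi\,dxdt=-\int_0^T\!\!\int_{\mathbb R}\rho^{\alpha-\frac12}\sqrt\rho(u-\bar u)\varphi_x\,dxdt-\frac{2\alpha}{2\alpha-1}\int_0^T\!\!\int_{\mathbb R}(\rho^{\alpha-\frac12})_x\sqrt\rho(u-\bar u)\varphi\,dxdt.$$ Then $$\lim_{t\to\infty}\sup_{x\in\mathbb R}|\rho(t,x)-\bar\rho(t,x)|=0.$$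
   Context: Rarefaction wave. Let $p(\rho)=\rho^\gamma$, $\lambda_2(\rho,u)=u+\sqrt{p'(\rho)}$, $\Sigma_2(\rho,u)=u-\int_0^\rho\frac{\sqrt{p'(s)}}{s}ds$. The states $(\rho_\pm,u_\pm)$, $\rho_\pm>0$, are connected by a 2-rarefaction wave if $\Sigma_2(\rho_-,u_-)=\Sigma_2(\rho_+,u_+)$ and $w_-<w_+$, where $w_\pm:=\lambda_2(\rho_\pm,u_\pm)$. For $q\ge2$ and $\eta>0$ let $w(t,x)$ be the smooth solution of $$w_t+ww_x=0,\qquad w(0,x)=\frac{w_++w_-}{2}+\frac{w_+-w_-}{2}K_q\int_0^{\eta x}(1+y^2)^{-q}dy,\qquad K_q\int_0^\infty(1+y^2)^{-q}dy=1.$$ The smooth 2-rarefaction wave $(\bar\rho,\bar u)(t,x)$ is defined by $\lambda_2(\bar\rho,\bar u)(t,x)=w(1+t,x)$ and $\Sigma_2(\bar\rho,\bar u)(t,x)=\Sigma_2(\rho_\pm,u_\pm)$; it solves $\bar\rho_t+(\bar\rho\bar u)_x=0$, $(\bar\rho\bar u)_t+(\bar\rho\bar u^2+p(\bar\rho))_x=0$. Put $(\bar\rho_0,\bar u_0)=(\bar\rho,\bar u)(0,\cdot)$. Relative potential: $\rho\Psi(\rho,\bar\rho)=\frac1{\gamma-1}[\rho^\gamma-\bar\rho^\gamma-\gamma\bar\rho^{\gamma-1}(\rho-\bar\rho)]$. Expressions such as $\rho_0(\frac{m_0}{\rho_0}-\bar u_0)^k$ and $\sqrt\rho(u-\bar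 u)$ are taken to be $0$ where the density vanishes; $\rho u$ means $\sqrt\rho[\sqrt\rho(u-\bar u)]+\rho\bar u$. Weak solution towards $(\bar\rho,\bar u)$: a pair $(\rho,u)$ such that (1) $\rho\ge0$ a.e., $\rho(0,\cdot)=\rho_0$, and for every $T>0$: $\rho\in L^\infty(0,T;L^\infty(\mathbb R))$, $(\rho^{\alpha-\frac12})_x\in L^\infty(0,T;L^2(\mathbb R))$, $\sqrt\rho(u-\bar u)\in L^\infty(0,T;L^2(\mathbb R))$; moreover $\rho\in C([0,\infty);W^{1,\infty}(K)^* )$ for each compact interval $K\subset\mathbb R$ ($\rho$ acting by $\varphi\mapsto\int_K\rho\varphi\,dx$). (2) For all $t_2\ge t_1\ge0$ and $\zeta\in C_0^1(\mathbb R\times[t_1,t_2])$: $\int_{\mathbb R}(\rho-\bar\rho)\zeta\,dx\big|_{t_1}^{t_2}=\int_{t_1}^{t_2}\int_{\mathbb R}[(\rho-\bar\rho)\zeta_t+(\rho u-\bar\rho\bar u)\zeta_x]dxdt.$ (3) For all $T>0$ and $\psi\in C_0^\infty(\mathbb R\times[0,T))$: $$\int_{\mathbb R}(m_0-\bar\rho_0\bar u_0)\psi(0,x)dx+\int_0^T\!\!\int_{\mathbb R}\big\{\sqrt\rho[\sqrt\rho(u-\bar u)]+(\rho-\bar\rho)\bar u\big\}\psi_t\,dxdt$$ $$+\int_0^T\!\!\int_{\mathbb R}\big\{[\sqrt\rho(u-\bar u)]^2+2\sqrt\rho[\sqrt\rho(u-\bar u)]\bar u+(\rho-\bar\rho)\bar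 u^2+\rho^\gamma-\bar\rho^\gamma\big\}\psi_x\,dxdt$$ $$-\langle\rho^\alpha(u-\bar u)_x,\psi_x\rangle-\int_0^T\!\!\int_{\mathbb R}\rho^\alpha\bar u_x\psi_x\,dxdt=0,$$ where $\langle\rho^\alpha(u-\bar u)_x,\phi\rangle:=-\int_0^T\int_{\mathbb R}\rho^{\alpha-\frac12}\sqrt\rho(u-\bar u)\phi_x\,dxdt-\frac{2\alpha}{2\alpha-1}\int_0^T\int_{\mathbb R}(\rho^{\alpha-\frac12})_x\sqrt\rho(u-\bar u)\phi\,dxdt.$ *)

theory Defs
  imports "HOL-Analysis.Analysis"
begin

section \<open>Test functions, weak derivatives and function spaces\<close>

text \<open>
  Functions of time and space are curried, time first. Measurability and integration refer to
  Lebesgue (not merely Borel) measure.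
\<close>

text \<open>
  On an open set this is the usual class of n times continuously differentiable functions. On a
  strip or half plane containing boundary points the derivatives there are one-sided, so the class
  consists of the functions that are regular up to the boundary.
\<close>

primrec Ck_on :: "nat \<Rightarrow> 'a::euclidean_space set \<Rightarrow> ('a \<Rightarrow> real) \<Rightarrow> bool" where
  "Ck_on 0 S f \<longleftrightarrow> continuous_on S f"
| "Ck_on (Suc n) S f \<longleftrightarrow>
     (\<exists>D. (\<forall>p\<in>S. (f has_derivative D p) (at p within S)) \<and> (\<forall>h. Ck_on n S (\<lambda>p. D p h)))"

definition smooth_on :: "'a::euclidean_space set \<Rightarrow> ('a \<Rightarrow> real) \<Rightarrow> bool" where
  "smooth_on S f \<longleftrightarrow> (\<forall>n. Ck_on n S f)"

text \<open>The support is relative to \<open>S\<close>: it may touch those boundary points that belong to \<open>S\<close>.\<close>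

definition compact_support_in :: "'a::euclidean_space set \<Rightarrow> ('a \<Rightarrow> real) \<Rightarrow> bool" where
  "compact_support_in S f \<longleftrightarrow> (\<exists>K\<subseteq>S. compact K \<and> (\<forall>p\<in>S - K. f p = 0))"

definition C01 :: "'a::euclidean_space set \<Rightarrow> ('a \<Rightarrow> real) \<Rightarrow> bool" where
  "C01 S f \<longleftrightarrow> Ck_on 1 S f \<and> compact_support_in S f"

definition C0_infinity :: "'a::euclidean_space set \<Rightarrow> ('a \<Rightarrow> real) \<Rightarrow> bool" where
  "C0_infinity S f \<longleftrightarrow> smooth_on S f \<and> compact_support_in S f"

definition dt :: "(real \<Rightarrow> real \<Rightarrow> real) \<Rightarrow> real \<Rightarrow> real \<Rightarrow> real" where
  "dt f t x = deriv (\<lambda>s. f s x) t"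

definition dx :: "(real \<Rightarrow> real \<Rightarrow> real) \<Rightarrow> real \<Rightarrow> real \<Rightarrow> real" where
  "dx f t x = deriv (f t) x"

text \<open>
  Open strips are used for all integrals over time intervals; the boundary is a null set, and
  derivatives of test functions are two-sided inside.
\<close>

definition strip :: "real \<Rightarrow> real \<Rightarrow> (real \<times> real) set" where
  "strip a b = {a<..<b} \<times> UNIV"

definition int_strip :: "real \<Rightarrow> real \<Rightarrow> (real \<Rightarrow> real \<Rightarrow> real) \<Rightarrow> real" where
  "int_strip a b f = (LINT (t, x)|lebesgue_on (strip a b). f t x)"

definition loc_integrable :: "'a::euclidean_space set \<Rightarrow> ('a \<Rightarrow> real) \<Rightarrow> bool" where
  "loc_integrable S f \<longleftrightarrow> (\<forall>K\<subseteq>S. compact K \<longrightarrow> integrable (lebesgue_on K) f)"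

definition has_weak_deriv :: "real set \<Rightarrow> (real \<Rightarrow> real) \<Rightarrow> (real \<Rightarrow> real) \<Rightarrow> bool" where
  "has_weak_deriv I f g \<longleftrightarrow> loc_integrable I f \<and> loc_integrable I g \<and>
     (\<forall>\<phi>. C0_infinity I \<phi> \<longrightarrow>
        (LINT x|lebesgue_on I. f x * deriv \<phi> x) = - (LINT x|lebesgue_on I. g x * \<phi> x))"

text \<open>Weak derivative in space of a function on \<open>(0, \<infinity>) \<times> \<real>\<close>.\<close>

definition has_weak_dx ::
    "(real \<Rightarrow> real \<Rightarrow> real) \<Rightarrow> (real \<Rightarrow> real \<Rightarrow> real) \<Rightarrow> bool" where
  "has_weak_dx f g \<longleftrightarrow>
     loc_integrable ({0<..} \<times> UNIV) (case_prod f) \<and> loc_integrable ({0<..} \<times> UNIV) (case_prod g) \<and>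
     (\<forall>\<phi>. C0_infinity ({0<..} \<times> UNIV) (case_prod \<phi>) \<longrightarrow>
        (LINT (t, x)|lebesgue_on ({0<..} \<times> UNIV). f t x * dx \<phi> t x)
          = - (LINT (t, x)|lebesgue_on ({0<..} \<times> UNIV). g t x * \<phi> t x))"

text \<open>
  A representative of the weak derivative, which is unique up to null sets. It is only meaningful
  if the weak derivative exists; this is always stated separately.
\<close>

definition weak_dx :: "(real \<Rightarrow> real \<Rightarrow> real) \<Rightarrow> real \<Rightarrow> real \<Rightarrow> real" where
  "weak_dx f = (SOME g. has_weak_dx f g)"

definition L2_on :: "'a::euclidean_space set \<Rightarrow> ('a \<Rightarrow> real) \<Rightarrow> bool" where
  "L2_on S f \<longleftrightarrow>
     f \<in> borel_measurable (lebesgue_on S) \<and> integrable (lebesgue_on S) (\<lambda>p. (f p)\<^sup>2)"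

definition Linf_Linf :: "real \<Rightarrow> (real \<Rightarrow> real \<Rightarrow> real) \<Rightarrow> bool" where
  "Linf_Linf T f \<longleftrightarrow> case_prod f \<in> borel_measurable (lebesgue_on (strip 0 T)) \<and>
     (\<exists>C. AE t in lebesgue_on {0<..<T}. AE x in lebesgue. \<bar>f t x\<bar> \<le> C)"

definition Linf_L2 :: "real \<Rightarrow> (real \<Rightarrow> real \<Rightarrow> real) \<Rightarrow> bool" where
  "Linf_L2 T f \<longleftrightarrow> case_prod f \<in> borel_measurable (lebesgue_on (strip 0 T)) \<and>
     (\<exists>C. AE t in lebesgue_on {0<..<T}. L2_on UNIV (f t) \<and> (LINT x|lebesgue. (f t x)\<^sup>2) \<le> C)"

text \<open>The unit ball of \<open>W\<^sup>1\<^sup>,\<^sup>\<infinity>([a, b])\<close> with norm \<open>ess sup \<bar>\<phi>\<bar> + ess sup \<bar>\<phi>'\<bar>\<close>.\<close>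

definition W1inf_unit_ball :: "real \<Rightarrow> real \<Rightarrow> (real \<Rightarrow> real) set" where
  "W1inf_unit_ball a b = {\<phi>. \<exists>d A B. has_weak_deriv {a<..<b} \<phi> d \<and>
     (AE x in lebesgue_on {a<..<b}. \<bar>\<phi> x\<bar> \<le> A) \<and> (AE x in lebesgue_on {a<..<b}. \<bar>d x\<bar> \<le> B) \<and>
     A + B \<le> 1}"

text \<open>Continuity in time with values in the dual of \<open>W\<^sup>1\<^sup>,\<^sup>\<infinity>([a, b])\<close>, in the operator norm.\<close>

definition continuous_W1inf_dual :: "real \<Rightarrow> real \<Rightarrow> (real \<Rightarrow> real \<Rightarrow> real) \<Rightarrow> bool" where
  "continuous_W1inf_dual a b f \<longleftrightarrow>
     (\<forall>t\<ge>0. integrable (lebesgue_on {a..b}) (f t)) \<and>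
     (\<forall>t\<ge>0. \<forall>\<epsilon>>0. \<exists>\<delta>>0. \<forall>s\<ge>0. \<bar>s - t\<bar> < \<delta> \<longrightarrow>
        (\<forall>\<phi>\<in>W1inf_unit_ball a b.
           \<bar>(LINT x|lebesgue_on {a..b}. f s x * \<phi> x) - (LINT x|lebesgue_on {a..b}. f t x * \<phi> x)\<bar> \<le> \<epsilon>))"


section \<open>The smooth rarefaction wave\<close>

definition pressure :: "real \<Rightarrow> real \<Rightarrow> real" where
  "pressure \<gamma> r = r powr \<gamma>"

definition lambda2 :: "real \<Rightarrow> real \<Rightarrow> real \<Rightarrow> real" where
  "lambda2 \<gamma> r v = v + sqrt (deriv (pressure \<gamma>) r)"

definition Sigma2 :: "real \<Rightarrow> real \<Rightarrow> real \<Rightarrow> real" where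
  "Sigma2 \<gamma> r v = v - (LBINT s=0..ereal r. sqrt (deriv (pressure \<gamma>) s) / s)"

definition two_rarefaction :: "real \<Rightarrow> real \<Rightarrow> real \<Rightarrow> real \<Rightarrow> real \<Rightarrow> bool" where
  "two_rarefaction \<gamma> rm um rp up \<longleftrightarrow>
     Sigma2 \<gamma> rm um = Sigma2 \<gamma> rp up \<and> lambda2 \<gamma> rm um < lambda2 \<gamma> rp up"

definition Kq :: "real \<Rightarrow> real" where
  "Kq q = 1 / (LBINT y=0..\<infinity>. (1 + y\<^sup>2) powr (- q))"

definition burgers_data :: "real \<Rightarrow> real \<Rightarrow> real \<Rightarrow> real \<Rightarrow> real \<Rightarrow> real" where
  "burgers_data wm wp q \<eta> x = (wp + wm) / 2 +
     (wp - wm) / 2 * (Kq q * (LBINT y=0..ereal (\<eta> * x). (1 + y\<^sup>2) powr (- q)))"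

text \<open>
  For \<open>wm < wp\<close> the data are increasing, and the method of characteristics shows that exactly one
  function on \<open>[0, \<infinity>) \<times> \<real>\<close> has this property.
\<close>

definition smooth_burgers_solution ::
    "real \<Rightarrow> real \<Rightarrow> real \<Rightarrow> real \<Rightarrow> (real \<Rightarrow> real \<Rightarrow> real) \<Rightarrow> bool" where
  "smooth_burgers_solution wm wp q \<eta> w \<longleftrightarrow>
     smooth_on ({0..} \<times> UNIV) (case_prod w) \<and>
     (\<forall>t>0. \<forall>x. dt w t x + w t x * dx w t x = 0) \<and>
     (\<forall>x. w 0 x = burgers_data wm wp q \<eta> x)"

text \<open>
  Positivity of \<open>\<rho>\<^sub>b\<close> selects the physical root: \<open>lambda2 - Sigma2\<close> is a strictly increasing function
  of the density on \<open>(0, \<infinity>)\<close>. Only the values at times \<open>t \<ge> 0\<close> matter.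
\<close>

definition smooth_rarefaction_wave ::
    "real \<Rightarrow> real \<Rightarrow> real \<Rightarrow> real \<Rightarrow> real \<Rightarrow> real \<Rightarrow> real \<Rightarrow>
     (real \<Rightarrow> real \<Rightarrow> real) \<Rightarrow> (real \<Rightarrow> real \<Rightarrow> real) \<Rightarrow> bool" where
  "smooth_rarefaction_wave \<gamma> rm um rp up q \<eta> \<rho>\<^sub>b u\<^sub>b \<longleftrightarrow>
     (\<exists>w. smooth_burgers_solution (lambda2 \<gamma> rm um) (lambda2 \<gamma> rp up) q \<eta> w \<and>
        (\<forall>t\<ge>0. \<forall>x. \<rho>\<^sub>b t x > 0 \<and>
           lambda2 \<gamma> (\<rho>\<^sub>b t x) (u\<^sub>b t x) = w (1 + t) x \<and>
           Sigma2 \<gamma> (\<rho>\<^sub>b t x) (u\<^sub>b t x) = Sigma2 \<gamma> rm um \<and>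
           Sigma2 \<gamma> (\<rho>\<^sub>b t x) (u\<^sub>b t x) = Sigma2 \<gamma> rp up))"


section \<open>Weak solutions towards the rarefaction wave\<close>

text \<open>The product \<open>\<rho> \<Psi>(\<rho>, \<rho>\<^sub>b)\<close>.\<close>

definition rel_potential :: "real \<Rightarrow> real \<Rightarrow> real \<Rightarrow> real" where
  "rel_potential \<gamma> r rb =
     1 / (\<gamma> - 1) * (r powr \<gamma> - rb powr \<gamma> - \<gamma> * rb powr (\<gamma> - 1) * (r - rb))"

text \<open>The quantity \<open>\<surd>\<rho> (u - u\<^sub>b)\<close>; it vanishes where \<open>\<rho>\<close> does, whatever \<open>u\<close> is there.\<close>

definition wvel ::
    "(real \<Rightarrow> real \<Rightarrow> real) \<Rightarrow> (real \<Rightarrow> real \<Rightarrow> real) \<Rightarrow> (real \<Rightarrow> real \<Rightarrow> real) \<Rightarrow>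
     real \<Rightarrow> real \<Rightarrow> real" where
  "wvel \<rho> u u\<^sub>b t x = sqrt (\<rho> t x) * (u t x - u\<^sub>b t x)"

definition rho_pow :: "real \<Rightarrow> (real \<Rightarrow> real \<Rightarrow> real) \<Rightarrow> real \<Rightarrow> real \<Rightarrow> real" where
  "rho_pow a \<rho> t x = \<rho> t x powr a"

text \<open>The pairing \<open>\<langle>\<rho>\<^sup>\<alpha> (u - u\<^sub>b)\<^sub>x, \<phi>\<rangle>\<close> on \<open>(0, T) \<times> \<real>\<close>.\<close>

definition visc_pairing ::
    "real \<Rightarrow> real \<Rightarrow> (real \<Rightarrow> real \<Rightarrow> real) \<Rightarrow> (real \<Rightarrow> real \<Rightarrow> real) \<Rightarrow> (real \<Rightarrow> real \<Rightarrow> real) \<Rightarrow>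
     (real \<Rightarrow> real \<Rightarrow> real) \<Rightarrow> real" where
  "visc_pairing \<alpha> T \<rho> u u\<^sub>b \<phi> =
     - int_strip 0 T (\<lambda>t x. rho_pow (\<alpha> - 1/2) \<rho> t x * wvel \<rho> u u\<^sub>b t x * dx \<phi> t x)
     - 2 * \<alpha> / (2 * \<alpha> - 1) *
       int_strip 0 T (\<lambda>t x. weak_dx (rho_pow (\<alpha> - 1/2) \<rho>) t x * wvel \<rho> u u\<^sub>b t x * \<phi> t x)"

definition solution_class ::
    "real \<Rightarrow> (real \<Rightarrow> real \<Rightarrow> real) \<Rightarrow> (real \<Rightarrow> real) \<Rightarrow>
     (real \<Rightarrow> real \<Rightarrow> real) \<Rightarrow> (real \<Rightarrow> real \<Rightarrow> real) \<Rightarrow> bool" where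
  "solution_class \<alpha> u\<^sub>b \<rho>0 \<rho> u \<longleftrightarrow>
     (AE (t, x) in lebesgue_on ({0<..} \<times> UNIV). \<rho> t x \<ge> 0) \<and>
     (AE x in lebesgue. \<rho> 0 x = \<rho>0 x) \<and>
     (\<exists>g. has_weak_dx (rho_pow (\<alpha> - 1/2) \<rho>) g) \<and>
     (\<forall>T>0. Linf_Linf T \<rho> \<and>
        Linf_L2 T (weak_dx (rho_pow (\<alpha> - 1/2) \<rho>)) \<and>
        Linf_L2 T (wvel \<rho> u u\<^sub>b)) \<and>
     (\<forall>a b. a < b \<longrightarrow> continuous_W1inf_dual a b \<rho>)"

text \<open>In the flux, \<open>\<rho> u\<close> stands for \<open>\<surd>\<rho> [\<surd>\<rho> (u - u\<^sub>b)] + \<rho> u\<^sub>b\<close>.\<close>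

definition weak_mass_equation ::
    "(real \<Rightarrow> real \<Rightarrow> real) \<Rightarrow> (real \<Rightarrow> real \<Rightarrow> real) \<Rightarrow>
     (real \<Rightarrow> real \<Rightarrow> real) \<Rightarrow> (real \<Rightarrow> real \<Rightarrow> real) \<Rightarrow> bool" where
  "weak_mass_equation \<rho>\<^sub>b u\<^sub>b \<rho> u \<longleftrightarrow>
     (\<forall>t1 t2 \<zeta>. 0 \<le> t1 \<longrightarrow> t1 \<le> t2 \<longrightarrow> C01 ({t1..t2} \<times> UNIV) (case_prod \<zeta>) \<longrightarrow>
        (LINT x|lebesgue. (\<rho> t2 x - \<rho>\<^sub>b t2 x) * \<zeta> t2 x)
          - (LINT x|lebesgue. (\<rho> t1 x - \<rho>\<^sub>b t1 x) * \<zeta> t1 x)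
        = int_strip t1 t2 (\<lambda>t x.
            (\<rho> t x - \<rho>\<^sub>b t x) * dt \<zeta> t x
            + ((sqrt (\<rho> t x) * wvel \<rho> u u\<^sub>b t x + \<rho> t x * u\<^sub>b t x) - \<rho>\<^sub>b t x * u\<^sub>b t x) * dx \<zeta> t x))"

definition weak_momentum_equation ::
    "real \<Rightarrow> real \<Rightarrow> (real \<Rightarrow> real \<Rightarrow> real) \<Rightarrow> (real \<Rightarrow> real \<Rightarrow> real) \<Rightarrow> (real \<Rightarrow> real) \<Rightarrow>
     (real \<Rightarrow> real \<Rightarrow> real) \<Rightarrow> (real \<Rightarrow> real \<Rightarrow> real) \<Rightarrow> bool" where
  "weak_momentum_equation \<alpha> \<gamma> \<rho>\<^sub>b u\<^sub>b m0 \<rho> u \<longleftrightarrow>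
     (\<forall>T \<psi>. 0 < T \<longrightarrow> C0_infinity ({0..<T} \<times> UNIV) (case_prod \<psi>) \<longrightarrow>
        (LINT x|lebesgue. (m0 x - \<rho>\<^sub>b 0 x * u\<^sub>b 0 x) * \<psi> 0 x)
        + int_strip 0 T (\<lambda>t x.
            (sqrt (\<rho> t x) * wvel \<rho> u u\<^sub>b t x + (\<rho> t x - \<rho>\<^sub>b t x) * u\<^sub>b t x) * dt \<psi> t x)
        + int_strip 0 T (\<lambda>t x.
            ((wvel \<rho> u u\<^sub>b t x)\<^sup>2 + 2 * sqrt (\<rho> t x) * wvel \<rho> u u\<^sub>b t x * u\<^sub>b t x
              + (\<rho> t x - \<rho>\<^sub>b t x) * (u\<^sub>b t x)\<^sup>2 + \<rho> t x powr \<gamma> - \<rho>\<^sub>b t x powr \<gamma>) * dx \<psi> t x)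
        - visc_pairing \<alpha> T \<rho> u u\<^sub>b (dx \<psi>)
        - int_strip 0 T (\<lambda>t x. \<rho> t x powr \<alpha> * dx u\<^sub>b t x * dx \<psi> t x) = 0)"

definition weak_solution_towards ::
    "real \<Rightarrow> real \<Rightarrow> (real \<Rightarrow> real \<Rightarrow> real) \<Rightarrow> (real \<Rightarrow> real \<Rightarrow> real) \<Rightarrow> (real \<Rightarrow> real) \<Rightarrow> (real \<Rightarrow> real) \<Rightarrow>
     (real \<Rightarrow> real \<Rightarrow> real) \<Rightarrow> (real \<Rightarrow> real \<Rightarrow> real) \<Rightarrow> bool" where
  "weak_solution_towards \<alpha> \<gamma> \<rho>\<^sub>b u\<^sub>b \<rho>0 m0 \<rho> u \<longleftrightarrow>
     solution_class \<alpha> u\<^sub>b \<rho>0 \<rho> u \<and>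
     weak_mass_equation \<rho>\<^sub>b u\<^sub>b \<rho> u \<and>
     weak_momentum_equation \<alpha> \<gamma> \<rho>\<^sub>b u\<^sub>b m0 \<rho> u"

definition admissible_data ::
    "real \<Rightarrow> real \<Rightarrow> real \<Rightarrow> real \<Rightarrow> real \<Rightarrow> real \<Rightarrow> (real \<Rightarrow> real) \<Rightarrow> (real \<Rightarrow> real) \<Rightarrow>
     (real \<Rightarrow> real) \<Rightarrow> (real \<Rightarrow> real) \<Rightarrow> bool" where
  "admissible_data \<alpha> \<gamma> rm um rp up \<rho>\<^sub>b0 u\<^sub>b0 \<rho>0 m0 \<longleftrightarrow>
     \<rho>0 \<in> borel_measurable lebesgue \<and> m0 \<in> borel_measurable lebesgue \<and>
     (\<rho>0 \<longlongrightarrow> rm) at_bot \<and> (m0 \<longlongrightarrow> rm * um) at_bot \<and>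
     (\<rho>0 \<longlongrightarrow> rp) at_top \<and> (m0 \<longlongrightarrow> rp * up) at_top \<and>
     (AE x in lebesgue. \<rho>0 x \<ge> 0) \<and>
     (AE x in lebesgue. \<rho>0 x = 0 \<longrightarrow> m0 x = 0) \<and>
     (\<exists>g. has_weak_deriv UNIV (\<lambda>x. \<rho>0 x powr (\<alpha> - 1/2)) g \<and> L2_on UNIV g) \<and>
     integrable lebesgue (\<lambda>x. rel_potential \<gamma> (\<rho>0 x) (\<rho>\<^sub>b0 x)) \<and>
     integrable lebesgue (\<lambda>x. \<rho>0 x * (m0 x / \<rho>0 x - u\<^sub>b0 x) ^ 2) \<and>
     integrable lebesgue (\<lambda>x. \<rho>0 x * (m0 x / \<rho>0 x - u\<^sub>b0 x) ^ 3)"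

text \<open>
  The supremum over time of the energy is an essential supremum, since \<open>u\<close> and the weak derivative
  are only determined almost everywhere.
\<close>

definition uniform_bound ::
    "real \<Rightarrow> real \<Rightarrow> (real \<Rightarrow> real \<Rightarrow> real) \<Rightarrow> (real \<Rightarrow> real \<Rightarrow> real) \<Rightarrow>
     (real \<Rightarrow> real \<Rightarrow> real) \<Rightarrow> (real \<Rightarrow> real \<Rightarrow> real) \<Rightarrow> real \<Rightarrow> real \<Rightarrow> bool" where
  "uniform_bound \<alpha> \<gamma> \<rho>\<^sub>b u\<^sub>b \<rho> u C T \<longleftrightarrow>
     continuous_on (strip 0 T) (case_prod \<rho>) \<and>
     (\<forall>t\<in>{0..T}. \<forall>x. 0 \<le> \<rho> t x \<and> \<rho> t x \<le> C) \<and>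
     (\<exists>g. has_weak_dx (\<lambda>t x. rho_pow ((\<gamma> + \<alpha> - 1) / 2) \<rho> t x - rho_pow ((\<gamma> + \<alpha> - 1) / 2) \<rho>\<^sub>b t x) g) \<and>
     (\<exists>\<Lambda>. L2_on (strip 0 T) (case_prod \<Lambda>) \<and>
        (\<forall>\<phi>. C0_infinity (strip 0 T) (case_prod \<phi>) \<longrightarrow>
           int_strip 0 T (\<lambda>t x. \<Lambda> t x * \<phi> t x) = visc_pairing \<alpha> T \<rho> u u\<^sub>b \<phi>) \<and>
        (AE t in lebesgue_on {0<..<T}.
           (\<integral>\<^sup>+ x. ennreal (\<bar>wvel \<rho> u u\<^sub>b t x\<bar>\<^sup>2 + (weak_dx (rho_pow (\<alpha> - 1/2) \<rho>) t x)\<^sup>2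
                + rel_potential \<gamma> (\<rho> t x) (\<rho>\<^sub>b t x)) \<partial>lebesgue)
           + (\<integral>\<^sup>+ (t, x). ennreal
                ((weak_dx (\<lambda>t x. rho_pow ((\<gamma> + \<alpha> - 1) / 2) \<rho> t x
                                 - rho_pow ((\<gamma> + \<alpha> - 1) / 2) \<rho>\<^sub>b t x) t x)\<^sup>2
                 + (\<Lambda> t x)\<^sup>2) \<partial>lebesgue_on (strip 0 T))
           \<le> ennreal C))"

end

theory Submission
  imports Defs
begin

text \<open>
  Write \<open>d = \<rho> - \<rho>\<^sub>b\<close> and \<open>v = \<rho>\<^sup>\<kappa> - \<rho>\<^sub>b\<^sup>\<kappa>\<close> with \<open>\<kappa> = (\<gamma> + \<alpha> - 1) / 2\<close>. The bound on the spatial derivative of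
  \<open>\<rho>\<^sup>\<alpha>\<^sup>-\<^sup>1\<^sup>/\<^sup>2\<close> makes \<open>\<rho>\<close> equicontinuous in space uniformly in time, and so is \<open>\<rho>\<^sub>b\<close>, because the solution of
  Burgers' equation with increasing data stays between \<open>w\<^sub>-\<close> and \<open>w\<^sub>+\<close> and is no steeper than its data. The mass
  equation makes local averages of \<open>d\<close> Lipschitz in time. Hence if \<open>\<bar>d(t, x)\<bar> \<ge> \<delta>\<close> at some point, then
  \<open>\<bar>d\<bar> \<ge> \<delta> / 4\<close>, with constant sign, on a space-time box at \<open>(t, x)\<close> whose size depends only on \<open>\<delta>\<close>; on this
  box \<open>\<bar>v\<bar>\<close> is bounded below. On the other hand the integral of the relative potential is bounded, so
  averages of \<open>v\<close> over long intervals are small. The integral of \<open>(v\<^sub>x)\<^sup>2\<close> over the time window of the box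
  is therefore bounded below, which is impossible for large \<open>t\<close> because \<open>v\<^sub>x\<close> is square integrable on the
  half plane.
\<close>

section \<open>Smooth test functions\<close>

text \<open>Neither \<open>u\<close> nor the spatial derivatives of powers of \<open>\<rho>\<close>
  are known pointwise; they enter through integrals against smooth test functions. The fundamental
  theorem of calculus therefore takes the form of a test with \<open>plateau\<close>: its derivative
  is a difference of two mollifiers of unit mass, so pairing it with a weak derivative yields a
  difference of two averages. As these weak derivatives live in space-time, each such estimate also
  needs a time window of positive length, and pointwise lower bounds must first be shown to persist
  in time. For equicontinuity an arbitrarily short window suffices: the energy bound holds at almost
  every time, and the window length cancels. For the decay the length must not depend on
  \<open>t\<close>, because the dissipation is only integrable in time; mere continuity of
  \<open>\<rho>\<close> gives no such uniform length, which is why the mass equation enters.\<close>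

lemma Ck_on_subset:
  assumes "Ck_on n S f" "T \<subseteq> S"
  shows "Ck_on n T f"
  using assms(1)
proof (induction n arbitrary: f)
  case 0
  then show ?case using assms(2) continuous_on_subset by auto
next
  case (Suc n)
  then show ?case
    using assms(2) by (simp, meson has_derivative_subset subsetD)
qed

lemma Ck_on_lower: "Ck_on (Suc n) S f \<Longrightarrow> Ck_on n S f"
proof (induction n arbitrary: f)
  case 0
  then show ?case
    by (auto simp: continuous_on_eq_continuous_within intro: has_derivative_continuous)
next
  case (Suc n)
  then obtain D where D: "\<forall>p\<in>S. (f has_derivative D p) (at p within S)"
    "\<And>h. Ck_on (Suc n) S (\<lambda>p. D p h)"
    by (metis Ck_on.simps(2))
  with Suc.IH show ?case by (simp only: Ck_on.simps(2)) blast
qed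

lemma Ck_on_const [simp]: "Ck_on n S (\<lambda>p. c)"
  by (induction n arbitrary: c) (auto intro!: exI[of _ "\<lambda>p h. 0"])

lemma Ck_on_add: "Ck_on n S f \<Longrightarrow> Ck_on n S g \<Longrightarrow> Ck_on n S (\<lambda>p. f p + g p)"
proof (induction n arbitrary: f g)
  case 0
  then show ?case by (auto intro: continuous_intros)
next
  case (Suc n)
  from Suc.prems obtain D E where
    D: "\<forall>p\<in>S. (f has_derivative D p) (at p within S)" "\<And>h. Ck_on n S (\<lambda>p. D p h)"
    and E: "\<forall>p\<in>S. (g has_derivative E p) (at p within S)" "\<And>h. Ck_on n S (\<lambda>p. E p h)"
    by auto
  then show ?case
    by (auto intro!: exI[of _ "\<lambda>p h. D p h + E p h"] Suc.IH has_derivative_add)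
qed

lemma Ck_on_mult: "Ck_on n S f \<Longrightarrow> Ck_on n S g \<Longrightarrow> Ck_on n S (\<lambda>p. f p * g p)"
proof (induction n arbitrary: f g)
  case 0
  then show ?case by (auto intro: continuous_intros)
next
  case (Suc n)
  from Suc.prems obtain D E where
    D: "\<forall>p\<in>S. (f has_derivative D p) (at p within S)" "\<And>h. Ck_on n S (\<lambda>p. D p h)"
    and E: "\<forall>p\<in>S. (g has_derivative E p) (at p within S)" "\<And>h. Ck_on n S (\<lambda>p. E p h)"
    by auto
  then show ?case
    using Suc.prems[THEN Ck_on_lower]
    by (auto intro!: exI[of _ "\<lambda>p h. f p * E p h + D p h * g p"] Ck_on_add Suc.IH has_derivative_mult)
qed

text \<open>The derivative of the reciprocal contains the reciprocal itself, but one order of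
  regularity less is asked of it; hence the induction keeps \<open>f\<close> fixed.\<close>

lemma Ck_on_inverse:
  assumes "Ck_on n S f" "\<And>p. p \<in> S \<Longrightarrow> f p \<noteq> 0"
  shows "Ck_on n S (\<lambda>p. inverse (f p))"
  using assms
proof (induction n)
  case 0
  then show ?case by (auto intro: continuous_intros)
next
  case (Suc n)
  from Suc.prems obtain D where
    D: "\<forall>p\<in>S. (f has_derivative D p) (at p within S)" "\<And>h. Ck_on n S (\<lambda>p. D p h)"
    by auto
  moreover have "Ck_on n S (\<lambda>p. inverse (f p))"
    using Suc Ck_on_lower by blast
  ultimately show ?case
    using Suc.prems(2)
    by (auto intro!: exI[of _ "\<lambda>p h. (-1) * (inverse (f p) * D p h * inverse (f p))"]
        Ck_on_mult has_derivative_inverse[THEN has_derivative_eq_rhs])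
qed

lemma Ck_on_affine:
  assumes "Ck_on n UNIV f" "bounded_linear L"
  shows "Ck_on n UNIV (\<lambda>p. f (c + L p))"
  using assms(1)
proof (induction n arbitrary: f)
  case 0
  have "continuous_on UNIV (\<lambda>p. c + L p)"
    by (intro continuous_intros linear_continuous_on assms(2))
  then show ?case using 0 by (auto intro: continuous_on_compose2)
next
  case (Suc n)
  then obtain D where D: "\<And>p. (f has_derivative D p) (at p)" "\<And>h. Ck_on n UNIV (\<lambda>p. D p h)"
    by auto
  have "((\<lambda>p. c + L p) has_derivative L) (at p)" for p
    using bounded_linear_imp_has_derivative[OF assms(2)]
    by (auto intro!: derivative_eq_intros)
  from has_derivative_compose[OF this D(1)] show ?case
    using Suc.IH[OF D(2)] by (auto intro!: exI[of _ "\<lambda>p h. D (c + L p) (L h)"])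
qed

section \<open>A smooth step and its kernel\<close>

definition flat_fun :: "nat \<Rightarrow> real \<Rightarrow> real" where
  "flat_fun k x = (if x > 0 then exp (- inverse x) * inverse x ^ k else 0)"

lemma flat_fun_tendsto_0: "(flat_fun k \<longlongrightarrow> 0) (at 0)"
proof -
  have "((\<lambda>x. inverse x ^ k / exp (inverse x)) \<longlongrightarrow> 0) (at_right (0::real))"
    by (rule filterlim_compose[OF tendsto_power_div_exp_0 filterlim_inverse_at_top_right])
  then have "(flat_fun k \<longlongrightarrow> 0) (at_right 0)"
    by (rule Lim_transform_eventually)
      (auto simp: flat_fun_def exp_minus field_simps eventually_at_right_less
        intro!: eventually_mono[OF eventually_at_right_less])
  moreover have "(flat_fun k \<longlongrightarrow> 0) (at_left 0)"
    by (rule tendsto_eventually)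
      (auto simp: flat_fun_def eventually_at_filter)
  ultimately show ?thesis using filterlim_at_split by blast
qed

text \<open>For \<open>k = 0\<close> this is the classical function that is flat at the origin. The
  factor \<open>inverse x ^ k\<close> makes the family closed under differentiation up to linear
  combinations, so smoothness becomes an induction over all \<open>k\<close> at once.\<close>

lemma flat_fun_deriv:
  "(flat_fun k has_real_derivative flat_fun (k + 2) x - real k * flat_fun (k + 1) x) (at x)"
proof -
  consider "x < 0" | "x = 0" | "x > 0" by linarith
  then show ?thesis
  proof cases
    case 1
    have "((\<lambda>x. 0) has_real_derivative 0) (at x)" by simp
    then have "(flat_fun k has_real_derivative 0) (at x)"
      by (rule has_field_derivative_transform_within_open[of _ _ _ "{..<0}"])
        (use 1 in \<open>auto simp: flat_fun_def\<close>)
    then show ?thesis using 1 by (simp add: flat_fun_def)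
  next
    case 2
    \<comment> \<open>The difference quotient at 0 is exactly \<open>flat_fun (k + 1)\<close>:
      division by \<open>h\<close> adds one power of \<open>inverse h\<close>.\<close>
    have "((\<lambda>h. (flat_fun k (0 + h) - flat_fun k 0) / h) \<longlongrightarrow> 0) (at 0)"
      by (rule Lim_transform_eventually[OF flat_fun_tendsto_0[of "k + 1"]])
        (auto simp: flat_fun_def eventually_at_filter field_simps)
    then show ?thesis using 2 by (simp add: flat_fun_def DERIV_def)
  next
    case 3
    have "((\<lambda>x. exp (- inverse x) * inverse x ^ k) has_real_derivative
        exp (- inverse x) * inverse x ^ (k + 2)
        - real k * (exp (- inverse x) * inverse x ^ (k + 1))) (at x)"
      apply (rule derivative_eq_intros refl | use 3 in force)+
      using 3 by (cases k) (auto simp: field_simps power2_eq_square)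
    then have "(flat_fun k has_real_derivative
        exp (- inverse x) * inverse x ^ (k + 2)
        - real k * (exp (- inverse x) * inverse x ^ (k + 1))) (at x)"
      by (rule has_field_derivative_transform_within_open[of _ _ _ "{0<..}"])
        (use 3 in \<open>auto simp: flat_fun_def\<close>)
    then show ?thesis using 3 by (simp add: flat_fun_def)
  qed
qed

lemma Ck_on_flat_fun: "Ck_on n UNIV (flat_fun k)"
proof (induction n arbitrary: k)
  case 0
  then show ?case
    by (auto intro!: continuous_at_imp_continuous_on DERIV_isCont[OF flat_fun_deriv])
next
  case (Suc n)
  have "Ck_on n UNIV (\<lambda>p. (flat_fun (k + 2) p + (- real k) * flat_fun (k + 1) p) * h)" for h
    by (intro Ck_on_mult Ck_on_add Suc.IH Ck_on_const)
  then show ?case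
    using flat_fun_deriv[of k]
    by (auto simp: has_field_derivative_def
        intro!: exI[of _ "\<lambda>p h. (flat_fun (k + 2) p - real k * flat_fun (k + 1) p) * h"])
qed

definition smooth_step :: "real \<Rightarrow> real" where
  "smooth_step x = flat_fun 0 x * inverse (flat_fun 0 x + flat_fun 0 (1 - x))"

text \<open>Taking the kernel as a derivative gives it a known primitive, from which unit mass and
  the primitive of \<open>plateau\<close> type follow.\<close>

definition step_kernel :: "real \<Rightarrow> real" where
  "step_kernel = deriv smooth_step"

lemma flat_fun_sum_pos: "flat_fun 0 x + flat_fun 0 (1 - x) > 0"
proof -
  have "x > 0 \<or> 1 - x > 0" by linarith
  then show ?thesis
    by (auto simp: flat_fun_def intro: add_pos_nonneg add_nonneg_pos)
qed

lemma Ck_on_smooth_step: "Ck_on n UNIV smooth_step"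
proof -
  have "Ck_on n UNIV (\<lambda>x. flat_fun 0 (1 + (- x)))"
    by (rule Ck_on_affine[OF Ck_on_flat_fun bounded_linear_minus[OF bounded_linear_ident]])
  then have "Ck_on n UNIV (\<lambda>x. flat_fun 0 x * inverse (flat_fun 0 x + flat_fun 0 (1 - x)))"
    using flat_fun_sum_pos by (intro Ck_on_mult Ck_on_inverse Ck_on_add Ck_on_flat_fun) (auto simp: less_imp_neq[symmetric] dest: less_imp_neq)
  then show ?thesis by (simp add: smooth_step_def[abs_def])
qed

lemma smooth_step_eq_0: "x \<le> 0 \<Longrightarrow> smooth_step x = 0"
  by (simp add: smooth_step_def flat_fun_def)

lemma smooth_step_eq_1: "x \<ge> 1 \<Longrightarrow> smooth_step x = 1"
  using flat_fun_sum_pos[of x] by (simp add: smooth_step_def flat_fun_def)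

lemma smooth_step_deriv: "(smooth_step has_real_derivative step_kernel x) (at x)"
proof -
  obtain D where "\<And>x. (smooth_step has_derivative D x) (at x)"
    using Ck_on_smooth_step[of 1] by auto
  then have "smooth_step field_differentiable (at x)"
    using differentiable_def field_differentiable_def
    by (metis has_real_derivative)
  then show ?thesis
    by (simp add: step_kernel_def DERIV_deriv_iff_field_differentiable)
qed

lemma Ck_on_step_kernel: "Ck_on n UNIV step_kernel"
proof -
  obtain D where D: "\<And>x. (smooth_step has_derivative D x) (at x)" "Ck_on n UNIV (\<lambda>x. D x 1)"
    using Ck_on_smooth_step[of "Suc n"] by auto
  have "D x 1 = step_kernel x" for x
    using has_derivative_unique[OF D(1) smooth_step_deriv[of x, unfolded has_field_derivative_def]]
    by simp
  then show ?thesis using D(2) by simp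
qed

text \<open>In the quotient rule the terms with \<open>flat_fun 2 x * flat_fun 0 x\<close> cancel,
  and the two that remain are products of nonnegative factors.\<close>

lemma step_kernel_nonneg: "step_kernel x \<ge> 0"
proof -
  let ?g = "\<lambda>x. flat_fun 0 (1 - x)"
  have "(?g has_real_derivative - flat_fun 2 (1 - x)) (at x)"
  proof -
    have "((\<lambda>x. 1 - x) has_real_derivative - 1) (at x)"
      by (auto intro!: derivative_eq_intros)
    from DERIV_chain2[OF flat_fun_deriv[of 0] this] show ?thesis
      by (simp add: numeral_2_eq_2)
  qed
  moreover have "(flat_fun 0 has_real_derivative flat_fun 2 x) (at x)"
    using flat_fun_deriv[of 0 x] by (simp add: numeral_2_eq_2)
  ultimately have "((\<lambda>x. flat_fun 0 x / (flat_fun 0 x + ?g x)) has_real_derivative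
      (flat_fun 2 x * (flat_fun 0 x + ?g x) - flat_fun 0 x * (flat_fun 2 x - flat_fun 2 (1 - x)))
        / ((flat_fun 0 x + ?g x) * (flat_fun 0 x + ?g x))) (at x)"
    using flat_fun_sum_pos[of x] by (auto intro!: derivative_eq_intros)
  then have "step_kernel x =
      (flat_fun 2 x * (flat_fun 0 x + ?g x) - flat_fun 0 x * (flat_fun 2 x - flat_fun 2 (1 - x)))
        / ((flat_fun 0 x + ?g x) * (flat_fun 0 x + ?g x))"
    using DERIV_unique[OF smooth_step_deriv[of x]]
    by (simp add: smooth_step_def[abs_def] divide_inverse)
  also have "\<dots> = (flat_fun 2 x * ?g x + flat_fun 0 x * flat_fun 2 (1 - x))
        / ((flat_fun 0 x + ?g x) * (flat_fun 0 x + ?g x))"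
    by (simp add: algebra_simps)
  also have "\<dots> \<ge> 0"
    by (intro divide_nonneg_nonneg add_nonneg_nonneg mult_nonneg_nonneg) (auto simp: flat_fun_def)
  finally show ?thesis .
qed

lemma smooth_step_mono: "x \<le> y \<Longrightarrow> smooth_step x \<le> smooth_step y"
  using DERIV_nonneg_imp_nondecreasing smooth_step_deriv step_kernel_nonneg by blast

lemma smooth_step_bounds: "0 \<le> smooth_step x" "smooth_step x \<le> 1"
  using smooth_step_mono[of x "max x 1"] smooth_step_mono[of "min x 0" x]
  by (auto simp: smooth_step_eq_0 smooth_step_eq_1)

text \<open>The step is constant on the two open half lines; the points 0 and 1 follow because the
  zero set of a continuous function is closed.\<close>

lemma step_kernel_eq_0: "x \<le> 0 \<or> x \<ge> 1 \<Longrightarrow> step_kernel x = 0"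
proof -
  have cont: "continuous_on UNIV step_kernel"
    using Ck_on_step_kernel[of 0] by simp
  have *: "step_kernel y = 0" if "y \<in> {..<0} \<union> {1<..}" for y
  proof -
    have "(smooth_step has_real_derivative 0) (at y)"
      if "open T" "y \<in> T" "\<And>z. z \<in> T \<Longrightarrow> smooth_step z = c" for T c
      by (rule has_field_derivative_transform_within_open[OF DERIV_const[of c] that(1,2)])
        (simp add: that(3))
    from this[of "{..<0}" 0] this[of "{1<..}" 1] that
    have "(smooth_step has_real_derivative 0) (at y)"
      by (auto simp: smooth_step_eq_0 smooth_step_eq_1)
    then show ?thesis using DERIV_unique smooth_step_deriv by blast
  qed
  have closed: "closed {y. step_kernel y = 0}"
    using cont by (intro closed_Collect_eq continuous_on_const)
  then have "closure ({..<0} \<union> {1<..}) \<subseteq> {y. step_kernel y = 0}"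
    using * by (intro closure_minimal) auto
  then show "x \<le> 0 \<or> x \<ge> 1 \<Longrightarrow> step_kernel x = 0" by (auto simp: closure_Un)
qed

lemma step_kernel_bounded: obtains B where "B > 0" "\<And>x. step_kernel x \<le> B"
proof -
  have "compact (step_kernel ` {0..1})"
    by (intro compact_continuous_image continuous_on_subset[OF Ck_on_step_kernel[of 0, simplified]]) auto
  then obtain B where B: "\<And>x. x \<in> {0..1} \<Longrightarrow> \<bar>step_kernel x\<bar> \<le> B"
    by (force simp: bounded_iff dest!: compact_imp_bounded)
  have "step_kernel x \<le> \<bar>B\<bar> + 1" for x
    using B[of x] step_kernel_eq_0[of x] by (cases "x \<in> {0..1}") auto
  then show ?thesis using that[of "\<bar>B\<bar> + 1"] by auto
qed

section \<open>Scaled steps, mollifiers and plateaus\<close>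

definition scaled_step :: "real \<Rightarrow> real \<Rightarrow> real \<Rightarrow> real" where
  "scaled_step r a x = smooth_step ((x - a) / r)"

text \<open>The parameter \<open>a\<close> is the left end of the support, not its centre, so
  averages look to the right of \<open>a\<close>.\<close>

definition mollifier :: "real \<Rightarrow> real \<Rightarrow> real \<Rightarrow> real" where
  "mollifier r a x = step_kernel ((x - a) / r) / r"

lemma Ck_on_scaled: "Ck_on n UNIV f \<Longrightarrow> Ck_on n UNIV (\<lambda>x::real. f ((x - a) / r))"
  using Ck_on_affine[of n f "\<lambda>x. x / r" "- a / r"]
  by (simp add: bounded_linear_divide diff_divide_distrib add.commute)

lemma Ck_on_scaled_step: "Ck_on n UNIV (scaled_step r a)"
  unfolding scaled_step_def[abs_def] by (rule Ck_on_scaled[OF Ck_on_smooth_step])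

lemma Ck_on_mollifier: "Ck_on n UNIV (mollifier r a)"
  using Ck_on_mult[OF Ck_on_scaled[OF Ck_on_step_kernel] Ck_on_const, of n a r "1 / r"]
  by (simp add: mollifier_def[abs_def])

lemma scaled_step_deriv: "(scaled_step r a has_real_derivative mollifier r a x) (at x)"
proof -
  have "((\<lambda>x. (x - a) / r) has_real_derivative 1 / r) (at x)"
    by (cases "r = 0") (auto intro!: derivative_eq_intros)
  from DERIV_chain2[OF smooth_step_deriv this] show ?thesis
    by (simp add: scaled_step_def[abs_def] mollifier_def)
qed

lemma continuous_mollifier: "continuous_on A (mollifier r a)"
  using Ck_on_mollifier[of 0 r a] continuous_on_subset by auto

lemma mollifier_nonneg: "r > 0 \<Longrightarrow> mollifier r a x \<ge> 0"
  by (simp add: mollifier_def step_kernel_nonneg)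

lemma mollifier_eq_0: "r > 0 \<Longrightarrow> x \<notin> {a<..<a + r} \<Longrightarrow> mollifier r a x = 0"
  by (auto simp: mollifier_def step_kernel_eq_0 field_simps)

lemma scaled_step_eq_0: "r > 0 \<Longrightarrow> x \<le> a \<Longrightarrow> scaled_step r a x = 0"
  by (simp add: scaled_step_def smooth_step_eq_0 field_simps)

lemma scaled_step_eq_1: "r > 0 \<Longrightarrow> x \<ge> a + r \<Longrightarrow> scaled_step r a x = 1"
  by (simp add: scaled_step_def smooth_step_eq_1 field_simps)

lemma scaled_step_bounds: "0 \<le> scaled_step r a x" "scaled_step r a x \<le> 1"
  by (simp_all add: scaled_step_def smooth_step_bounds)

lemma has_bochner_integral_mollifier:
  assumes "r > 0"
  shows "has_bochner_integral lborel (mollifier r a) 1"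
proof -
  have "has_bochner_integral lborel (\<lambda>x. mollifier r a x * indicator {a..a + r} x)
      (scaled_step r a (a + r) - scaled_step r a a)"
    using assms continuous_mollifier[of UNIV r a]
    by (intro has_bochner_integral_FTC_Icc_real scaled_step_deriv)
      (auto simp: continuous_on_eq_continuous_at[OF open_UNIV])
  moreover have "mollifier r a x * indicator {a..a + r} x = mollifier r a x" for x
    using mollifier_eq_0[OF assms, of x a] by (fastforce simp: indicator_def)
  ultimately show ?thesis
    using assms by (simp add: scaled_step_eq_0 scaled_step_eq_1)
qed

text \<open>The antiderivative of the difference of two mollifiers has compact support.\<close>

definition plateau :: "real \<Rightarrow> real \<Rightarrow> real \<Rightarrow> real \<Rightarrow> real \<Rightarrow> real" where
  "plateau r a L b x = scaled_step r a x - scaled_step L b x"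

lemma Ck_on_plateau: "Ck_on n UNIV (plateau r a L b)"
  using Ck_on_add[OF Ck_on_scaled_step Ck_on_mult[OF Ck_on_const Ck_on_scaled_step], of n r a "-1" L b]
  by (simp add: plateau_def[abs_def])

lemma plateau_deriv: "(plateau r a L b has_real_derivative mollifier r a x - mollifier L b x) (at x)"
  unfolding plateau_def[abs_def] by (intro DERIV_diff scaled_step_deriv)

text \<open>To the right of both ramps the two steps equal 1 and cancel, whichever ramp comes
  first.\<close>

lemma plateau_eq_0:
  "r > 0 \<Longrightarrow> L > 0 \<Longrightarrow> x \<notin> {min a b..max (a + r) (b + L)} \<Longrightarrow> plateau r a L b x = 0"
  by (auto simp: plateau_def scaled_step_eq_0 scaled_step_eq_1)

lemma abs_plateau_le_1: "\<bar>plateau r a L b x\<bar> \<le> 1"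
  using scaled_step_bounds[of r a x] scaled_step_bounds[of L b x] by (simp add: plateau_def)

lemma plateau_nonneg:
  assumes "r > 0" "L > 0" "a + r \<le> b"
  shows "plateau r a L b x \<ge> 0"
  using assms scaled_step_bounds[of r a x] scaled_step_bounds[of L b x]
  by (cases "x \<le> b") (auto simp: plateau_def scaled_step_eq_0 scaled_step_eq_1)

lemma plateau_eq_1: "r > 0 \<Longrightarrow> L > 0 \<Longrightarrow> x \<in> {a + r..b} \<Longrightarrow> plateau r a L b x = 1"
  by (auto simp: plateau_def scaled_step_eq_0 scaled_step_eq_1)

lemma Ck_on_fst: "Ck_on n UNIV f \<Longrightarrow> Ck_on n UNIV (\<lambda>p::real \<times> real. f (fst p))"
  using Ck_on_affine[of n f fst 0] by (simp add: bounded_linear_fst)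

lemma Ck_on_snd: "Ck_on n UNIV f \<Longrightarrow> Ck_on n UNIV (\<lambda>p::real \<times> real. f (snd p))"
  using Ck_on_affine[of n f snd 0] by (simp add: bounded_linear_snd)

text \<open>The vanishing of \<open>\<theta>\<close> is asked only inside \<open>T\<close>. For a
  closed time interval \<open>T\<close> this admits a constant \<open>\<theta>\<close>, as in the
  test function for the mass equation.\<close>

lemma compact_support_tensor:
  fixes \<theta> \<phi> :: "real \<Rightarrow> real"
  assumes "{c..d} \<subseteq> T" "\<And>t. t \<in> T \<Longrightarrow> t \<notin> {c..d} \<Longrightarrow> \<theta> t = 0" "\<And>x. x \<notin> {a..b} \<Longrightarrow> \<phi> x = 0"
  shows "compact_support_in (T \<times> UNIV) (\<lambda>(t, x). \<theta> t * \<phi> x)"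
  unfolding compact_support_in_def
  using assms by (intro exI[of _ "{c..d} \<times> {a..b}"]) (fastforce simp: compact_Times simp del: atLeastAtMost_iff)

lemma C0_infinity_tensor:
  fixes \<theta> \<phi> :: "real \<Rightarrow> real"
  assumes "\<And>n. Ck_on n UNIV \<theta>" "\<And>n. Ck_on n UNIV \<phi>"
    and "{c..d} \<subseteq> T" "\<And>t. t \<in> T \<Longrightarrow> t \<notin> {c..d} \<Longrightarrow> \<theta> t = 0" "\<And>x. x \<notin> {a..b} \<Longrightarrow> \<phi> x = 0"
  shows "C0_infinity (T \<times> UNIV) (\<lambda>(t, x). \<theta> t * \<phi> x)"
  using compact_support_tensor[of c d T \<theta> a b \<phi>, OF assms(3-5)]
    Ck_on_subset[OF Ck_on_mult[OF Ck_on_fst[OF assms(1)] Ck_on_snd[OF assms(2)]] subset_UNIV]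
  by (simp add: C0_infinity_def smooth_on_def split_beta')

section \<open>Integration over the plane\<close>

text \<open>Tonelli holds for the Borel product, while \<open>f\<close> is only Lebesgue measurable
  in the plane; a Borel representative agrees with it on almost every slice. Working with an upper
  bound \<open>c\<close> avoids any claim on the measurability of the slice integrals of
  \<open>f\<close>.\<close>

lemma nn_integral_lebesgue_le_iterated:
  fixes f :: "real \<times> real \<Rightarrow> ennreal"
  assumes "f \<in> borel_measurable lebesgue"
    and "AE t in lborel. (\<integral>\<^sup>+ x. f (t, x) \<partial>lebesgue) \<le> c t"
  shows "(\<integral>\<^sup>+ p. f p \<partial>lebesgue) \<le> (\<integral>\<^sup>+ t. c t \<partial>lborel)"
proof -
  obtain g where g: "g \<in> borel_measurable lborel" "AE p in lborel. f p = g p"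
    using completion_ex_borel_measurable[OF assms(1)] by auto
  have gm: "g \<in> borel_measurable (lborel \<Otimes>\<^sub>M lborel)"
    using g(1) by (simp add: lborel_prod)
  have "AE p in lborel \<Otimes>\<^sub>M lborel. f p = g p"
    using g(2) by (subst lborel_prod)
  then have AE: "AE t in lborel. AE x in lborel. f (t, x) = g (t, x)"
    by (rule lborel_pair.AE_pair)
  have "(\<integral>\<^sup>+ p. f p \<partial>lebesgue) = (\<integral>\<^sup>+ p. g p \<partial>lborel)"
    using g(2) by (simp add: nn_integral_completion cong: nn_integral_cong_AE)
  also have "\<dots> = (\<integral>\<^sup>+ t. \<integral>\<^sup>+ x. g (t, x) \<partial>lborel \<partial>lborel)"
    using lborel.nn_integral_fst[OF gm] by (simp add: lborel_prod)
  also have "\<dots> \<le> (\<integral>\<^sup>+ t. c t \<partial>lborel)"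
  proof (rule nn_integral_mono_AE)
    show "AE t in lborel. (\<integral>\<^sup>+ x. g (t, x) \<partial>lborel) \<le> c t"
      using AE assms(2)
    proof eventually_elim
      case (elim t)
      then have "(\<integral>\<^sup>+ x. g (t, x) \<partial>lborel) = (\<integral>\<^sup>+ x. f (t, x) \<partial>lborel)"
        by (intro nn_integral_cong_AE) auto
      then show ?case using elim by (simp add: nn_integral_completion)
    qed
  qed
  finally show ?thesis .
qed

text \<open>For a function that is not integrable the left side is 0 by convention, so the bound can
  be used before integrability is known.\<close>

lemma abs_integral_le_nn_integral:
  fixes f :: "'a \<Rightarrow> real"
  shows "ennreal \<bar>integral\<^sup>L M f\<bar> \<le> (\<integral>\<^sup>+ x. ennreal \<bar>f x\<bar> \<partial>M)"
  using integral_norm_bound_ennreal[of M f]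
  by (cases "integrable M f") (auto simp: not_integrable_integral_eq)

text \<open>The cut-offs confine everything to a compact box inside the strip. There
  \<open>f\<close> is continuous, hence integrable, even if it is unbounded near the edge of
  \<open>T\<close>, and Fubini applies to the product extended by 0.\<close>

lemma integral_tensor_lebesgue_on:
  fixes f :: "real \<Rightarrow> real \<Rightarrow> real" and \<theta> \<kappa> :: "real \<Rightarrow> real"
  assumes T: "open T" "{c..d} \<subseteq> T" and f: "continuous_on (T \<times> UNIV) (case_prod f)"
    and \<theta>: "continuous_on UNIV \<theta>" "\<And>t. t \<notin> {c..d} \<Longrightarrow> \<theta> t = 0"
    and \<kappa>: "continuous_on UNIV \<kappa>" "\<And>x. x \<notin> {a..b} \<Longrightarrow> \<kappa> x = 0"
  shows "integrable lborel (\<lambda>t. \<theta> t * (LINT x|lborel. f t x * \<kappa> x))" (is ?I)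
    and "(LINT (t, x)|lebesgue_on (T \<times> UNIV). f t x * (\<theta> t * \<kappa> x))
        = (LINT t|lborel. \<theta> t * (LINT x|lborel. f t x * \<kappa> x))" (is ?E)
proof -
  let ?B = "{c..d} \<times> {a..b}"
  define h where "h p = indicator ?B p *\<^sub>R (f (fst p) (snd p) * (\<theta> (fst p) * \<kappa> (snd p)))" for p
  have "continuous_on ?B (\<lambda>p. f (fst p) (snd p) * (\<theta> (fst p) * \<kappa> (snd p)))"
    using T(2) by (intro continuous_intros continuous_on_subset[OF f[unfolded split_beta']]
        continuous_on_compose2[OF \<theta>(1)] continuous_on_compose2[OF \<kappa>(1)]) auto
  then have h: "integrable lborel h"
    unfolding h_def by (intro borel_integrable_compact) (auto simp: compact_Times)
  then have hp: "integrable (lborel \<Otimes>\<^sub>M lborel) h"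
    by (simp add: lborel_prod)
  have inner: "(LINT x|lborel. h (t, x)) = \<theta> t * (LINT x|lborel. f t x * \<kappa> x)" for t
  proof -
    have "h (t, x) = \<theta> t * (f t x * \<kappa> x)" for x
      using \<theta>(2)[of t] \<kappa>(2)[of x] by (auto simp: h_def indicator_def)
    then show ?thesis by simp
  qed
  show ?I using lborel_pair.integrable_fst'[OF hp] by (simp add: inner)
  have "open (T \<times> (UNIV :: real set))" by (simp add: T(1) open_Times)
  then have "(LINT (t, x)|lebesgue_on (T \<times> UNIV). f t x * (\<theta> t * \<kappa> x))
      = (LINT p|lebesgue. indicator (T \<times> UNIV) p *\<^sub>R (case p of (t, x) \<Rightarrow> f t x * (\<theta> t * \<kappa> x)))"
    by (intro integral_restrict_space) auto
  also have "\<dots> = (LINT p|lebesgue. h p)"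
    using T(2) \<theta>(2) \<kappa>(2) by (intro Bochner_Integration.integral_cong) (fastforce simp: h_def indicator_def simp del: atLeastAtMost_iff)+
  also have "\<dots> = integral\<^sup>L (lborel \<Otimes>\<^sub>M lborel) h"
    using h by (simp add: integral_completion lborel_prod)
  also have "\<dots> = (LINT t|lborel. LINT x|lborel. h (t, x))"
    using lborel_pair.integral_fst'[OF hp] by simp
  finally show ?E by (simp add: inner)
qed

section \<open>The smooth rarefaction wave\<close>

text \<open>Comparison with the derivative of \<open>arctan\<close>, whose limits at both ends are
  finite.\<close>

lemma integrable_one_plus_square_powr:
  assumes "q \<ge> 1"
  shows "integrable lborel (\<lambda>y::real. (1 + y\<^sup>2) powr (- q))"
proof (rule Bochner_Integration.integrable_bound)
  have "set_integrable lborel (einterval (-\<infinity>) \<infinity>) (\<lambda>y::real. 1 / (1 + y\<^sup>2))"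
  proof (rule interval_integral_FTC_nonneg(1))
    show "DERIV arctan x :> 1 / (1 + x\<^sup>2)" for x
      using DERIV_arctan[of x] by (simp add: inverse_eq_divide)
    show "isCont (\<lambda>y::real. 1 / (1 + y\<^sup>2)) x" for x
      by (intro continuous_intros) (simp add: add_pos_nonneg less_imp_neq[symmetric] sum_power2_eq_zero_iff add_nonneg_eq_0_iff)
    show "((arctan \<circ> real_of_ereal) \<longlongrightarrow> - pi / 2) (at_right (-\<infinity>))"
      by (simp add: ereal_tendsto_simps1 tendsto_arctan_at_bot)
    show "((arctan \<circ> real_of_ereal) \<longlongrightarrow> pi / 2) (at_left \<infinity>)"
      by (simp add: ereal_tendsto_simps1 tendsto_arctan_at_top)
  qed auto
  then show "integrable lborel (\<lambda>y::real. 1 / (1 + y\<^sup>2))"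
    by (simp add: set_integrable_def)
  show "AE y in lborel. norm ((1 + y\<^sup>2) powr (- q)) \<le> norm (1 / (1 + y\<^sup>2))"
  proof (rule AE_I2)
    fix y :: real
    have "(1 + y\<^sup>2) powr (- q) \<le> (1 + y\<^sup>2) powr (- 1)"
      using assms by (intro powr_mono) auto
    then show "norm ((1 + y\<^sup>2) powr (- q)) \<le> norm (1 / (1 + y\<^sup>2))"
      by (simp add: powr_minus_divide)
  qed
qed measurable

lemma interval_lebesgue_integrable_of_integrable:
  assumes "integrable lborel f"
  shows "interval_lebesgue_integrable lborel a b (f :: real \<Rightarrow> real)"
  unfolding interval_lebesgue_integrable_def set_integrable_def
  using integrable_mult_indicator[OF _ assms, unfolded real_scaleR_def] by auto

text \<open>The integrand is even with values in the interval from 0 to 1. Hence its primitive is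
  odd, increasing and 1-Lipschitz, and dividing by the limit at infinity gives the bound 1 and the
  Lipschitz constant \<open>Kq q\<close>.\<close>

lemma burgers_profile:
  fixes q :: real
  assumes "q \<ge> 1"
  defines "P \<equiv> (\<lambda>z::real. Kq q * (LBINT y=0..ereal z. (1 + y\<^sup>2) powr (- q)))"
  shows "mono P" "\<bar>P z\<bar> \<le> 1" "\<bar>P z - P y\<bar> \<le> Kq q * \<bar>z - y\<bar>" "Kq q \<ge> 0"
proof -
  define h where "h y = (1 + y\<^sup>2) powr (- q)" for y :: real
  define H where "H z = (LBINT y=0..ereal z. h y)" for z :: real
  define J where "J = (LBINT y=0..\<infinity>. h y)"
  have P: "P z = H z / J" "Kq q = 1 / J" for z
    by (simp_all add: P_def H_def h_def J_def Kq_def)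
  have h: "0 < h y" "h y \<le> 1" for y
    using powr_mono[of "- q" 0 "1 + y\<^sup>2"] assms(1) by (simp_all add: h_def add_pos_nonneg less_imp_neq[symmetric] powr_def add_nonneg_eq_0_iff)
  have int: "integrable lborel h"
    unfolding h_def by (rule integrable_one_plus_square_powr[OF assms(1)])
  have iint: "interval_lebesgue_integrable lborel a b h" for a b
    by (rule interval_lebesgue_integrable_of_integrable[OF int])
  have diff: "H y - H x = (LBINT s=ereal x..ereal y. h s)" for x y
    using interval_integral_sum[OF iint, of 0 "ereal x" "ereal y"] by (simp add: H_def)
  have incr: "0 \<le> H y - H x" "H y - H x \<le> y - x" if "x \<le> y" for x y
  proof -
    have eq: "H y - H x = (LBINT s. indicator {x<..<y} s * h s)"
      using that unfolding diff interval_lebesgue_integral_def set_lebesgue_integral_def by simp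
    show "0 \<le> H y - H x"
      unfolding eq using h by (intro Bochner_Integration.integral_nonneg) (simp add: less_imp_le)
    have "H y - H x \<le> (LBINT s. indicator {x<..<y} s)"
      unfolding eq using h int
      by (intro integral_mono integrable_mult_indicator[where f=h, simplified real_scaleR_def]
          integrable_real_indicator)
        (use that in \<open>auto simp: indicator_def\<close>)
    also have "\<dots> = y - x" using that by simp
    finally show "H y - H x \<le> y - x" .
  qed
  have le_J: "H z \<le> J" if "z \<ge> 0" for z
  proof -
    have "J - H z = (LBINT s=ereal z..\<infinity>. h s)"
      using interval_integral_sum[OF iint, of 0 "ereal z" "\<infinity>"] by (simp add: H_def J_def)
    also have "\<dots> \<ge> 0"
      unfolding interval_lebesgue_integral_def set_lebesgue_integral_def
      using h by (auto intro!: Bochner_Integration.integral_nonneg simp: less_imp_le)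
    finally show ?thesis by simp
  qed
  have odd: "H (- z) = - H z" for z
    using interval_integral_reflect[of 0 "ereal (- z)" h]
      interval_integral_endpoints_reverse[of 0 "ereal z" h]
    by (simp add: H_def h_def zero_ereal_def)
  have H0: "H 0 = 0" by (simp add: H_def flip: zero_ereal_def)
  have J: "J \<ge> 0" using le_J[of 0] H0 by simp
  show "Kq q \<ge> 0" using J P by simp
  show "mono P" using incr(1) J by (auto simp: mono_def P intro!: divide_right_mono)
  have "\<bar>H z\<bar> \<le> J"
    using le_J[of z] le_J[of "- z"] odd[of z] incr(1)[of 0 z] incr(1)[of z 0] H0
    by (cases "z \<ge> 0") auto
  \<comment> \<open>Only \<open>J \<ge> 0\<close> has been shown; for \<open>J = 0\<close> division
    by zero gives 0 and the bound persists.\<close>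
  then show "\<bar>P z\<bar> \<le> 1" using J by (cases "J = 0") (auto simp: P divide_le_eq)
  have "\<bar>H z - H y\<bar> \<le> \<bar>z - y\<bar>"
    using incr[of y z] incr[of z y] by (cases "y \<le> z") auto
  then have "\<bar>H z - H y\<bar> / J \<le> \<bar>z - y\<bar> / J"
    using J by (rule divide_right_mono)
  then show "\<bar>P z - P y\<bar> \<le> Kq q * \<bar>z - y\<bar>"
    using J by (simp add: P flip: diff_divide_distrib)
qed

lemma burgers_data_properties:
  assumes "wm < wp" "q \<ge> 1" "\<eta> > 0"
  shows "mono (burgers_data wm wp q \<eta>)" "burgers_data wm wp q \<eta> x \<in> {wm..wp}"
    and "\<exists>M\<ge>0. \<forall>x y. \<bar>burgers_data wm wp q \<eta> x - burgers_data wm wp q \<eta> y\<bar> \<le> M * \<bar>x - y\<bar>"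
proof -
  define P where "P z = Kq q * (LBINT y=0..ereal z. (1 + y\<^sup>2) powr (- q))" for z :: real
  note prof = burgers_profile[OF assms(2), folded P_def]
  have B: "burgers_data wm wp q \<eta> x = (wp + wm) / 2 + (wp - wm) / 2 * P (\<eta> * x)" for x
    by (simp add: burgers_data_def P_def)
  show "mono (burgers_data wm wp q \<eta>)"
    using assms(1,3) by (auto simp: mono_def B intro!: mult_left_mono monoD[OF prof(1)])
  have "\<bar>(wp - wm) / 2 * P (\<eta> * x)\<bar> \<le> (wp - wm) / 2"
    using mult_left_mono[OF prof(2)[of "\<eta> * x"], of "(wp - wm) / 2"] assms(1) by (simp add: abs_mult)
  then have "wm \<le> (wp + wm) / 2 + y \<and> (wp + wm) / 2 + y \<le> wp"
    if "y = (wp - wm) / 2 * P (\<eta> * x)" for y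
    unfolding that[symmetric] by (auto simp: field_simps abs_if split: if_splits)
  then show "burgers_data wm wp q \<eta> x \<in> {wm..wp}"
    unfolding B by simp
  have "\<bar>burgers_data wm wp q \<eta> x - burgers_data wm wp q \<eta> y\<bar>
      \<le> ((wp - wm) / 2 * (Kq q * \<eta>)) * \<bar>x - y\<bar>" for x y
  proof -
    have "burgers_data wm wp q \<eta> x - burgers_data wm wp q \<eta> y
        = (wp - wm) / 2 * (P (\<eta> * x) - P (\<eta> * y))"
      by (simp add: B algebra_simps)
    then have "\<bar>burgers_data wm wp q \<eta> x - burgers_data wm wp q \<eta> y\<bar>
        = (wp - wm) / 2 * \<bar>P (\<eta> * x) - P (\<eta> * y)\<bar>"
      unfolding abs_mult using assms(1) by (simp only: abs_mult) simp
    also have "\<dots> \<le> (wp - wm) / 2 * (Kq q * \<bar>\<eta> * x - \<eta> * y\<bar>)"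
      using assms(1) prof(3) by (intro mult_left_mono) auto
    also have "\<bar>\<eta> * x - \<eta> * y\<bar> = \<eta> * \<bar>x - y\<bar>"
      using assms(3) by (simp add: abs_mult flip: right_diff_distrib)
    finally show ?thesis by (simp add: mult.assoc)
  qed
  then show "\<exists>M\<ge>0. \<forall>x y. \<bar>burgers_data wm wp q \<eta> x - burgers_data wm wp q \<eta> y\<bar> \<le> M * \<bar>x - y\<bar>"
    using assms prof(4) by (intro exI[of _ "(wp - wm) / 2 * (Kq q * \<eta>)"]) auto
qed

text \<open>
  Along the straight line through \<open>(t, x)\<close> with slope \<open>w t x\<close> the difference \<open>w - w t x\<close> solves a
  linear homogeneous equation with bounded coefficient, so it vanishes.
\<close>

lemma burgers_characteristics:
  assumes "smooth_burgers_solution wm wp q \<eta> w" "t \<ge> 0"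
  shows "w t x = burgers_data wm wp q \<eta> (x - t * w t x)"
proof -
  define c where "c = w t x"
  define X where "X s = x + (s - t) * c" for s
  define \<phi> where "\<phi> s = w s (X s) - c" for s
  let ?S = "{0..} \<times> (UNIV :: real set)"
  have "Ck_on 1 ?S (case_prod w)"
    using assms(1) by (simp add: smooth_burgers_solution_def smooth_on_def)
  then obtain D where D: "\<And>p. p \<in> ?S \<Longrightarrow> (case_prod w has_derivative D p) (at p within ?S)"
    and D_cont: "\<And>h. continuous_on ?S (\<lambda>p. D p h)"
    by auto
  define a where "a s = D (s, X s) (0, 1)" for s
  have w_cont: "continuous_on ?S (case_prod w)"
    using D has_derivative_continuous by (fastforce simp: continuous_on_eq_continuous_within)
  have curve: "continuous_on {0..t} (\<lambda>s. (s, X s))"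
    unfolding X_def by (intro continuous_intros)
  have curve_sub: "(\<lambda>s. (s, X s)) ` {0..t} \<subseteq> ?S" by auto
  have \<phi>_cont: "continuous_on {0..t} \<phi>"
    unfolding \<phi>_def using continuous_on_compose2[OF w_cont curve curve_sub]
    by (intro continuous_intros) simp
  have a_cont: "continuous_on {0..t} a"
    unfolding a_def using continuous_on_compose2[OF D_cont curve curve_sub] by auto
  then have "bounded (a ` {0..t})"
    by (intro compact_imp_bounded compact_continuous_image) auto
  then obtain M where M: "\<And>s. s \<in> {0..t} \<Longrightarrow> \<bar>a s\<bar> \<le> M"
    by (force simp: bounded_iff)
  \<comment> \<open>The chain rule gives \<open>w\<^sub>t + c w\<^sub>x\<close> on the line;
    inserting the equation leaves \<open>(c - w) w\<^sub>x\<close>, which is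
    \<open>- \<phi> a\<close>.\<close>
  have \<phi>_deriv: "(\<phi> has_real_derivative - (\<phi> s * a s)) (at s)" if s: "0 < s" for s
  proof -
    \<comment> \<open>At positive times the derivative relative to the half plane is a genuine one,
      as \<open>dt\<close> and \<open>dx\<close> require.\<close>
    have at: "at (s, y) within ?S = at (s, y)" for y
    proof (rule at_within_interior)
      have "open ({0::real<..} \<times> (UNIV :: real set))" by (intro open_Times) auto
      then show "(s, y) \<in> interior ?S"
        by (rule interiorI) (use s in auto)
    qed
    have Ds: "(case_prod w has_derivative D (s, y)) (at (s, y))" for y
      using D[of "(s, y)"] s by (simp add: at)
    have line: "((\<lambda>r. w r (y + (r - s) * k)) has_real_derivative D (s, y) (1, k)) (at s)" for y k
    proof -
      have "((\<lambda>r. (r, y + (r - s) * k)) has_derivative (\<lambda>h. h *\<^sub>R (1, k))) (at s)"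
        by (auto intro!: derivative_eq_intros)
      from has_derivative_compose[OF this, of "case_prod w" "D (s, y)"] Ds[of y]
      have "((\<lambda>r. w r (y + (r - s) * k)) has_derivative (\<lambda>h. D (s, y) (h *\<^sub>R (1, k)))) (at s)"
        by simp
      moreover have "D (s, y) (h *\<^sub>R (1, k)) = D (s, y) (1, k) * h" for h
        using linear_scale[OF has_derivative_linear[OF Ds[of y]], of h "(1, k)"]
        by (simp add: mult.commute)
      ultimately show ?thesis by (simp add: has_field_derivative_def)
    qed
    have "((\<lambda>y. (s, y)) has_derivative (\<lambda>h. (0, h))) (at y)" for y
      by (auto intro!: derivative_eq_intros)
    from has_derivative_compose[OF this Ds]
    have "((\<lambda>y. w s y) has_derivative (\<lambda>h. D (s, y) (0, h))) (at y)" for y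
      by simp
    moreover have "(\<lambda>h. D (s, y) (0, h)) = (*) (D (s, y) (0, 1))" for y
    proof
      show "D (s, y) (0, h) = D (s, y) (0, 1) * h" for h
        using linear_scale[OF has_derivative_linear[OF Ds[of y]], of h "(0, 1)"]
        by (simp add: mult.commute)
    qed
    ultimately have "dx w s y = D (s, y) (0, 1)" for y
      unfolding dx_def by (intro DERIV_imp_deriv) (simp only: has_field_derivative_def)
    moreover have "dt w s y = D (s, y) (1, 0)" for y
      unfolding dt_def using line[of y 0] by (intro DERIV_imp_deriv) simp
    moreover have "dt w s (X s) + w s (X s) * dx w s (X s) = 0"
      using assms(1) s by (simp add: smooth_burgers_solution_def)
    ultimately have pde: "D (s, X s) (1, 0) = - (w s (X s) * a s)"
      by (simp add: a_def)
    have "D (s, X s) (1, c) = D (s, X s) (1, 0) + c * D (s, X s) (0, 1)"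
      using linear_add[OF has_derivative_linear[OF Ds], of "X s" "(1, 0)" "c *\<^sub>R (0, 1)"]
        linear_scale[OF has_derivative_linear[OF Ds], of "X s" c "(0, 1)"]
      by simp
    then have "D (s, X s) (1, c) = - (\<phi> s * a s)"
      by (simp add: pde \<phi>_def a_def algebra_simps)
    moreover have "\<phi> = (\<lambda>r. w r (X s + (r - s) * c) - c)"
      by (rule ext) (simp add: \<phi>_def X_def algebra_simps)
    ultimately show ?thesis
      using DERIV_diff[OF line[of "X s" c] DERIV_const[of c]] by simp
  qed
  \<comment> \<open>Gronwall's weight: the rate \<open>2 * M\<close> outweighs any decay of the
    square of \<open>\<phi>\<close>, so \<open>\<psi>\<close> cannot decrease. Vanishing at time
    \<open>t\<close>, it also vanishes at time 0.\<close>
  define \<psi> where "\<psi> s = (\<phi> s)\<^sup>2 * exp (2 * M * s)" for s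
  have "\<psi> 0 \<le> \<psi> t"
  proof (rule DERIV_nonneg_imp_increasing_open[of 0 t \<psi>])
    show "continuous_on {0..t} \<psi>"
      unfolding \<psi>_def by (intro continuous_intros \<phi>_cont)
    fix s assume s: "0 < s" "s < t"
    have "(\<psi> has_real_derivative 2 * (\<phi> s)\<^sup>2 * exp (2 * M * s) * (M - a s)) (at s)"
      unfolding \<psi>_def[abs_def]
      by (auto intro!: derivative_eq_intros \<phi>_deriv[OF s(1)] simp: algebra_simps power2_eq_square)
    moreover have "2 * (\<phi> s)\<^sup>2 * exp (2 * M * s) * (M - a s) \<ge> 0"
      using M[of s] s by (intro mult_nonneg_nonneg) auto
    ultimately show "\<exists>y. DERIV \<psi> s :> y \<and> y \<ge> 0" by blast
  qed (use assms(2) in simp)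
  moreover have "\<psi> t = 0" by (simp add: \<psi>_def \<phi>_def X_def c_def)
  ultimately have "\<phi> 0 = 0" by (simp add: \<psi>_def)
  then have "c = w 0 (X 0)" by (simp add: \<phi>_def)
  also have "\<dots> = burgers_data wm wp q \<eta> (X 0)"
    using assms(1) by (simp add: smooth_burgers_solution_def)
  finally show ?thesis by (simp add: X_def c_def)
qed

text \<open>Everything is read off the implicit relation \<open>w = w\<^sub>0 (x - t w)\<close> with
  increasing data \<open>w\<^sub>0\<close>. If \<open>w\<close> decreased from \<open>x\<close> to a
  point \<open>y\<close> on its right, the feet of the two characteristics would be in order and the
  data would contradict this. As \<open>w\<close> increases, feet in order are no farther apart than
  \<open>x\<close> and \<open>y\<close>, so the Lipschitz constant of the data survives for all
  times.\<close>

lemma burgers_solution_properties: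
  assumes w: "smooth_burgers_solution wm wp q \<eta> w" and "wm < wp" "q \<ge> 1" "\<eta> > 0"
  shows "t \<ge> 0 \<Longrightarrow> w t x \<in> {wm..wp}"
    and "continuous_on ({0..} \<times> UNIV) (case_prod w)"
    and "\<exists>M\<ge>0. \<forall>t\<ge>0. \<forall>x y. \<bar>w t x - w t y\<bar> \<le> M * \<bar>x - y\<bar>"
proof -
  note data = burgers_data_properties[OF assms(2-4)]
  show "w t x \<in> {wm..wp}" if "t \<ge> 0"
    using data(2) burgers_characteristics[OF w that] by metis
  have "Ck_on 0 ({0..} \<times> UNIV) (case_prod w)"
    using w unfolding smooth_burgers_solution_def smooth_on_def by blast
  then show "continuous_on ({0..} \<times> UNIV) (case_prod w)" by simp
  obtain M where M: "M \<ge> 0"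
    "\<And>x y. \<bar>burgers_data wm wp q \<eta> x - burgers_data wm wp q \<eta> y\<bar> \<le> M * \<bar>x - y\<bar>"
    using data(3) by blast
  have le: "w t x \<le> w t y \<and> w t y - w t x \<le> M * (y - x)" if "t \<ge> 0" "x \<le> y" for t x y
  proof -
    note char = burgers_characteristics[OF w that(1)]
    have mono: "w t x \<le> w t y"
    proof (rule ccontr)
      assume *: "\<not> w t x \<le> w t y"
      then have "x - t * w t x \<le> y - t * w t y"
        using that mult_left_mono[of "w t y" "w t x" t] by linarith
      then show False
        using monoD[OF data(1)] char[of x] char[of y] * by metis
    qed
    show ?thesis
    proof (cases "x - t * w t x \<le> y - t * w t y")
      case True
      have "w t y - w t x \<le> M * \<bar>(y - t * w t y) - (x - t * w t x)\<bar>"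
        using M(2)[of "y - t * w t y" "x - t * w t x"] char[of x] char[of y] by linarith
      also have "\<dots> \<le> M * (y - x)"
        using True mult_left_mono[OF mono that(1)] M(1) by (intro mult_left_mono) linarith+
      finally show ?thesis using mono by simp
    next
      \<comment> \<open>Feet in reversed order force equal values, by the monotonicity just
        shown.\<close>
      case False
      then have "w t y \<le> w t x"
        using monoD[OF data(1)] char[of x] char[of y] by (metis nle_le)
      then show ?thesis using mono M(1) that by simp
    qed
  qed
  have "\<bar>w t x - w t y\<bar> \<le> M * \<bar>x - y\<bar>" if "t \<ge> 0" for t x y
    using le[OF that, of x y] le[OF that, of y x] by (cases "x \<le> y") auto
  then show "\<exists>M\<ge>0. \<forall>t\<ge>0. \<forall>x y. \<bar>w t x - w t y\<bar> \<le> M * \<bar>x - y\<bar>"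
    using M(1) by blast
qed

lemma sqrt_deriv_pressure:
  assumes "\<gamma> > 0" "r > 0"
  shows "sqrt (deriv (pressure \<gamma>) r) = sqrt \<gamma> * r powr ((\<gamma> - 1) / 2)"
proof -
  have "(pressure \<gamma> has_real_derivative \<gamma> * r powr (\<gamma> - 1)) (at r)"
    unfolding pressure_def[abs_def] using assms by (auto intro!: derivative_eq_intros)
  then have "deriv (pressure \<gamma>) r = \<gamma> * r powr (\<gamma> - 1)"
    by (rule DERIV_imp_deriv)
  then show ?thesis using assms by (simp add: real_sqrt_mult powr_half_sqrt_powr)
qed

text \<open>The integrand can be unbounded at 0, hence the form of the fundamental theorem for
  nonnegative integrands, with limits of the primitive at the end points. The primitive tends to 0
  at 0 because its exponent is positive.\<close>

lemma Sigma2_eq: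
  assumes "\<gamma> > 1" "r > 0"
  shows "Sigma2 \<gamma> r v = v - sqrt \<gamma> * (2 / (\<gamma> - 1)) * r powr ((\<gamma> - 1) / 2)"
proof -
  define F where "F s = sqrt \<gamma> * (2 / (\<gamma> - 1)) * s powr ((\<gamma> - 1) / 2)" for s :: real
  define f where "f s = sqrt \<gamma> * s powr ((\<gamma> - 1) / 2 - 1)" for s :: real
  have "(LBINT s=0..ereal r. sqrt (deriv (pressure \<gamma>) s) / s) = (LBINT s=0..ereal r. f s)"
    using assms
    by (intro interval_integral_cong)
      (auto simp: einterval_iff sqrt_deriv_pressure f_def powr_diff min_def split: if_splits)
  also have "\<dots> = F r - F 0"
  proof (rule interval_integral_FTC_nonneg(2))
    show "0 < ereal r" using assms by simp
    show "(F has_real_derivative f x) (at x)" if "0 < ereal x" "ereal x < ereal r" for x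
      unfolding F_def[abs_def] f_def using that assms by (auto intro!: derivative_eq_intros)
    show "isCont f x" if "0 < ereal x" "ereal x < ereal r" for x
      unfolding f_def[abs_def] using that by (intro continuous_intros) auto
    have "(F \<longlongrightarrow> F 0) (at_right 0)"
      unfolding F_def using assms
      by (intro tendsto_intros tendsto_powr2) (auto intro: eventually_at_right_less eventually_mono[OF eventually_at_right_less])
    then show "((F \<circ> real_of_ereal) \<longlongrightarrow> F 0) (at_right 0)"
      by (simp add: zero_ereal_def ereal_tendsto_simps1)
    have "(F \<longlongrightarrow> F r) (at_left r)"
      unfolding F_def using assms by (intro tendsto_intros) auto
    then show "((F \<circ> real_of_ereal) \<longlongrightarrow> F r) (at_left (ereal r))"
      by (simp add: ereal_tendsto_simps1)
  qed (auto simp: f_def assms less_imp_le[OF less_trans[OF zero_less_one assms(1)]])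
  finally show ?thesis by (simp add: Sigma2_def F_def)
qed

text \<open>On a level set of \<open>Sigma2\<close> the speed \<open>lambda2\<close> is the level
  plus \<open>k * r powr e\<close>, an increasing function of the density \<open>r\<close>. Its
  inverse \<open>G\<close> expresses \<open>\<rho>\<^sub>b\<close> through the Burgers solution,
  from which range, continuity and equicontinuity carry over.\<close>

lemma smooth_rarefaction_wave_properties:
  assumes "\<gamma> > 1" "q \<ge> 1" "rm > 0" "rp > 0" "\<eta> > 0" "two_rarefaction \<gamma> rm um rp up"
    and wave: "smooth_rarefaction_wave \<gamma> rm um rp up q \<eta> \<rho>\<^sub>b u\<^sub>b"
  shows "t \<ge> 0 \<Longrightarrow> \<rho>\<^sub>b t x \<in> {rm..rp}"
    and "continuous_on ({0..} \<times> UNIV) (case_prod \<rho>\<^sub>b)"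
    and "\<epsilon> > 0 \<Longrightarrow> \<exists>\<delta>>0. \<forall>t\<ge>0. \<forall>x y. \<bar>x - y\<bar> < \<delta> \<longrightarrow> \<bar>\<rho>\<^sub>b t x - \<rho>\<^sub>b t y\<bar> < \<epsilon>"
    and "\<exists>U. \<forall>t\<ge>0. \<forall>x. \<bar>u\<^sub>b t x\<bar> \<le> U"
proof -
  define wm where "wm = lambda2 \<gamma> rm um"
  define wp where "wp = lambda2 \<gamma> rp up"
  define \<Sigma> where "\<Sigma> = Sigma2 \<gamma> rm um"
  have \<Sigma>p: "Sigma2 \<gamma> rp up = \<Sigma>" and wm_wp: "wm < wp"
    using assms(6) by (simp_all add: two_rarefaction_def \<Sigma>_def wm_def wp_def)
  obtain w where w: "smooth_burgers_solution wm wp q \<eta> w"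
    and wb: "\<And>t x. t \<ge> 0 \<Longrightarrow> \<rho>\<^sub>b t x > 0 \<and> lambda2 \<gamma> (\<rho>\<^sub>b t x) (u\<^sub>b t x) = w (1 + t) x \<and>
      Sigma2 \<gamma> (\<rho>\<^sub>b t x) (u\<^sub>b t x) = \<Sigma>"
    using wave unfolding smooth_rarefaction_wave_def wm_def[symmetric] wp_def[symmetric]
      \<Sigma>_def[symmetric] by metis
  define e where "e = (\<gamma> - 1) / 2"
  define k where "k = sqrt \<gamma> * (1 + 2 / (\<gamma> - 1))"
  have pos: "e > 0" "k > 0" using assms(1) by (auto simp: e_def k_def add_pos_pos)
  have diff: "lambda2 \<gamma> r v - Sigma2 \<gamma> r v = k * r powr e" if "r > 0" for r v
    using assms(1) that
    by (simp add: lambda2_def Sigma2_eq sqrt_deriv_pressure e_def k_def algebra_simps)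
  define G where "G z = ((z - \<Sigma>) / k) powr (1 / e)" for z
  have G: "G (lambda2 \<gamma> r v) = r" "(lambda2 \<gamma> r v - \<Sigma>) / k > 0"
    if "r > 0" "Sigma2 \<gamma> r v = \<Sigma>" for r v
    using diff[OF that(1), of v] that pos by (simp_all add: G_def powr_powr)
  have Gm: "G wm = rm" "(wm - \<Sigma>) / k > 0"
    using G[OF assms(3), of um] by (simp_all add: wm_def \<Sigma>_def)
  have Gp: "G wp = rp" using G[OF assms(4) \<Sigma>p] by (simp add: wp_def)
  have Gb: "\<rho>\<^sub>b t x = G (w (1 + t) x)" if "t \<ge> 0" for t x
    using G(1)[of "\<rho>\<^sub>b t x" "u\<^sub>b t x"] wb[OF that, of x] by simp
  note wprop = burgers_solution_properties[OF w wm_wp assms(2,5)]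
  have w_range: "w (1 + t) x \<in> {wm..wp}" if "t \<ge> 0" for t x
    using wprop(1) that by simp
  have base: "(z - \<Sigma>) / k > 0" if "z \<in> {wm..wp}" for z
  proof -
    have "(wm - \<Sigma>) / k \<le> (z - \<Sigma>) / k" using that pos by (intro divide_right_mono) auto
    then show ?thesis using Gm(2) by simp
  qed
  have G_mono: "G y \<le> G z" if "y \<in> {wm..wp}" "y \<le> z" for y z
    unfolding G_def using that base[OF that(1)] pos
    by (intro powr_mono2 divide_right_mono) auto
  have G_cont: "continuous_on {wm..wp} G"
    unfolding G_def using base pos by (intro continuous_intros) force+
  show range: "\<rho>\<^sub>b t x \<in> {rm..rp}" if "t \<ge> 0" for t x
    using Gb[OF that] G_mono[of wm "w (1 + t) x"] G_mono[of "w (1 + t) x" wp] w_range[OF that]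
      Gm(1) Gp wm_wp by auto
  have "continuous_on ({0..} \<times> UNIV) (\<lambda>p. G (case_prod w (1 + fst p, snd p)))"
    using w_range
    by (intro continuous_on_compose2[OF G_cont] continuous_on_compose2[OF wprop(2)] continuous_intros)
      auto
  then show "continuous_on ({0..} \<times> UNIV) (case_prod \<rho>\<^sub>b)"
    by (rule continuous_on_eq) (auto simp: Gb)
  show "\<exists>\<delta>>0. \<forall>t\<ge>0. \<forall>x y. \<bar>x - y\<bar> < \<delta> \<longrightarrow> \<bar>\<rho>\<^sub>b t x - \<rho>\<^sub>b t y\<bar> < \<epsilon>" if "\<epsilon> > 0"
  proof -
    have "uniformly_continuous_on {wm..wp} G"
      by (rule compact_uniformly_continuous[OF G_cont]) simp
    then obtain d where d: "d > 0"
      "\<And>y z. y \<in> {wm..wp} \<Longrightarrow> z \<in> {wm..wp} \<Longrightarrow> \<bar>y - z\<bar> < d \<Longrightarrow> \<bar>G y - G z\<bar> < \<epsilon>"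
      using \<open>\<epsilon> > 0\<close> unfolding uniformly_continuous_on_def dist_real_def by metis
    obtain M where M: "M \<ge> 0" "\<And>t x y. t \<ge> 0 \<Longrightarrow> \<bar>w t x - w t y\<bar> \<le> M * \<bar>x - y\<bar>"
      using wprop(3) by blast
    have "\<bar>\<rho>\<^sub>b t x - \<rho>\<^sub>b t y\<bar> < \<epsilon>" if "t \<ge> 0" "\<bar>x - y\<bar> < d / (M + 1)" for t x y
    proof -
      have "\<bar>w (1 + t) x - w (1 + t) y\<bar> \<le> (M + 1) * \<bar>x - y\<bar>"
        using M(2)[of "1 + t" x y] that(1) by (simp add: distrib_right)
      also have "\<dots> < d" using that(2) M(1) by (simp add: field_simps)
      finally show ?thesis using d(2) w_range[OF that(1)] by (simp add: Gb[OF that(1)])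
    qed
    then show ?thesis using d(1) M(1) by (intro exI[of _ "d / (M + 1)"]) auto
  qed
  have "\<bar>u\<^sub>b t x\<bar> \<le> \<bar>wm\<bar> + \<bar>wp\<bar> + sqrt \<gamma> * rp powr e" if "t \<ge> 0" for t x
  proof -
    have "u\<^sub>b t x = w (1 + t) x - sqrt \<gamma> * \<rho>\<^sub>b t x powr e"
      using wb[OF that, of x] assms(1) sqrt_deriv_pressure[of \<gamma> "\<rho>\<^sub>b t x"]
      by (simp add: lambda2_def e_def algebra_simps)
    moreover have "0 \<le> sqrt \<gamma> * \<rho>\<^sub>b t x powr e" "sqrt \<gamma> * \<rho>\<^sub>b t x powr e \<le> sqrt \<gamma> * rp powr e"
      using range[OF that, of x] assms(1,3) pos(1) by (auto intro!: mult_left_mono powr_mono2)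
    ultimately show ?thesis using w_range[OF that, of x] by auto
  qed
  then show "\<exists>U. \<forall>t\<ge>0. \<forall>x. \<bar>u\<^sub>b t x\<bar> \<le> U" by blast
qed

section \<open>Weak derivatives in space\<close>

lemma integrable_mult_mollifier:
  assumes "continuous_on UNIV f" "r > 0"
  shows "integrable lborel (\<lambda>x. f x * mollifier r a x)"
proof -
  have "integrable lborel (\<lambda>x. indicator {a..a + r} x *\<^sub>R (f x * mollifier r a x))"
    by (intro borel_integrable_compact continuous_intros continuous_mollifier
        continuous_on_subset[OF assms(1)]) auto
  moreover have "(\<lambda>x. indicator {a..a + r} x *\<^sub>R (f x * mollifier r a x)) = (\<lambda>x. f x * mollifier r a x)"
  proof
    show "indicator {a..a + r} x *\<^sub>R (f x * mollifier r a x) = f x * mollifier r a x" for x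
      using mollifier_eq_0[OF assms(2), of x a] by (fastforce simp: indicator_def)
  qed
  ultimately show ?thesis by (simp only:)
qed

lemma mollifier_average_ge:
  assumes "continuous_on UNIV f" "r > 0" "\<And>x. x \<in> {a..a + r} \<Longrightarrow> f x \<ge> c"
  shows "(LINT x|lborel. f x * mollifier r a x) \<ge> c"
proof -
  have "c * mollifier r a x \<le> f x * mollifier r a x" for x
    using assms(3)[of x] mollifier_nonneg[OF assms(2), of a x] mollifier_eq_0[OF assms(2), of x a]
    by (cases "x \<in> {a..a + r}") (auto intro: mult_right_mono)
  then have "(LINT x|lborel. c * mollifier r a x) \<le> (LINT x|lborel. f x * mollifier r a x)"
    using assms has_bochner_integral_mollifier[OF assms(2), of a]
    by (intro integral_mono integrable_mult_mollifier) (auto intro: has_bochner_integral_integrable)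
  then show ?thesis
    using has_bochner_integral_integral_eq[OF has_bochner_integral_mollifier[OF assms(2)]] by simp
qed

lemma mollifier_average_le:
  assumes "continuous_on UNIV f" "r > 0" "\<And>x. x \<in> {a..a + r} \<Longrightarrow> f x \<le> c"
  shows "(LINT x|lborel. f x * mollifier r a x) \<le> c"
  using mollifier_average_ge[of "\<lambda>x. - f x" r a "- c"] assms by (simp add: continuous_on_minus)

lemma open_strip_UNIV: "open T \<Longrightarrow> open (T \<times> (UNIV :: real set))"
  by (simp add: open_Times)

text \<open>An open set is a countable union of compact sets, and measurability on each of them
  suffices.\<close>

lemma loc_integrable_measurable:
  fixes f :: "'a::euclidean_space \<Rightarrow> real"
  assumes "open S" "loc_integrable S f"
  shows "f \<in> borel_measurable (lebesgue_on S)"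
proof -
  obtain K :: "nat \<Rightarrow> 'a set" where K: "\<And>n. compact (K n)" "\<And>n. K n \<subseteq> S" "\<Union> (range K) = S"
    using open_Union_compact_subsets[OF assms(1)] by metis
  show ?thesis
  proof (rule measurable_piecewise_restrict[of "range K"])
    fix \<Omega> assume "\<Omega> \<in> range K"
    then obtain n where n: "\<Omega> = K n" by auto
    have Kn: "K n \<in> sets lebesgue" using K(1) by (simp add: borel_compact)
    then show "\<Omega> \<inter> space (lebesgue_on S) \<in> sets (lebesgue_on S)"
      using K(2)[of n] assms(1) by (auto simp: n sets_restrict_space space_restrict_space Int_absorb1 Int_absorb2)
    have "restrict_space (lebesgue_on S) \<Omega> = lebesgue_on (K n)"
      using K(2)[of n] assms(1) Kn by (simp add: n restrict_restrict_space Int_absorb1)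
    moreover have "f \<in> borel_measurable (lebesgue_on (K n))"
      using assms(2) K(1,2) unfolding loc_integrable_def by blast
    ultimately show "f \<in> restrict_space (lebesgue_on S) \<Omega> \<rightarrow>\<^sub>M borel" by simp
  qed (use K(3) in \<open>auto simp: space_restrict_space\<close>)
qed

lemma borel_measurable_slice:
  fixes h :: "real \<Rightarrow> real \<Rightarrow> real"
  assumes "case_prod h \<in> borel_measurable borel"
  shows "h t \<in> borel_measurable borel"
proof -
  have "(\<lambda>x. (t, x)) \<in> borel \<rightarrow>\<^sub>M (borel :: (real \<times> real) measure)"
    by (intro borel_measurable_continuous_onI continuous_intros)
  from measurable_compose[OF this assms] show ?thesis by simp
qed

text \<open>A Lebesgue measurable function in the plane can have slices that are not measurable; a
  Borel representative has none. Agreement is recorded both in the plane and on almost every slice,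
  because integrals of both kinds are compared later.\<close>

lemma borel_version_on_strip:
  fixes g :: "real \<Rightarrow> real \<Rightarrow> real"
  assumes "open T" "case_prod g \<in> borel_measurable (lebesgue_on (T \<times> UNIV))"
  obtains h where "case_prod h \<in> borel_measurable borel"
    "AE (t, x) in lborel. t \<in> T \<longrightarrow> g t x = h t x"
    "AE t in lborel. t \<in> T \<longrightarrow> (AE x in lborel. g t x = h t x)"
proof -
  have "(\<lambda>p. indicator (T \<times> UNIV) p *\<^sub>R case_prod g p) \<in> borel_measurable lebesgue"
    using assms(2) open_strip_UNIV[OF assms(1)] by (subst (asm) borel_measurable_restrict_space_iff) auto
  then obtain h where h: "h \<in> borel_measurable lborel"
    "AE p in lborel. indicator (T \<times> UNIV) p *\<^sub>R case_prod g p = h p"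
    using completion_ex_borel_measurable_real[of _ lborel] by fastforce
  have "AE p in lborel. fst p \<in> T \<longrightarrow> g (fst p) (snd p) = h p"
    using h(2) by eventually_elim (auto simp: indicator_def split_beta' split: if_splits)
  then have AE: "AE p in lborel \<Otimes>\<^sub>M lborel. fst p \<in> T \<longrightarrow> g (fst p) (snd p) = h p"
    by (subst lborel_prod)
  show ?thesis
  proof (rule that[of "curry h"])
    show "case_prod (curry h) \<in> borel_measurable borel" using h(1) by simp
    show "AE (t, x) in lborel. t \<in> T \<longrightarrow> g t x = curry h t x"
      using AE by (subst (asm) lborel_prod) (simp add: split_beta')
    have "AE t in lborel. AE x in lborel. t \<in> T \<longrightarrow> g t x = h (t, x)"
      using lborel_pair.AE_pair[OF AE] by simp
    then show "AE t in lborel. t \<in> T \<longrightarrow> (AE x in lborel. g t x = curry h t x)"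
      by eventually_elim auto
  qed
qed

text \<open>Rise, plateau and fall have length \<open>e\<close> each, whence the window length
  \<open>3 * e\<close> and the lower bound \<open>e\<close> for the integral.\<close>

definition time_bump :: "real \<Rightarrow> real \<Rightarrow> real \<Rightarrow> real" where
  "time_bump e c = plateau e c e (c + 2 * e)"

lemma time_bump:
  assumes "e > 0"
  shows "0 \<le> time_bump e c t" "time_bump e c t \<le> 1"
    and "t \<notin> {c..c + 3 * e} \<Longrightarrow> time_bump e c t = 0"
    and "integrable lborel (time_bump e c)" "(LINT t|lborel. time_bump e c t) \<ge> e"
    and "continuous_on UNIV (time_bump e c)"
proof -
  show nonneg: "0 \<le> time_bump e c t" for t
    unfolding time_bump_def using assms by (intro plateau_nonneg) auto
  show "time_bump e c t \<le> 1"
    using abs_plateau_le_1[of e c e "c + 2 * e" t] by (simp add: time_bump_def)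
  show zero: "time_bump e c t = 0" if "t \<notin> {c..c + 3 * e}" for t
    unfolding time_bump_def using assms that by (intro plateau_eq_0) auto
  show cont: "continuous_on UNIV (time_bump e c)"
    using Ck_on_plateau[of 0] by (simp add: time_bump_def)
  have "integrable lborel (\<lambda>t. indicator {c..c + 3 * e} t *\<^sub>R time_bump e c t)"
    by (intro borel_integrable_compact continuous_on_subset[OF cont]) auto
  moreover have "(\<lambda>t. indicator {c..c + 3 * e} t *\<^sub>R time_bump e c t) = time_bump e c"
    using zero by (fastforce simp: indicator_def)
  ultimately show int: "integrable lborel (time_bump e c)" by (simp only:)
  have "(LINT t|lborel. indicator {c + e..c + 2 * e} t) \<le> (LINT t|lborel. time_bump e c t)"
    using plateau_eq_1[of e e _ c "c + 2 * e"] nonneg assms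
    by (intro integral_mono int integrable_real_indicator) (auto simp: indicator_def time_bump_def)
  then show "(LINT t|lborel. time_bump e c t) \<ge> e" using assms by simp
qed

text \<open>
  Young's inequality replaces the Cauchy-Schwarz inequality, which leaves the constant \<open>K\<close> free.
\<close>

lemma weak_dx_time_window:
  assumes weak: "has_weak_dx f g" and f: "continuous_on ({0<..} \<times> UNIV) (case_prod f)"
    and h: "case_prod h \<in> borel_measurable borel" "AE (t, x) in lborel. t \<in> {0<..} \<longrightarrow> g t x = h t x"
    and pos: "t0 > 0" "e > 0" "K > 0" "r > 0" "L > 0"
    and len: "max (a + r) (b + L) - min a b \<le> K * m" and s: "\<bar>s\<bar> = 1"
    and lower: "AE t in lborel. t \<in> {t0..t0 + 3 * e} \<longrightarrow>
      s * (LINT x|lborel. f t x * (mollifier r a x - mollifier L b x)) \<ge> m"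
  shows "ennreal (m * e / 2) \<le>
    (\<integral>\<^sup>+ t. indicator {t0..t0 + 3 * e} t * (\<integral>\<^sup>+ x. ennreal (K / 2 * (h t x)\<^sup>2) \<partial>lborel) \<partial>lborel)"
proof -
  define lo where "lo = min a b"
  define hi where "hi = max (a + r) (b + L)"
  have lohi: "lo < hi" "hi - lo \<le> K * m" using pos len by (auto simp: lo_def hi_def)
  then have m: "m > 0" using pos(3) by (smt (verit) zero_less_mult_pos)
  define \<theta> where "\<theta> = time_bump e t0"
  define \<phi> where "\<phi> = plateau r a L b"
  define \<kappa> where "\<kappa> x = mollifier r a x - mollifier L b x" for x
  define F where "F t = (LINT x|lborel. f t x * \<kappa> x)" for t
  let ?W = "{t0..t0 + 3 * e}" and ?S = "{0::real<..} \<times> (UNIV :: real set)"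
  note \<theta> = time_bump[OF pos(2), where c = t0, folded \<theta>_def]
  define I where "I = (LINT t|lborel. \<theta> t)"
  have I: "I \<ge> 0" using \<theta>(1) by (simp add: I_def)
  define X where
    "X = (\<integral>\<^sup>+ t. indicator ?W t * (\<integral>\<^sup>+ x. ennreal (K / 2 * (h t x)\<^sup>2) \<partial>lborel) \<partial>lborel)"
  have \<theta>_Ck: "Ck_on n UNIV \<theta>" and \<phi>_Ck: "Ck_on n UNIV \<phi>" for n
    by (simp_all add: \<theta>_def time_bump_def \<phi>_def Ck_on_plateau)
  have \<phi>_0: "\<phi> x = 0" if "x \<notin> {lo..hi}" for x
    using that pos unfolding \<phi>_def lo_def hi_def by (intro plateau_eq_0) auto
  have \<kappa>_0: "\<kappa> x = 0" if "x \<notin> {lo..hi}" for x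
    using that pos mollifier_eq_0[of r x a] mollifier_eq_0[of L x b]
    by (auto simp: \<kappa>_def lo_def hi_def min_def max_def split: if_splits)
  have \<kappa>_cont: "continuous_on UNIV \<kappa>"
    unfolding \<kappa>_def by (intro continuous_intros continuous_mollifier)
  have W: "?W \<subseteq> {0<..}" using pos(1) by auto
  have openS: "open ?S" by (rule open_strip_UNIV[OF open_greaterThan])
  note tensor = integral_tensor_lebesgue_on[OF open_greaterThan W f \<theta>(6,3) \<kappa>_cont \<kappa>_0, folded F_def]
  have test: "C0_infinity ?S (case_prod (\<lambda>t x. \<theta> t * \<phi> x))"
    using \<theta>(3) \<phi>_0 by (intro C0_infinity_tensor[OF \<theta>_Ck \<phi>_Ck W])
  \<comment> \<open>This is the integration by parts: \<open>\<phi>\<close> is a primitive of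
    \<open>\<kappa>\<close> with compact support, so \<open>f\<close> is paired with
    \<open>\<theta> \<kappa>\<close> and its weak derivative with
    \<open>\<theta> \<phi>\<close>.\<close>
  have "dx (\<lambda>t x. \<theta> t * \<phi> x) t x = \<theta> t * \<kappa> x" for t x
    unfolding dx_def \<phi>_def \<kappa>_def
    by (intro DERIV_imp_deriv DERIV_cmult plateau_deriv)
  then have "(LINT (t, x)|lebesgue_on ?S. f t x * (\<theta> t * \<kappa> x))
      = - (LINT (t, x)|lebesgue_on ?S. g t x * (\<theta> t * \<phi> x))"
    using weak[unfolded has_weak_dx_def, THEN conjunct2, THEN conjunct2, rule_format, OF test]
    by simp
  then have "(LINT t|lborel. \<theta> t * F t) = - (LINT (t, x)|lebesgue_on ?S. g t x * (\<theta> t * \<phi> x))"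
    using tensor(2) by simp
  then have "ennreal \<bar>LINT t|lborel. \<theta> t * F t\<bar>
      \<le> (\<integral>\<^sup>+ p. ennreal \<bar>g (fst p) (snd p) * (\<theta> (fst p) * \<phi> (snd p))\<bar> \<partial>lebesgue_on ?S)"
    using abs_integral_le_nn_integral[of "lebesgue_on ?S" "\<lambda>p. g (fst p) (snd p) * (\<theta> (fst p) * \<phi> (snd p))"]
    by (simp add: split_beta')
  also have "\<dots> = (\<integral>\<^sup>+ p. ennreal \<bar>g (fst p) (snd p) * (\<theta> (fst p) * \<phi> (snd p))\<bar> * indicator ?S p \<partial>lborel)"
    using openS by (subst nn_integral_restrict_space) (auto simp: nn_integral_completion)
  also have "\<dots> \<le> (\<integral>\<^sup>+ p. indicator ?W (fst p) * ennreal (K / 2 * (h (fst p) (snd p))\<^sup>2)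
      + ennreal (\<theta> (fst p)) * (ennreal (1 / (2 * K)) * indicator {lo..hi} (snd p)) \<partial>lborel)"
  proof (rule nn_integral_mono_AE)
    show "AE p in lborel. ennreal \<bar>g (fst p) (snd p) * (\<theta> (fst p) * \<phi> (snd p))\<bar> * indicator ?S p
      \<le> indicator ?W (fst p) * ennreal (K / 2 * (h (fst p) (snd p))\<^sup>2)
      + ennreal (\<theta> (fst p)) * (ennreal (1 / (2 * K)) * indicator {lo..hi} (snd p))"
      using h(2)
    proof eventually_elim
      case (elim p)
      obtain t x where p: "p = (t, x)" by (cases p)
      show ?case
      proof (cases "t \<in> ?W \<and> x \<in> {lo..hi}")
        case True
        have g: "g t x = h t x" using elim W True by (auto simp: p)
        \<comment> \<open>Expanding the square gives Young's inequality with weight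
          \<open>K\<close>; its constant term is integrated only over
          \<open>{lo..hi}\<close>.\<close>
        have "0 \<le> (K * \<bar>h t x\<bar> - 1)\<^sup>2" by simp
        then have "\<bar>h t x\<bar> \<le> K / 2 * (h t x)\<^sup>2 + 1 / (2 * K)"
          using pos(3) by (simp add: field_simps power2_eq_square)
        then have "\<bar>h t x\<bar> * \<theta> t \<le> (K / 2 * (h t x)\<^sup>2 + 1 / (2 * K)) * \<theta> t"
          using \<theta>(1) by (rule mult_right_mono)
        also have "\<dots> = K / 2 * (h t x)\<^sup>2 * \<theta> t + \<theta> t * (1 / (2 * K))"
          by (simp add: algebra_simps)
        also have "\<dots> \<le> K / 2 * (h t x)\<^sup>2 * 1 + \<theta> t * (1 / (2 * K))"
          using \<theta>(2) pos(3) by (intro add_right_mono mult_left_mono) auto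
        finally have young: "\<bar>h t x\<bar> * \<theta> t \<le> K / 2 * (h t x)\<^sup>2 + \<theta> t * (1 / (2 * K))"
          by simp
        have "\<bar>h t x * (\<theta> t * \<phi> x)\<bar> = \<bar>h t x\<bar> * \<theta> t * \<bar>\<phi> x\<bar>"
          using \<theta>(1)[of t] by (simp add: abs_mult)
        also have "\<dots> \<le> \<bar>h t x\<bar> * \<theta> t * 1"
          using \<theta>(1)[of t] abs_plateau_le_1 unfolding \<phi>_def by (intro mult_left_mono) auto
        finally have "\<bar>h t x * (\<theta> t * \<phi> x)\<bar> \<le> K / 2 * (h t x)\<^sup>2 + \<theta> t * (1 / (2 * K))"
          using young by simp
        then have "ennreal \<bar>h t x * (\<theta> t * \<phi> x)\<bar>
            \<le> ennreal (K / 2 * (h t x)\<^sup>2) + ennreal (\<theta> t) * ennreal (1 / (2 * K))"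
          using pos(3) \<theta>(1)[of t] by (simp flip: ennreal_plus ennreal_mult)
        then show ?thesis using True W by (auto simp: p g indicator_def)
      next
        case False
        then have "\<theta> t * \<phi> x = 0" using \<theta>(3)[of t] \<phi>_0[of x] by fastforce
        then have "g t x * (\<theta> t * \<phi> x) = 0" by simp
        then show ?thesis by (simp only: p fst_conv snd_conv) simp
      qed
    qed
  qed
  also have "\<dots> = (\<integral>\<^sup>+ t. \<integral>\<^sup>+ x. indicator ?W t * ennreal (K / 2 * (h t x)\<^sup>2)
      + ennreal (\<theta> t) * (ennreal (1 / (2 * K)) * indicator {lo..hi} x) \<partial>lborel \<partial>lborel)"
  proof -
    have [measurable]: "(\<lambda>p. h (fst p) (snd p)) \<in> borel_measurable (borel \<Otimes>\<^sub>M borel)"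
      using h(1) by (simp add: split_beta' borel_prod)
    have [measurable]: "\<theta> \<in> borel_measurable borel"
      using \<theta>(6) by (rule borel_measurable_continuous_onI)
    show ?thesis
      by (subst lborel_prod[symmetric], subst lborel.nn_integral_fst[symmetric]) simp_all
  qed
  also have "\<dots> = (\<integral>\<^sup>+ t. indicator ?W t * (\<integral>\<^sup>+ x. ennreal (K / 2 * (h t x)\<^sup>2) \<partial>lborel)
      + ennreal (\<theta> t) * ennreal ((hi - lo) / (2 * K)) \<partial>lborel)"
  proof (rule nn_integral_cong)
    fix t
    have hp[measurable]: "(\<lambda>p. h (fst p) (snd p)) \<in> borel_measurable (borel \<Otimes>\<^sub>M borel)"
      using h(1) by (simp add: split_beta' borel_prod)
    have [measurable]: "h t \<in> borel_measurable borel"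
      using h(1) by (rule borel_measurable_slice)
    have "(\<integral>\<^sup>+ x. indicator ?W t * ennreal (K / 2 * (h t x)\<^sup>2)
        + ennreal (\<theta> t) * (ennreal (1 / (2 * K)) * indicator {lo..hi} x) \<partial>lborel)
      = indicator ?W t * (\<integral>\<^sup>+ x. ennreal (K / 2 * (h t x)\<^sup>2) \<partial>lborel)
        + ennreal (\<theta> t) * (ennreal (1 / (2 * K)) * (\<integral>\<^sup>+ x. indicator {lo..hi} x \<partial>lborel))"
      by (simp add: nn_integral_add nn_integral_cmult)
    also have "ennreal (1 / (2 * K)) * (\<integral>\<^sup>+ x. indicator {lo..hi} x \<partial>lborel) = ennreal ((hi - lo) / (2 * K))"
      using lohi(1) pos(3) by (simp flip: ennreal_mult)
    finally show "(\<integral>\<^sup>+ x. indicator ?W t * ennreal (K / 2 * (h t x)\<^sup>2)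
        + ennreal (\<theta> t) * (ennreal (1 / (2 * K)) * indicator {lo..hi} x) \<partial>lborel)
      = indicator ?W t * (\<integral>\<^sup>+ x. ennreal (K / 2 * (h t x)\<^sup>2) \<partial>lborel)
        + ennreal (\<theta> t) * ennreal ((hi - lo) / (2 * K))" .
  qed
  also have "\<dots> = X + ennreal (I * ((hi - lo) / (2 * K)))"
  proof -
    have hp[measurable]: "(\<lambda>p. h (fst p) (snd p)) \<in> borel_measurable (borel \<Otimes>\<^sub>M borel)"
      using h(1) by (simp add: split_beta' borel_prod)
    have [measurable]: "(\<lambda>t. \<integral>\<^sup>+ x. ennreal (K / 2 * (h t x)\<^sup>2) \<partial>lborel) \<in> borel_measurable borel"
      by (rule lborel.borel_measurable_nn_integral) (simp add: split_beta')
    have [measurable]: "\<theta> \<in> borel_measurable borel"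
      using \<theta>(6) by (rule borel_measurable_continuous_onI)
    have "(\<integral>\<^sup>+ t. ennreal (\<theta> t) * ennreal ((hi - lo) / (2 * K)) \<partial>lborel)
        = ennreal I * ennreal ((hi - lo) / (2 * K))"
      using \<theta>(1,4) unfolding I_def by (simp add: nn_integral_multc nn_integral_eq_integral)
    also have "\<dots> = ennreal (I * ((hi - lo) / (2 * K)))"
      using I lohi pos by (simp flip: ennreal_mult)
    finally show ?thesis
      unfolding X_def by (subst nn_integral_add) simp_all
  qed
  finally have upper: "ennreal \<bar>LINT t|lborel. \<theta> t * F t\<bar> \<le> X + ennreal (I * ((hi - lo) / (2 * K)))" .
  have "m * I = (LINT t|lborel. \<theta> t * m)"
    using \<theta>(4) by (simp add: I_def mult.commute)
  also have "\<dots> \<le> (LINT t|lborel. s * (\<theta> t * F t))"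
  proof (rule integral_mono_AE)
    show "AE t in lborel. \<theta> t * m \<le> s * (\<theta> t * F t)"
      using lower
    proof eventually_elim
      case (elim t)
      then show ?case
        using \<theta>(1,3)[of t] mult_left_mono[of m "s * F t" "\<theta> t"]
        by (cases "t \<in> ?W") (auto simp: F_def \<kappa>_def mult.left_commute)
    qed
  qed (use \<theta>(4) tensor(1) in auto)
  also have "\<dots> \<le> \<bar>LINT t|lborel. \<theta> t * F t\<bar>"
    using abs_ge_self[of "s * (LINT t|lborel. \<theta> t * F t)"] s by (simp add: abs_mult)
  finally have "ennreal (m * I) \<le> X + ennreal (I * ((hi - lo) / (2 * K)))"
    using upper by (meson ennreal_leI order_trans)
  \<comment> \<open>By \<open>len\<close> the constant term of Young's inequality is at most half of
    the left-hand side.\<close>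
  also have "\<dots> \<le> X + ennreal (m * I / 2)"
  proof -
    have "I * ((hi - lo) / (2 * K)) \<le> I * (m / 2)"
      using lohi pos(3) I by (intro mult_left_mono) (auto simp: field_simps)
    then show ?thesis by (intro add_left_mono ennreal_leI) (simp add: mult.commute)
  qed
  finally have "ennreal (m * I) \<le> X + ennreal (m * I / 2)" .
  moreover have "ennreal (m * I) = ennreal (m * I / 2) + ennreal (m * I / 2)"
    using m I by (subst ennreal_plus[symmetric]) auto
  ultimately have "ennreal (m * I / 2) + ennreal (m * I / 2) \<le> ennreal (m * I / 2) + X"
    by (simp only: add.commute)
  \<comment> \<open>Only the finite half is cancelled, since \<open>X\<close> may be
    infinite.\<close>
  then have "ennreal (m * I / 2) \<le> X"
    unfolding ennreal_add_left_cancel_le by simp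
  moreover have "m * e / 2 \<le> m * I / 2" using \<theta>(5) m by (simp add: I_def)
  ultimately show ?thesis unfolding X_def by (meson ennreal_leI order_trans)
qed

lemma continuous_on_slice:
  fixes f :: "real \<Rightarrow> real \<Rightarrow> real"
  assumes "continuous_on (T \<times> UNIV) (case_prod f)" "t \<in> T"
  shows "continuous_on UNIV (f t)"
proof -
  have "continuous_on UNIV (\<lambda>x::real. (t, x))" by (intro continuous_intros)
  then show ?thesis
    using continuous_on_compose2[OF assms(1), of UNIV "\<lambda>x. (t, x)"] assms(2)
    by (simp add: image_subset_iff)
qed

lemma integral_mult_mollifier_diff:
  assumes "continuous_on UNIV f" "r > 0" "L > 0"
  shows "(LINT x|lborel. f x * (mollifier r a x - mollifier L b x))
    = (LINT x|lborel. f x * mollifier r a x) - (LINT x|lborel. f x * mollifier L b x)"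
  using assms by (simp add: right_diff_distrib integrable_mult_mollifier)

lemma weak_dx_borel_version:
  assumes "has_weak_dx f g"
  obtains h where "case_prod h \<in> borel_measurable borel"
    "AE (t, x) in lborel. t \<in> {0<..} \<longrightarrow> g t x = h t x"
    "AE t in lborel. t \<in> {0<..} \<longrightarrow> (AE x in lborel. g t x = h t x)"
proof -
  have "loc_integrable ({0<..} \<times> UNIV) (case_prod g)"
    using assms unfolding has_weak_dx_def by (elim conjE)
  from loc_integrable_measurable[OF open_strip_UNIV[OF open_greaterThan] this]
  show ?thesis
    by (rule borel_version_on_strip[OF open_greaterThan]) (rule that)
qed

text \<open>By continuity, two close points with values more than \<open>\<epsilon>\<close> apart
  stay well apart on a short time window. There \<open>weak_dx_time_window\<close> forces more
  energy than \<open>C\<close> times the window length permits. That length cancels, so it may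
  depend on the points, and the result holds at every positive time although the energy bound holds
  only at almost every time.\<close>

lemma weak_dx_equicontinuous:
  assumes weak: "has_weak_dx f g" and f: "continuous_on ({0<..} \<times> UNIV) (case_prod f)"
    and C: "C \<ge> 0" "AE t in lborel. 0 < t \<longrightarrow> (\<integral>\<^sup>+ x. ennreal ((g t x)\<^sup>2) \<partial>lborel) \<le> ennreal C"
    and \<epsilon>: "\<epsilon> > 0"
  shows "\<exists>\<delta>>0. \<forall>t>0. \<forall>x y. \<bar>x - y\<bar> < \<delta> \<longrightarrow> \<bar>f t x - f t y\<bar> \<le> \<epsilon>"
proof -
  obtain h where h: "case_prod h \<in> borel_measurable borel"
    "AE (t, x) in lborel. t \<in> {0<..} \<longrightarrow> g t x = h t x"
    "AE t in lborel. t \<in> {0<..} \<longrightarrow> (AE x in lborel. g t x = h t x)"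
    by (rule weak_dx_borel_version[OF weak])
  \<comment> \<open>What remains of \<open>\<epsilon>\<close> after each of the two averages has
    lost \<open>\<epsilon> / 4\<close>.\<close>
  define m where "m = \<epsilon> / 2"
  \<comment> \<open>Chosen so that \<open>3 * K * C < m\<close>, the opposite of what the window
    estimate yields.\<close>
  define K where "K = m / (6 * C + 6)"
  have pos: "m > 0" "K > 0" using \<epsilon> C(1) by (auto simp: m_def K_def)
  have hC: "AE t in lborel. 0 < t \<longrightarrow> (\<integral>\<^sup>+ x. ennreal (K / 2 * (h t x)\<^sup>2) \<partial>lborel) \<le> ennreal (K / 2 * C)"
    using C(2) h(3)
  proof eventually_elim
    case (elim t)
    show ?case
    proof
      assume t: "0 < t"
      have [measurable]: "h t \<in> borel_measurable borel"
        using h(1) by (rule borel_measurable_slice)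
      have "(\<integral>\<^sup>+ x. ennreal (K / 2 * (h t x)\<^sup>2) \<partial>lborel)
          = ennreal (K / 2) * (\<integral>\<^sup>+ x. ennreal ((h t x)\<^sup>2) \<partial>lborel)"
        using pos(2) by (subst nn_integral_cmult[symmetric]) (auto simp flip: ennreal_mult)
      also have "(\<integral>\<^sup>+ x. ennreal ((h t x)\<^sup>2) \<partial>lborel) = (\<integral>\<^sup>+ x. ennreal ((g t x)\<^sup>2) \<partial>lborel)"
        using elim(2) t by (intro nn_integral_cong_AE) auto
      also have "ennreal (K / 2) * \<dots> \<le> ennreal (K / 2) * ennreal C"
        using elim(1) t by (intro mult_left_mono) auto
      finally show "(\<integral>\<^sup>+ x. ennreal (K / 2 * (h t x)\<^sup>2) \<partial>lborel) \<le> ennreal (K / 2 * C)"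
        using pos(2) C(1) by (simp flip: ennreal_mult)
    qed
  qed
  have "\<bar>f t x - f t y\<bar> \<le> \<epsilon>" if t: "t > 0" and xy: "\<bar>x - y\<bar> < K * m" for t x y
  proof (rule ccontr)
    assume contra: "\<not> \<bar>f t x - f t y\<bar> \<le> \<epsilon>"
    have near: "\<exists>d>0. \<forall>t' z'. \<bar>t' - t\<bar> \<le> d \<longrightarrow> \<bar>z' - z\<bar> \<le> d \<longrightarrow> \<bar>f t' z' - f t z\<bar> \<le> \<epsilon> / 4" for z
    proof -
      have "isCont (case_prod f) (t, z)"
        using f t open_strip_UNIV[OF open_greaterThan, of "0::real"]
        by (auto simp: continuous_on_eq_continuous_at)
      then obtain d where d: "d > 0" "\<And>p. dist p (t, z) < d \<Longrightarrow> dist (case_prod f p) (f t z) < \<epsilon> / 4"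
        unfolding continuous_at_eps_delta using \<epsilon> by (metis case_prod_conv divide_pos_pos zero_less_numeral)
      have "\<bar>f t' z' - f t z\<bar> \<le> \<epsilon> / 4" if "\<bar>t' - t\<bar> \<le> d / 3" "\<bar>z' - z\<bar> \<le> d / 3" for t' z'
      proof -
        have "dist (t', z') (t, z) \<le> \<bar>t' - t\<bar> + \<bar>z' - z\<bar>"
          unfolding dist_prod_def by (simp add: dist_real_def sqrt_sum_squares_le_sum_abs)
        then have "dist (t', z') (t, z) < d" using that d(1) by linarith
        from d(2)[OF this] show ?thesis by (simp add: dist_real_def)
      qed
      then show ?thesis using d(1) by (intro exI[of _ "d / 3"]) auto
    qed
    obtain d1 d2 where d: "d1 > 0" "d2 > 0"
      "\<And>t' z'. \<bar>t' - t\<bar> \<le> d1 \<Longrightarrow> \<bar>z' - x\<bar> \<le> d1 \<Longrightarrow> \<bar>f t' z' - f t x\<bar> \<le> \<epsilon> / 4"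
      "\<And>t' z'. \<bar>t' - t\<bar> \<le> d2 \<Longrightarrow> \<bar>z' - y\<bar> \<le> d2 \<Longrightarrow> \<bar>f t' z' - f t y\<bar> \<le> \<epsilon> / 4"
      using near[of x] near[of y] by metis
    \<comment> \<open>The first entry fits both mollifiers into an interval of length
      \<open>K * m\<close>; \<open>d1\<close> and \<open>d2\<close> keep the averages, and the time
      window of length \<open>3 * e = r\<close>, inside the continuity neighbourhoods.\<close>
    define r where "r = min (K * m - \<bar>x - y\<bar>) (min d1 d2)"
    have r: "r > 0" "r \<le> d1" "r \<le> d2" "\<bar>x - y\<bar> + r \<le> K * m"
      using xy d(1,2) by (auto simp: r_def)
    define e where "e = r / 3"
    define s where "s = sgn (f t x - f t y)"
    have "s * (LINT z|lborel. f t' z * (mollifier r x z - mollifier r y z)) \<ge> m"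
      if t': "t' \<in> {t..t + 3 * e}" for t'
    proof -
      have cont: "continuous_on UNIV (f t')"
        using t' t by (intro continuous_on_slice[OF f]) auto
      have tt: "\<bar>t' - t\<bar> \<le> d1" "\<bar>t' - t\<bar> \<le> d2" using t' r by (auto simp: e_def)
      have x: "f t x - \<epsilon> / 4 \<le> f t' z" "f t' z \<le> f t x + \<epsilon> / 4" if "z \<in> {x..x + r}" for z
      proof -
        have "\<bar>f t' z - f t x\<bar> \<le> \<epsilon> / 4"
          using d(3)[OF tt(1), of z] that r by auto
        then show "f t x - \<epsilon> / 4 \<le> f t' z" "f t' z \<le> f t x + \<epsilon> / 4"
          unfolding abs_le_iff by linarith+
      qed
      have y: "f t y - \<epsilon> / 4 \<le> f t' z" "f t' z \<le> f t y + \<epsilon> / 4" if "z \<in> {y..y + r}" for z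
      proof -
        have "\<bar>f t' z - f t y\<bar> \<le> \<epsilon> / 4"
          using d(4)[OF tt(2), of z] that r by auto
        then show "f t y - \<epsilon> / 4 \<le> f t' z" "f t' z \<le> f t y + \<epsilon> / 4"
          unfolding abs_le_iff by linarith+
      qed
      have "f t x - \<epsilon> / 4 \<le> (LINT z|lborel. f t' z * mollifier r x z)"
        "(LINT z|lborel. f t' z * mollifier r x z) \<le> f t x + \<epsilon> / 4"
        "f t y - \<epsilon> / 4 \<le> (LINT z|lborel. f t' z * mollifier r y z)"
        "(LINT z|lborel. f t' z * mollifier r y z) \<le> f t y + \<epsilon> / 4"
        using mollifier_average_ge[OF cont r(1)] mollifier_average_le[OF cont r(1)] x y by blast+
      then show ?thesis
        using contra unfolding integral_mult_mollifier_diff[OF cont r(1) r(1)] s_def m_def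
        by (auto simp: sgn_real_def abs_real_def split: if_splits)
    qed
    moreover have "\<bar>s\<bar> = 1" using contra \<epsilon> by (auto simp: s_def sgn_real_def)
    ultimately have "ennreal (m * e / 2) \<le> (\<integral>\<^sup>+ t'. indicator {t..t + 3 * e} t'
        * (\<integral>\<^sup>+ x. ennreal (K / 2 * (h t' x)\<^sup>2) \<partial>lborel) \<partial>lborel)"
      using r t pos(2) by (intro weak_dx_time_window[OF weak f h(1,2)]) (auto simp: e_def)
    also have "\<dots> \<le> (\<integral>\<^sup>+ t'. indicator {t..t + 3 * e} t' * ennreal (K / 2 * C) \<partial>lborel)"
      using hC t by (intro nn_integral_mono_AE) (auto elim!: eventually_mono simp: indicator_def)
    also have "\<dots> = ennreal (3 * e * (K / 2 * C))"
      using r(1) pos(2) C(1) by (simp add: nn_integral_multc e_def flip: ennreal_mult)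
    finally have "m * e / 2 \<le> 3 * e * (K / 2 * C)"
      using r(1) pos(2) C(1) by (simp add: e_def)
    then have "e * m \<le> e * (3 * K * C)" by (simp add: algebra_simps)
    then have "m \<le> 3 * K * C" using r(1) by (simp add: e_def)
    also have "\<dots> < m"
      using pos(1) C(1) by (simp add: K_def field_simps add_pos_nonneg)
    finally show False by simp
  qed
  then show ?thesis using pos by (intro exI[of _ "K * m"]) auto
qed

section \<open>Time regularity of local averages\<close>

text \<open>All mollifiers of width \<open>r\<close> are translates of one, so a single
  \<open>B\<close> serves every \<open>a\<close>; the time-Lipschitz constant of the averages is
  then independent of the place.\<close>

lemma deriv_mollifier_bound:
  assumes "r > 0"
  shows "\<exists>B\<ge>0. \<forall>a x. \<bar>deriv (mollifier r a) x\<bar> \<le> B * indicator {a..a + r} x"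
proof -
  define k where "k = deriv (mollifier r 0)"
  have shift: "mollifier r a x = mollifier r 0 (x - a)" for a x
    by (simp add: mollifier_def)
  obtain D where D: "\<And>x. (mollifier r 0 has_derivative D x) (at x)" "\<And>h. continuous_on UNIV (\<lambda>x. D x h)"
    using Ck_on_mollifier[of 1 r 0] by auto
  then have k: "(mollifier r 0 has_real_derivative k x) (at x)" for x
    unfolding k_def by (metis DERIV_deriv_iff_real_differentiable differentiable_def)
  have "D x 1 = k x" for x
    using has_derivative_unique[OF D(1) k[of x, unfolded has_field_derivative_def]] by simp
  then have cont: "continuous_on UNIV k" using D(2)[of 1] by simp
  then have "bounded (k ` {0..r})"
    by (intro compact_imp_bounded compact_continuous_image continuous_on_subset[OF cont]) auto
  then obtain B where B: "\<And>x. x \<in> {0..r} \<Longrightarrow> \<bar>k x\<bar> \<le> B"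
    by (force simp: bounded_iff)
  have zero: "k x = 0" if "x \<notin> {0..r}" for x
  proof -
    have "(mollifier r 0 has_real_derivative 0) (at x)"
    proof (rule has_field_derivative_transform_within_open[OF DERIV_const[of 0]])
      show "open (- {0..r})" by (simp add: open_Compl)
      show "0 = mollifier r 0 z" if "z \<in> - {0..r}" for z
        using that mollifier_eq_0[OF assms, of z 0] by auto
    qed (use that in auto)
    then show ?thesis using DERIV_unique k by blast
  qed
  have "\<bar>deriv (mollifier r a) x\<bar> \<le> B * indicator {a..a + r} x" for a x
  proof -
    have "((\<lambda>x. x - a) has_real_derivative 1) (at x)" by (auto intro!: derivative_eq_intros)
    from DERIV_chain2[OF k[of "x - a"] this] have "(mollifier r a has_real_derivative k (x - a)) (at x)"
      by (simp add: shift[of a, abs_def])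
    then have "deriv (mollifier r a) x = k (x - a)" by (rule DERIV_imp_deriv)
    then show ?thesis
      using B[of "x - a"] zero[of "x - a"] by (auto simp: indicator_def)
  qed
  moreover have "B \<ge> 0" using B[of 0] assms by auto
  ultimately show ?thesis by blast
qed

text \<open>A test function constant in time leaves only the flux against the derivative of the
  mollifier. The flux is at most a constant plus half the square of \<open>wvel\<close>, whose
  integral in space is bounded at almost every time.\<close>

lemma mass_average_lipschitz:
  assumes mass: "weak_mass_equation \<rho>\<^sub>b u\<^sub>b \<rho> u" and t: "0 < t1" "t1 \<le> t2"
    and \<rho>: "\<And>t x. 0 < t \<Longrightarrow> 0 \<le> \<rho> t x \<and> \<rho> t x \<le> C"
    and \<rho>\<^sub>b: "\<And>t x. 0 < t \<Longrightarrow> 0 \<le> \<rho>\<^sub>b t x \<and> \<rho>\<^sub>b t x \<le> R"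
    and u\<^sub>b: "\<And>t x. 0 < t \<Longrightarrow> \<bar>u\<^sub>b t x\<bar> \<le> U"
    and W: "case_prod (wvel \<rho> u u\<^sub>b) \<in> borel_measurable (lebesgue_on (strip t1 t2))"
    and Wt: "AE t in lborel. 0 < t \<longrightarrow> wvel \<rho> u u\<^sub>b t \<in> borel_measurable lebesgue \<and>
      (\<integral>\<^sup>+ x. ennreal ((wvel \<rho> u u\<^sub>b t x)\<^sup>2) \<partial>lebesgue) \<le> ennreal C"
    and r: "r > 0" and B: "B \<ge> 0" "\<And>x. \<bar>deriv (mollifier r a) x\<bar> \<le> B * indicator {a..a + r} x"
  shows "\<bar>(LINT x|lebesgue. (\<rho> t2 x - \<rho>\<^sub>b t2 x) * mollifier r a x)
      - (LINT x|lebesgue. (\<rho> t1 x - \<rho>\<^sub>b t1 x) * mollifier r a x)\<bar>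
    \<le> B * ((C / 2 + (C + R) * U) * r + C / 2) * (t2 - t1)"
proof -
  define V where "V = wvel \<rho> u u\<^sub>b"
  define M where "M = C / 2 + (C + R) * U"
  let ?J = "{a..a + r}" and ?S = "strip t1 t2"
  let ?\<zeta> = "\<lambda>(t::real) x. mollifier r a x"
  have C: "C \<ge> 0" using \<rho>[OF t(1), of 0] by linarith
  have R: "R \<ge> 0" using \<rho>\<^sub>b[OF t(1), of 0] by linarith
  have U: "U \<ge> 0" using u\<^sub>b[OF t(1), of 0] by linarith
  have M: "M \<ge> 0" using C R U by (simp add: M_def)
  define flux where "flux t x = (sqrt (\<rho> t x) * V t x + \<rho> t x * u\<^sub>b t x) - \<rho>\<^sub>b t x * u\<^sub>b t x" for t x
  have flux: "\<bar>flux t x\<bar> \<le> M + (V t x)\<^sup>2 / 2" if "0 < t" for t x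
  proof -
    \<comment> \<open>Young's inequality splits the product; the share \<open>\<rho> / 2\<close>, at
      most \<open>C / 2\<close>, is the first term of \<open>M\<close>.\<close>
    have "0 \<le> (sqrt (\<rho> t x) - \<bar>V t x\<bar>)\<^sup>2" by simp
    then have "\<bar>sqrt (\<rho> t x) * V t x\<bar> \<le> \<rho> t x / 2 + (V t x)\<^sup>2 / 2"
      using \<rho>[OF that, of x] by (simp add: power2_diff abs_mult)
    moreover have "\<bar>(\<rho> t x - \<rho>\<^sub>b t x) * u\<^sub>b t x\<bar> \<le> (C + R) * U"
      unfolding abs_mult using \<rho>[OF that, of x] \<rho>\<^sub>b[OF that, of x] u\<^sub>b[OF that, of x]
      by (intro mult_mono) auto
    moreover have "flux t x = sqrt (\<rho> t x) * V t x + (\<rho> t x - \<rho>\<^sub>b t x) * u\<^sub>b t x"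
      by (simp add: flux_def algebra_simps)
    ultimately show ?thesis
      using \<rho>[OF that, of x] unfolding M_def by linarith
  qed
  have S: "?S \<in> sets lebesgue" "open ?S"
    using open_strip_UNIV[of "{t1<..<t2}"] by (auto simp: strip_def)
  have "Ck_on 1 ({t1..t2} \<times> UNIV) (case_prod ?\<zeta>)"
    using Ck_on_subset[OF Ck_on_snd[OF Ck_on_mollifier] subset_UNIV] by (simp add: split_beta')
  moreover have "compact_support_in ({t1..t2} \<times> UNIV) (case_prod ?\<zeta>)"
  proof -
    have "mollifier r a x = 0" if "x \<notin> ?J" for x
      using that mollifier_eq_0[OF r, of x a] by auto
    then show ?thesis
      using compact_support_tensor[of t1 t2 "{t1..t2}" "\<lambda>_. 1" a "a + r" "mollifier r a"] by simp
  qed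
  ultimately have "C01 ({t1..t2} \<times> UNIV) (case_prod ?\<zeta>)"
    unfolding C01_def by blast
  then have "(LINT x|lebesgue. (\<rho> t2 x - \<rho>\<^sub>b t2 x) * mollifier r a x)
      - (LINT x|lebesgue. (\<rho> t1 x - \<rho>\<^sub>b t1 x) * mollifier r a x)
      = int_strip t1 t2 (\<lambda>t x. (\<rho> t x - \<rho>\<^sub>b t x) * dt ?\<zeta> t x + flux t x * dx ?\<zeta> t x)"
    using mass[unfolded weak_mass_equation_def, rule_format, of t1 t2 ?\<zeta>] t
    by (simp add: flux_def V_def)
  also have "\<dots> = int_strip t1 t2 (\<lambda>t x. flux t x * deriv (mollifier r a) x)"
    by (simp add: dt_def dx_def)
  finally have "ennreal \<bar>(LINT x|lebesgue. (\<rho> t2 x - \<rho>\<^sub>b t2 x) * mollifier r a x)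
      - (LINT x|lebesgue. (\<rho> t1 x - \<rho>\<^sub>b t1 x) * mollifier r a x)\<bar>
      \<le> (\<integral>\<^sup>+ p. ennreal \<bar>flux (fst p) (snd p) * deriv (mollifier r a) (snd p)\<bar> \<partial>lebesgue_on ?S)"
    using abs_integral_le_nn_integral[of "lebesgue_on ?S" "\<lambda>p. flux (fst p) (snd p) * deriv (mollifier r a) (snd p)"]
    by (simp add: split_beta' int_strip_def)
  also have "\<dots> \<le> (\<integral>\<^sup>+ p. ennreal (B * (M + (V (fst p) (snd p))\<^sup>2 / 2) * indicator ?J (snd p)) \<partial>lebesgue_on ?S)"
  proof (intro nn_integral_mono ennreal_leI)
    fix p assume "p \<in> space (lebesgue_on ?S)"
    then have "0 < fst p" using t by (auto simp: space_restrict_space strip_def)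
    then have "\<bar>flux (fst p) (snd p)\<bar> * \<bar>deriv (mollifier r a) (snd p)\<bar>
        \<le> (M + (V (fst p) (snd p))\<^sup>2 / 2) * (B * indicator ?J (snd p))"
      using flux B M by (intro mult_mono) auto
    then show "\<bar>flux (fst p) (snd p) * deriv (mollifier r a) (snd p)\<bar>
        \<le> B * (M + (V (fst p) (snd p))\<^sup>2 / 2) * indicator ?J (snd p)"
      by (simp add: abs_mult mult.left_commute mult.assoc)
  qed
  also have "\<dots> = (\<integral>\<^sup>+ p. ennreal (B * (M + (V (fst p) (snd p))\<^sup>2 / 2) * indicator ?J (snd p))
      * indicator ?S p \<partial>lebesgue)"
    using S by (intro nn_integral_restrict_space) auto
  also have "\<dots> \<le> (\<integral>\<^sup>+ t. ennreal (B * (M * r + C / 2)) * indicator {t1<..<t2} t \<partial>lborel)"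
  proof (rule nn_integral_lebesgue_le_iterated)
    have "(\<lambda>p. ennreal (B * (M + (V (fst p) (snd p))\<^sup>2 / 2) * indicator ?J (snd p)))
        \<in> borel_measurable (lebesgue_on ?S)"
    proof -
      have [measurable]: "(\<lambda>p. V (fst p) (snd p)) \<in> borel_measurable (lebesgue_on ?S)"
        using W by (simp add: V_def split_beta')
      have "(snd :: real \<times> real \<Rightarrow> real) \<in> borel_measurable borel"
        by (intro borel_measurable_continuous_onI continuous_intros)
      then have "(\<lambda>p::real \<times> real. indicator ?J (snd p) :: real) \<in> borel_measurable borel"
        by (rule measurable_compose) simp
      then have "(\<lambda>p. indicator ?J (snd p) :: real) \<in> borel_measurable (lebesgue_on ?S)"
        by (intro measurable_restrict_space1 measurable_completion) simp
      then show ?thesis by measurable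
    qed
    then show "(\<lambda>p. ennreal (B * (M + (V (fst p) (snd p))\<^sup>2 / 2) * indicator ?J (snd p))
        * indicator ?S p) \<in> borel_measurable lebesgue"
      using S(1) by (subst (asm) borel_measurable_restrict_space_iff_ennreal) auto
    show "AE t in lborel. (\<integral>\<^sup>+ x. ennreal (B * (M + (V (fst (t, x)) (snd (t, x)))\<^sup>2 / 2)
        * indicator ?J (snd (t, x))) * indicator ?S (t, x) \<partial>lebesgue)
        \<le> ennreal (B * (M * r + C / 2)) * indicator {t1<..<t2} t"
      using Wt
    proof eventually_elim
      case (elim t)
      show ?case
      proof (cases "t \<in> {t1<..<t2}")
        case False
        then show ?thesis by (simp add: strip_def)
      next
        case True
        then have Vt: "V t \<in> borel_measurable lebesgue"
          "(\<integral>\<^sup>+ x. ennreal ((V t x)\<^sup>2) \<partial>lebesgue) \<le> ennreal C"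
          using elim t by (auto simp: V_def)
        note [measurable] = Vt(1)
        have "(\<integral>\<^sup>+ x. ennreal (B * (M + (V t x)\<^sup>2 / 2) * indicator ?J x) \<partial>lebesgue)
            \<le> (\<integral>\<^sup>+ x. ennreal (B * M) * indicator ?J x + ennreal (B / 2) * ennreal ((V t x)\<^sup>2) \<partial>lebesgue)"
          using B M by (intro nn_integral_mono)
            (auto simp: indicator_def algebra_simps simp flip: ennreal_plus ennreal_mult)
        also have "\<dots> = ennreal (B * M) * ennreal r + ennreal (B / 2) * (\<integral>\<^sup>+ x. ennreal ((V t x)\<^sup>2) \<partial>lebesgue)"
        proof -
          have "(\<lambda>x. ennreal (B * M) * indicator ?J x) \<in> borel_measurable lebesgue"
            by (intro measurable_completion) measurable
          moreover have sq: "(\<lambda>x. ennreal ((V t x)\<^sup>2)) \<in> borel_measurable lebesgue" by measurable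
          then have "(\<lambda>x. ennreal (B / 2) * ennreal ((V t x)\<^sup>2)) \<in> borel_measurable lebesgue"
            by measurable
          ultimately show ?thesis
            using r by (simp add: nn_integral_add nn_integral_cmult[OF sq] nn_integral_cmult_indicator)
        qed
        also have "\<dots> \<le> ennreal (B * M) * ennreal r + ennreal (B / 2) * ennreal C"
          using Vt(2) by (intro add_left_mono mult_left_mono) auto
        also have "\<dots> = ennreal (B * (M * r + C / 2))"
          using B M C r by (simp add: algebra_simps flip: ennreal_plus ennreal_mult)
        finally show ?thesis using True by (simp add: strip_def)
      qed
    qed
  qed
  also have "\<dots> = ennreal (B * (M * r + C / 2) * (t2 - t1))"
    using B M C r t by (simp add: nn_integral_cmult ennreal_mult)
  finally show ?thesis
    unfolding M_def[symmetric] using B M C r t by (subst (asm) ennreal_le_iff) auto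
qed

section \<open>The relative potential\<close>

text \<open>Strict convexity of \<open>s powr \<gamma>\<close>, by the mean value theorem on either
  side of \<open>b\<close>. It needs only continuity at the end points, so vacuum
  \<open>r = 0\<close> is covered.\<close>

lemma rel_potential_pos:
  assumes "\<gamma> > 1" "r \<ge> 0" "b > 0" "r \<noteq> b"
  shows "rel_potential \<gamma> r b > 0"
proof -
  have cont: "continuous_on {x..y} (\<lambda>s::real. s powr \<gamma>)" if "x \<ge> 0" for x y
    using that assms(1) by (intro continuous_on_powr' continuous_intros) auto
  have deriv: "((\<lambda>s. s powr \<gamma>) has_real_derivative \<gamma> * s powr (\<gamma> - 1)) (at s)" if "s > 0" for s
    using that assms(1) by (auto intro!: derivative_eq_intros)
  have diff: "(\<lambda>s. s powr \<gamma>) differentiable (at s)" if "s > 0" for s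
    using deriv[OF that] real_differentiable_def by blast
  have "(r powr \<gamma> - b powr \<gamma> - \<gamma> * b powr (\<gamma> - 1) * (r - b)) > 0"
  proof (cases "r < b")
    case True
    obtain l z where z: "r < z" "z < b" "DERIV (\<lambda>s. s powr \<gamma>) z :> l"
      "b powr \<gamma> - r powr \<gamma> = (b - r) * l"
      using MVT[OF True cont[OF assms(2)] diff] assms(2) by auto
    have "l = \<gamma> * z powr (\<gamma> - 1)"
      using DERIV_unique[OF z(3) deriv] z(1) assms(2) by auto
    moreover have "\<gamma> * z powr (\<gamma> - 1) < \<gamma> * b powr (\<gamma> - 1)"
      using z assms by (intro mult_strict_left_mono powr_less_mono2) auto
    ultimately have "(b - r) * l < (b - r) * (\<gamma> * b powr (\<gamma> - 1))"
      using True by (intro mult_strict_left_mono) auto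
    then show ?thesis using z(4) by (simp add: algebra_simps)
  next
    case False
    then have br: "b < r" using assms(4) by simp
    obtain l z where z: "b < z" "z < r" "DERIV (\<lambda>s. s powr \<gamma>) z :> l"
      "r powr \<gamma> - b powr \<gamma> = (r - b) * l"
      using MVT[OF br cont diff] assms(3) by auto
    have "l = \<gamma> * z powr (\<gamma> - 1)"
      using DERIV_unique[OF z(3) deriv] z(1) assms(3) by auto
    moreover have "\<gamma> * b powr (\<gamma> - 1) < \<gamma> * z powr (\<gamma> - 1)"
      using z assms by (intro mult_strict_left_mono powr_less_mono2) auto
    ultimately have "(r - b) * (\<gamma> * b powr (\<gamma> - 1)) < (r - b) * l"
      using br by (intro mult_strict_left_mono) auto
    then show ?thesis using z(4) by (simp add: algebra_simps)
  qed
  then show ?thesis using assms(1) by (simp add: rel_potential_def)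
qed

lemma rel_potential_nonneg:
  assumes "\<gamma> > 1" "r \<ge> 0" "b > 0"
  shows "rel_potential \<gamma> r b \<ge> 0"
  using rel_potential_pos[OF assms] by (cases "r = b") (auto simp: rel_potential_def)

lemma compact_pos_lower_bound:
  fixes f :: "'a::topological_space \<Rightarrow> real"
  assumes "compact Z" "continuous_on Z f" "\<And>z. z \<in> Z \<Longrightarrow> f z > 0"
  shows "\<exists>c>0. \<forall>z\<in>Z. c \<le> f z"
proof (cases "Z = {}")
  case True
  then show ?thesis by (intro exI[of _ 1]) auto
next
  case False
  with continuous_attains_inf[OF assms(1) False assms(2)] assms(3) show ?thesis by blast
qed

lemma continuous_on_powr_diff:
  assumes "\<kappa> > 0" "rm > 0"
  shows "continuous_on ({0..C} \<times> {rm..rp}) (\<lambda>p::real \<times> real. fst p powr \<kappa> - snd p powr \<kappa>)"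
  using assms by (intro continuous_intros continuous_on_powr') auto

text \<open>Compactness of the pairs at distance at least \<open>\<delta>\<close>, whose powers
  differ by strict monotonicity. The factor \<open>s\<close> is the sign of \<open>r - b\<close>, so
  excess and deficit of density are treated together.\<close>

lemma powr_diff_coercive:
  fixes \<kappa> rm \<delta> :: real
  assumes "\<kappa> > 0" "rm > 0" "\<delta> > 0"
  shows "\<exists>c>0. \<forall>r\<in>{0..C}. \<forall>b\<in>{rm..rp}. \<forall>s. \<bar>s\<bar> = 1 \<longrightarrow> s * (r - b) \<ge> \<delta> \<longrightarrow>
    s * (r powr \<kappa> - b powr \<kappa>) \<ge> c"
proof -
  let ?f = "\<lambda>p::real \<times> real. \<bar>fst p powr \<kappa> - snd p powr \<kappa>\<bar>"
  let ?Z = "({0..C} \<times> {rm..rp}) \<inter> {p. \<bar>fst p - snd p\<bar> \<ge> \<delta>}"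
  have "closed {p::real \<times> real. \<bar>fst p - snd p\<bar> \<ge> \<delta>}"
    by (intro closed_Collect_le continuous_intros)
  then have "compact ?Z"
    by (intro compact_Int_closed compact_Times) auto
  moreover have "continuous_on ?Z ?f"
    by (intro continuous_on_rabs continuous_on_subset[OF continuous_on_powr_diff[OF assms(1,2)]]) auto
  moreover have "?f p > 0" if p: "p \<in> ?Z" for p
  proof -
    have "fst p \<noteq> snd p" "fst p \<ge> 0" "snd p > 0" using p assms by auto
    then show ?thesis
      using powr_less_mono2[of \<kappa> "fst p" "snd p"] powr_less_mono2[of \<kappa> "snd p" "fst p"] assms(1)
      by (cases "fst p < snd p") auto
  qed
  ultimately obtain c where c: "c > 0" "\<And>p. p \<in> ?Z \<Longrightarrow> c \<le> ?f p"
    using compact_pos_lower_bound[of ?Z ?f] by blast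
  have "s * (r powr \<kappa> - b powr \<kappa>) \<ge> c"
    if rb: "r \<in> {0..C}" "b \<in> {rm..rp}" and s: "\<bar>s\<bar> = 1" "s * (r - b) \<ge> \<delta>" for r b s
  proof -
    consider "s = 1" | "s = - 1" using s(1) by linarith
    then show ?thesis
    proof cases
      case 1
      then have "(r, b) \<in> ?Z" "b \<le> r" using rb s(2) assms(3) by auto
      moreover have "b powr \<kappa> \<le> r powr \<kappa>"
        using \<open>b \<le> r\<close> rb assms by (intro powr_mono2) auto
      ultimately show ?thesis using c(2)[of "(r, b)"] 1 by simp
    next
      case 2
      then have "(r, b) \<in> ?Z" "r \<le> b" using rb s(2) assms(3) by auto
      moreover have "r powr \<kappa> \<le> b powr \<kappa>"
        using \<open>r \<le> b\<close> rb assms by (intro powr_mono2) auto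
      ultimately show ?thesis using c(2)[of "(r, b)"] 2 by simp
    qed
  qed
  then show ?thesis using c(1) by blast
qed

text \<open>Near the diagonal the potential vanishes quadratically but the difference of powers only
  linearly; the term \<open>\<epsilon>\<close> absorbs that region. Where the difference is at least
  \<open>\<epsilon>\<close>, it is bounded while the potential has a positive minimum by
  compactness.\<close>

lemma powr_diff_le_rel_potential:
  fixes \<kappa> \<gamma> rm \<epsilon> :: real
  assumes "\<kappa> > 0" "\<gamma> > 1" "rm > 0" "\<epsilon> > 0"
  shows "\<exists>K\<ge>0. \<forall>r\<in>{0..C}. \<forall>b\<in>{rm..rp}. \<bar>r powr \<kappa> - b powr \<kappa>\<bar> \<le> \<epsilon> + K * rel_potential \<gamma> r b"
proof -
  let ?f = "\<lambda>p::real \<times> real. \<bar>fst p powr \<kappa> - snd p powr \<kappa>\<bar>"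
  let ?D = "{0..C} \<times> {rm..rp}"
  let ?g = "\<lambda>p. rel_potential \<gamma> (fst p) (snd p)"
  have f: "continuous_on ?D ?f"
    by (intro continuous_on_rabs continuous_on_powr_diff[OF assms(1,3)])
  have D: "compact ?D" by (intro compact_Times) auto
  define Z where "Z = {p \<in> ?D. \<epsilon> \<le> ?f p}"
  have "Z = ?D \<inter> ?f -` {\<epsilon>..}" by (auto simp: Z_def)
  then have "closed Z"
    using continuous_closed_preimage[OF f _ closed_atLeast] D by (simp add: compact_imp_closed)
  then have "compact (?D \<inter> Z)" by (rule compact_Int_closed[OF D])
  moreover have "?D \<inter> Z = Z" by (auto simp: Z_def)
  ultimately have "compact Z" by simp
  moreover have "continuous_on Z ?g"
    unfolding rel_potential_def Z_def using assms
    by (intro continuous_intros continuous_on_powr') auto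
  moreover have "?g p > 0" if "p \<in> Z" for p
    using that assms by (intro rel_potential_pos) (auto simp: Z_def)
  ultimately obtain m where m: "m > 0" "\<And>p. p \<in> Z \<Longrightarrow> m \<le> ?g p"
    using compact_pos_lower_bound[of Z ?g] by blast
  have "bounded (?f ` ?D)"
    using f D by (intro compact_imp_bounded compact_continuous_image)
  then obtain M where M: "\<And>p. p \<in> ?D \<Longrightarrow> ?f p \<le> M"
    by (force simp: bounded_iff)
  have "\<bar>r powr \<kappa> - b powr \<kappa>\<bar> \<le> \<epsilon> + \<bar>M\<bar> / m * rel_potential \<gamma> r b"
    if rb: "r \<in> {0..C}" "b \<in> {rm..rp}" for r b
  proof (cases "(r, b) \<in> Z")
    case True
    have "\<bar>r powr \<kappa> - b powr \<kappa>\<bar> \<le> \<bar>M\<bar>" using M[of "(r, b)"] rb by simp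
    also have "\<dots> = \<bar>M\<bar> / m * m" using m(1) by simp
    also have "\<dots> \<le> \<bar>M\<bar> / m * rel_potential \<gamma> r b"
      using m(1) m(2)[OF True] by (intro mult_left_mono) auto
    finally show ?thesis using assms(4) by simp
  next
    case False
    then have "\<bar>r powr \<kappa> - b powr \<kappa>\<bar> \<le> \<epsilon>" using rb by (auto simp: Z_def)
    moreover have "\<bar>M\<bar> / m * rel_potential \<gamma> r b \<ge> 0"
      using m(1) rb assms rel_potential_nonneg[of \<gamma> r b] by auto
    ultimately show ?thesis by linarith
  qed
  then show ?thesis using m(1) by (intro exI[of _ "\<bar>M\<bar> / m"]) auto
qed

section \<open>Convergence to the rarefaction wave\<close>

text \<open>The exceptional null set may depend on \<open>T\<close>; restricting to integers
  \<open>T\<close> leaves countably many.\<close>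

lemma AE_positive_times:
  fixes Q :: "real \<Rightarrow> bool"
  assumes "\<And>T. T > 0 \<Longrightarrow> AE t in lebesgue_on {0<..<T}. Q t"
  shows "AE t in lborel. 0 < t \<longrightarrow> Q t"
proof -
  have "AE t in lborel. t \<in> {0<..<real (Suc n)} \<longrightarrow> Q t" for n
    using assms[of "real (Suc n)"] by (simp add: AE_restrict_space_iff AE_completion_iff)
  then have "AE t in lborel. \<forall>n. t \<in> {0<..<real (Suc n)} \<longrightarrow> Q t"
    by (subst AE_all_countable) blast
  then show ?thesis
  proof eventually_elim
    case (elim t)
    obtain n where "t < real n" using reals_Archimedean2 by blast
    then have "t < real (Suc n)" by simp
    then show ?case using elim by auto
  qed
qed

text \<open>This frees the dissipation bound, which does not involve \<open>t\<close>, from the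
  quantifier over almost every time in \<open>uniform_bound\<close>; an interval of positive length
  is not a null set.\<close>

lemma AE_lebesgue_on_const:
  fixes T :: real
  assumes "AE t in lebesgue_on {0<..<T}. P" "T > 0"
  shows P
proof -
  have "emeasure (lebesgue_on {0<..<T}) (space (lebesgue_on {0<..<T})) \<noteq> 0"
    using assms(2) by (simp add: emeasure_restrict_space space_restrict_space)
  then have "ae_filter (lebesgue_on {0<..<T}) \<noteq> bot"
    by (simp add: ae_filter_eq_bot_iff)
  then show P using assms(1) by (simp add: eventually_const_iff)
qed

text \<open>The integrals over \<open>{0<..<T}\<close> are bounded by \<open>C\<close> and approach
  their supremum \<open>S\<close>. Past a time where \<open>S\<close> is reached up to
  \<open>\<epsilon>\<close>, a further disjoint interval adds at most
  \<open>\<epsilon>\<close>.\<close>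

lemma nn_integral_tail:
  fixes N :: "real \<Rightarrow> ennreal"
  assumes [measurable]: "N \<in> borel_measurable borel" and C: "C \<ge> 0"
    and bound: "\<And>T. T > 0 \<Longrightarrow> (\<integral>\<^sup>+ t. indicator {0<..<T} t * N t \<partial>lborel) \<le> ennreal C"
    and \<epsilon>: "\<epsilon> > 0"
  shows "\<exists>T0>0. \<forall>a\<ge>T0. \<forall>b\<ge>a. (\<integral>\<^sup>+ t. indicator {a..b} t * N t \<partial>lborel) \<le> ennreal \<epsilon>"
proof -
  define A where "A T = (\<integral>\<^sup>+ t. indicator {0<..<T} t * N t \<partial>lborel)" for T
  define S where "S = (SUP T\<in>{0<..}. enn2real (A T))"
  have A: "A T = ennreal (enn2real (A T))" "enn2real (A T) \<le> C" if "T > 0" for T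
  proof -
    have "A T \<le> ennreal C" using bound[OF that] by (simp add: A_def)
    then show "A T = ennreal (enn2real (A T))" "enn2real (A T) \<le> C"
      using C by (auto simp: enn2real_leI ennreal_enn2real_if top_unique)
  qed
  have bdd: "bdd_above ((\<lambda>T. enn2real (A T)) ` {0<..})"
    using A(2) by (auto intro!: bdd_aboveI[of _ C])
  have "\<exists>T0\<in>{0<..}. S - \<epsilon> < enn2real (A T0)"
    using \<epsilon> bdd by (subst less_cSUP_iff[symmetric]) (auto simp: S_def)
  then obtain T0 where T0: "T0 > 0" "S - \<epsilon> < enn2real (A T0)" by auto
  have "(\<integral>\<^sup>+ t. indicator {a..b} t * N t \<partial>lborel) \<le> ennreal \<epsilon>" if ab: "a \<ge> T0" "b \<ge> a" for a b
  proof -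
    define X where "X = (\<integral>\<^sup>+ t. indicator {a..b} t * N t \<partial>lborel)"
    have "A T0 + X = (\<integral>\<^sup>+ t. indicator {0<..<T0} t * N t + indicator {a..b} t * N t \<partial>lborel)"
      unfolding A_def X_def by (rule nn_integral_add[symmetric]) measurable
    also have "\<dots> \<le> A (b + 1)"
      unfolding A_def using ab T0(1) by (intro nn_integral_mono) (auto simp: indicator_def)
    also have "\<dots> \<le> ennreal S"
      using ab T0(1) bdd by (subst A(1)) (auto simp: S_def intro!: ennreal_leI cSUP_upper)
    also have "S \<le> enn2real (A T0) + \<epsilon>" using T0(2) by simp
    then have "ennreal S \<le> ennreal (enn2real (A T0)) + ennreal \<epsilon>"
      using \<epsilon> by (simp flip: ennreal_plus)
    also have "\<dots> = A T0 + ennreal \<epsilon>" using A(1)[OF T0(1)] by simp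
    finally have "A T0 + X \<le> A T0 + ennreal \<epsilon>" .
    moreover have "A T0 \<noteq> top" using A(1)[OF T0(1)] by (metis ennreal_neq_top)
    ultimately show ?thesis by (simp add: ennreal_add_left_cancel_le X_def)
  qed
  then show ?thesis using T0(1) by blast
qed

lemma continuous_on_positive_times:
  assumes "\<And>T. T > 0 \<Longrightarrow> continuous_on (strip 0 T) f"
  shows "continuous_on ({0<..} \<times> UNIV) f"
proof -
  have "open (strip 0 T)" for T
    by (simp add: strip_def open_strip_UNIV)
  then have "continuous_on (\<Union>T\<in>{0<..}. strip 0 T) f"
    using assms by (intro continuous_on_open_UN) auto
  moreover have "(\<Union>T\<in>{0<..}. strip 0 T) = {0<..} \<times> UNIV"
  proof -
    have "\<exists>T\<in>{0<..}. t < T" if "t > 0" for t :: real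
      using that by (intro bexI[of _ "t + 1"]) auto
    then show ?thesis by (auto simp: strip_def)
  qed
  ultimately show ?thesis by simp
qed

text \<open>The bound \<open>C\<close> confines the powers to a compact interval, on which the
  inverse power is uniformly continuous, also at vacuum.\<close>

lemma powr_equicontinuous_imp:
  fixes f :: "real \<Rightarrow> real \<Rightarrow> real"
  assumes a: "a > 0" and f: "\<And>t x. 0 < t \<Longrightarrow> 0 \<le> f t x \<and> f t x \<le> C"
    and equi: "\<And>\<epsilon>. \<epsilon> > 0 \<Longrightarrow> \<exists>\<delta>>0. \<forall>t>0. \<forall>x y. \<bar>x - y\<bar> < \<delta> \<longrightarrow> \<bar>f t x powr a - f t y powr a\<bar> \<le> \<epsilon>"
    and \<epsilon>: "\<epsilon> > 0"
  shows "\<exists>\<delta>>0. \<forall>t>0. \<forall>x y. \<bar>x - y\<bar> < \<delta> \<longrightarrow> \<bar>f t x - f t y\<bar> < \<epsilon>"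
proof -
  let ?G = "\<lambda>z::real. z powr (1 / a)"
  have "continuous_on {0..C powr a} ?G"
    using a by (intro continuous_on_powr' continuous_intros) auto
  then have "uniformly_continuous_on {0..C powr a} ?G"
    by (intro compact_uniformly_continuous) auto
  then obtain d where d: "d > 0" "\<And>y z. y \<in> {0..C powr a} \<Longrightarrow> z \<in> {0..C powr a} \<Longrightarrow>
      \<bar>y - z\<bar> < d \<Longrightarrow> \<bar>?G y - ?G z\<bar> < \<epsilon>"
    using \<epsilon> unfolding uniformly_continuous_on_def dist_real_def by metis
  obtain \<delta> where \<delta>: "\<delta> > 0"
    "\<And>t x y. t > 0 \<Longrightarrow> \<bar>x - y\<bar> < \<delta> \<Longrightarrow> \<bar>f t x powr a - f t y powr a\<bar> \<le> d / 2"
    using equi[of "d / 2"] d(1) by auto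
  have "\<bar>f t x - f t y\<bar> < \<epsilon>" if "t > 0" "\<bar>x - y\<bar> < \<delta>" for t x y
  proof -
    have G: "?G (f t z powr a) = f t z" "f t z powr a \<in> {0..C powr a}" for z
      using f[OF that(1), of z] a by (auto simp: powr_powr powr_mono2)
    have "\<bar>f t x powr a - f t y powr a\<bar> < d"
      using \<delta>(2)[OF that] d(1) by linarith
    from d(2)[OF G(2) G(2) this] show ?thesis by (simp add: G(1))
  qed
  then show ?thesis using \<delta>(1) by blast
qed

text \<open>The decay in \<open>L\<close> makes long averages of an integrable function
  small.\<close>

lemma mollifier_le: "\<exists>B>0. \<forall>L>0. \<forall>a x. mollifier L a x \<le> B / L"
proof -
  obtain B where "B > 0" "\<And>x. step_kernel x \<le> B" using step_kernel_bounded by blast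
  then show ?thesis
    by (intro exI[of _ B]) (auto simp: mollifier_def intro!: divide_right_mono)
qed

theorem theorem2p2:
  fixes \<alpha> \<gamma> q rm um rp up :: real
  assumes "\<gamma> > 1" and "\<alpha> > 1/2" and "q \<ge> 2" and "rm > 0" and "rp > 0"
    and "two_rarefaction \<gamma> rm um rp up"
  shows "\<exists>\<eta>0>0. \<forall>\<eta> (\<rho>\<^sub>b :: real \<Rightarrow> real \<Rightarrow> real) (u\<^sub>b :: real \<Rightarrow> real \<Rightarrow> real)
            (\<rho>0 :: real \<Rightarrow> real) (m0 :: real \<Rightarrow> real)
            (\<rho> :: real \<Rightarrow> real \<Rightarrow> real) (u :: real \<Rightarrow> real \<Rightarrow> real).
           0 < \<eta> \<longrightarrow> \<eta> \<le> \<eta>0 \<longrightarrow>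
           smooth_rarefaction_wave \<gamma> rm um rp up q \<eta> \<rho>\<^sub>b u\<^sub>b \<longrightarrow>
           admissible_data \<alpha> \<gamma> rm um rp up (\<rho>\<^sub>b 0) (u\<^sub>b 0) \<rho>0 m0 \<longrightarrow>
           weak_solution_towards \<alpha> \<gamma> \<rho>\<^sub>b u\<^sub>b \<rho>0 m0 \<rho> u \<longrightarrow>
           (\<exists>C. \<forall>T>0. uniform_bound \<alpha> \<gamma> \<rho>\<^sub>b u\<^sub>b \<rho> u C T) \<longrightarrow>
           ((\<lambda>t. SUP x. ereal \<bar>\<rho> t x - \<rho>\<^sub>b t x\<bar>) \<longlongrightarrow> 0) at_top"
proof (intro exI[of _ 1] conjI allI impI)
  \<comment> \<open>The wave estimates are available for every positive \<open>\<eta>\<close>, so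
    the threshold is set to 1.\<close>
  fix \<eta> \<rho>\<^sub>b u\<^sub>b \<rho>0 m0 \<rho> u
  assume \<eta>: "0 < \<eta>" and wave: "smooth_rarefaction_wave \<gamma> rm um rp up q \<eta> \<rho>\<^sub>b u\<^sub>b"
    and sol: "weak_solution_towards \<alpha> \<gamma> \<rho>\<^sub>b u\<^sub>b \<rho>0 m0 \<rho> u"
    and "\<exists>C. \<forall>T>0. uniform_bound \<alpha> \<gamma> \<rho>\<^sub>b u\<^sub>b \<rho> u C T"
  then obtain C where UB: "\<And>T. T > 0 \<Longrightarrow> uniform_bound \<alpha> \<gamma> \<rho>\<^sub>b u\<^sub>b \<rho> u C T" by blast

  \<comment> \<open>Ranges, continuity and weak derivatives\<close>
  have "q \<ge> 1" using assms(3) by simp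
  note wave_props = smooth_rarefaction_wave_properties[OF assms(1) this assms(4,5) \<eta> assms(6) wave]
  have \<rho>\<^sub>b: "\<rho>\<^sub>b t x \<in> {rm..rp}" if "t > 0" for t x
    using wave_props(1) that by simp
  have \<rho>\<^sub>b_cont: "continuous_on ({0<..} \<times> UNIV) (case_prod \<rho>\<^sub>b)"
    by (rule continuous_on_subset[OF wave_props(2)]) auto
  obtain U where U: "\<And>t x. 0 < t \<Longrightarrow> \<bar>u\<^sub>b t x\<bar> \<le> U"
    using wave_props(4) by (meson less_imp_le)
  have \<rho>: "0 \<le> \<rho> t x \<and> \<rho> t x \<le> C" if "0 < t" for t x
    using UB[OF that] that unfolding uniform_bound_def by auto
  have C: "C \<ge> 0" using \<rho>[of 1 0] by simp
  have \<rho>_cont: "continuous_on ({0<..} \<times> UNIV) (case_prod \<rho>)"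
    using UB unfolding uniform_bound_def by (intro continuous_on_positive_times) blast
  define \<kappa> where "\<kappa> = (\<gamma> + \<alpha> - 1) / 2"
  have \<kappa>: "\<kappa> > 0" using assms by (simp add: \<kappa>_def)
  define v where "v t x = rho_pow \<kappa> \<rho> t x - rho_pow \<kappa> \<rho>\<^sub>b t x" for t x
  have v_eq: "v t x = \<rho> t x powr \<kappa> - \<rho>\<^sub>b t x powr \<kappa>" for t x
    by (simp add: v_def rho_pow_def)
  have v_cont: "continuous_on ({0<..} \<times> UNIV) (case_prod v)"
    unfolding v_def rho_pow_def split_beta'
    using \<kappa> \<rho> \<rho>\<^sub>b assms(4) \<rho>_cont \<rho>\<^sub>b_cont
    by (intro continuous_intros continuous_on_powr') (auto simp: split_beta' intro: order_trans less_imp_le)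
  have v_weak: "has_weak_dx v (weak_dx v)"
  proof -
    \<comment> \<open>This clause of \<open>uniform_bound\<close> is the same for every
      \<open>T\<close>, so time 1 will do. Given existence, the choice operator in
      \<open>weak_dx\<close> returns an actual weak derivative.\<close>
    have "\<exists>g. has_weak_dx v g"
      using UB[OF zero_less_one] unfolding uniform_bound_def v_def[abs_def] \<kappa>_def by (elim conjE)
    then show ?thesis unfolding weak_dx_def by (rule someI_ex)
  qed
  define \<beta> where "\<beta> = \<alpha> - 1/2"
  have \<beta>: "\<beta> > 0" using assms(2) by (simp add: \<beta>_def)
  have \<rho>\<beta>_weak: "has_weak_dx (rho_pow \<beta> \<rho>) (weak_dx (rho_pow \<beta> \<rho>))"
  proof -
    have "\<exists>g. has_weak_dx (rho_pow \<beta> \<rho>) g"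
      using sol unfolding weak_solution_towards_def solution_class_def \<beta>_def by (elim conjE)
    then show ?thesis unfolding weak_dx_def by (rule someI_ex)
  qed
  have \<rho>\<beta>_cont: "continuous_on ({0<..} \<times> UNIV) (case_prod (rho_pow \<beta> \<rho>))"
    unfolding rho_pow_def split_beta'
    using \<beta> \<rho> \<rho>_cont
    by (intro continuous_intros continuous_on_powr') (auto simp: split_beta')

  \<comment> \<open>Energy and dissipation bounds for all positive times\<close>
  define W where "W = wvel \<rho> u u\<^sub>b"
  define P where "P t x = rel_potential \<gamma> (\<rho> t x) (\<rho>\<^sub>b t x)" for t x
  have P: "P t x \<ge> 0" if "t > 0" for t x
    using \<rho>[OF that, of x] \<rho>\<^sub>b[OF that, of x] assms(1,4)
    unfolding P_def by (intro rel_potential_nonneg) auto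
  have energy: "AE t in lborel. 0 < t \<longrightarrow>
      (\<integral>\<^sup>+ x. ennreal (\<bar>W t x\<bar>\<^sup>2 + (weak_dx (rho_pow \<beta> \<rho>) t x)\<^sup>2 + P t x) \<partial>lebesgue) \<le> ennreal C"
  proof (rule AE_positive_times)
    fix T :: real assume "T > 0"
    then obtain \<Lambda> where "AE t in lebesgue_on {0<..<T}.
        (\<integral>\<^sup>+ x. ennreal (\<bar>W t x\<bar>\<^sup>2 + (weak_dx (rho_pow \<beta> \<rho>) t x)\<^sup>2 + P t x) \<partial>lebesgue)
        + (\<integral>\<^sup>+ (t, x). ennreal ((weak_dx v t x)\<^sup>2 + (\<Lambda> t x)\<^sup>2) \<partial>lebesgue_on (strip 0 T)) \<le> ennreal C"
      using UB[of T] unfolding uniform_bound_def W_def P_def \<beta>_def v_def[abs_def] \<kappa>_def by blast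
    \<comment> \<open>The space-time term, in which \<open>\<Lambda>\<close> may change with
      \<open>T\<close>, is nonnegative and is dropped.\<close>
    then show "AE t in lebesgue_on {0<..<T}.
        (\<integral>\<^sup>+ x. ennreal (\<bar>W t x\<bar>\<^sup>2 + (weak_dx (rho_pow \<beta> \<rho>) t x)\<^sup>2 + P t x) \<partial>lebesgue) \<le> ennreal C"
      by (rule eventually_mono) (rule order_trans[OF add_increasing2[OF zero_le order_refl]])
  qed
  have dissipation: "(\<integral>\<^sup>+ p. ennreal ((weak_dx v (fst p) (snd p))\<^sup>2) \<partial>lebesgue_on (strip 0 T)) \<le> ennreal C"
    if T: "T > 0" for T
  proof -
    obtain \<Lambda> where "AE t in lebesgue_on {0<..<T}.
        (\<integral>\<^sup>+ x. ennreal (\<bar>W t x\<bar>\<^sup>2 + (weak_dx (rho_pow \<beta> \<rho>) t x)\<^sup>2 + P t x) \<partial>lebesgue)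
        + (\<integral>\<^sup>+ (t, x). ennreal ((weak_dx v t x)\<^sup>2 + (\<Lambda> t x)\<^sup>2) \<partial>lebesgue_on (strip 0 T)) \<le> ennreal C"
      using UB[OF T] unfolding uniform_bound_def W_def P_def \<beta>_def v_def[abs_def] \<kappa>_def by blast
    then have "AE t in lebesgue_on {0<..<T}.
        (\<integral>\<^sup>+ (t, x). ennreal ((weak_dx v t x)\<^sup>2 + (\<Lambda> t x)\<^sup>2) \<partial>lebesgue_on (strip 0 T)) \<le> ennreal C"
      by (rule eventually_mono) (rule order_trans[OF add_increasing[OF zero_le order_refl]])
    from AE_lebesgue_on_const[OF this T]
    have "(\<integral>\<^sup>+ (t, x). ennreal ((weak_dx v t x)\<^sup>2 + (\<Lambda> t x)\<^sup>2) \<partial>lebesgue_on (strip 0 T)) \<le> ennreal C" .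
    moreover have "(\<integral>\<^sup>+ p. ennreal ((weak_dx v (fst p) (snd p))\<^sup>2) \<partial>lebesgue_on (strip 0 T))
        \<le> (\<integral>\<^sup>+ (t, x). ennreal ((weak_dx v t x)\<^sup>2 + (\<Lambda> t x)\<^sup>2) \<partial>lebesgue_on (strip 0 T))"
      by (intro nn_integral_mono) (auto intro!: ennreal_leI)
    ultimately show ?thesis by (rule order_trans[rotated])
  qed
  have W_energy: "AE t in lborel. 0 < t \<longrightarrow> W t \<in> borel_measurable lebesgue \<and>
      (\<integral>\<^sup>+ x. ennreal ((W t x)\<^sup>2) \<partial>lebesgue) \<le> ennreal C"
  proof -
    have "AE t in lborel. 0 < t \<longrightarrow> W t \<in> borel_measurable lebesgue"
    proof (rule AE_positive_times)
      fix T :: real assume "T > 0"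
      then have "Linf_L2 T W"
        using sol unfolding weak_solution_towards_def solution_class_def W_def by blast
      then show "AE t in lebesgue_on {0<..<T}. W t \<in> borel_measurable lebesgue"
        unfolding Linf_L2_def L2_on_def by (auto elim!: eventually_mono)
    qed
    with energy show ?thesis
    proof eventually_elim
      case (elim t)
      have "(\<integral>\<^sup>+ x. ennreal ((W t x)\<^sup>2) \<partial>lebesgue) \<le> (\<integral>\<^sup>+ x. ennreal (\<bar>W t x\<bar>\<^sup>2
          + (weak_dx (rho_pow \<beta> \<rho>) t x)\<^sup>2 + P t x) \<partial>lebesgue)" if "0 < t"
        using P[OF that] by (intro nn_integral_mono ennreal_leI) simp
      then show ?case using elim by (auto intro: order_trans)
    qed
  qed
  have \<rho>\<beta>_energy: "AE t in lborel. 0 < t \<longrightarrow>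
      (\<integral>\<^sup>+ x. ennreal ((weak_dx (rho_pow \<beta> \<rho>) t x)\<^sup>2) \<partial>lborel) \<le> ennreal C"
    using energy
  proof eventually_elim
    case (elim t)
    have "(\<integral>\<^sup>+ x. ennreal ((weak_dx (rho_pow \<beta> \<rho>) t x)\<^sup>2) \<partial>lebesgue) \<le> (\<integral>\<^sup>+ x. ennreal (\<bar>W t x\<bar>\<^sup>2
        + (weak_dx (rho_pow \<beta> \<rho>) t x)\<^sup>2 + P t x) \<partial>lebesgue)" if "0 < t"
      using P[OF that] by (intro nn_integral_mono ennreal_leI) simp
    then show ?case using elim by (auto simp: nn_integral_completion intro: order_trans)
  qed
  have P_energy: "AE t in lborel. 0 < t \<longrightarrow> (\<integral>\<^sup>+ x. ennreal (P t x) \<partial>lborel) \<le> ennreal C"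
    using energy
  proof eventually_elim
    case (elim t)
    have "(\<integral>\<^sup>+ x. ennreal (P t x) \<partial>lebesgue) \<le> (\<integral>\<^sup>+ x. ennreal (\<bar>W t x\<bar>\<^sup>2
        + (weak_dx (rho_pow \<beta> \<rho>) t x)\<^sup>2 + P t x) \<partial>lebesgue)"
      by (intro nn_integral_mono ennreal_leI) simp
    then show ?case using elim by (auto simp: nn_integral_completion intro: order_trans)
  qed
  obtain h where h: "case_prod h \<in> borel_measurable borel"
    "AE (t, x) in lborel. t \<in> {0<..} \<longrightarrow> weak_dx v t x = h t x"
    by (rule weak_dx_borel_version[OF v_weak])
  \<comment> \<open>The dissipation rate of \<open>v\<close>, formed with the Borel representative
    so that it is measurable in time.\<close>
  define N where "N t = (\<integral>\<^sup>+ x. ennreal ((h t x)\<^sup>2) \<partial>lborel)" for t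
  have h_meas[measurable]: "(\<lambda>p. h (fst p) (snd p)) \<in> borel_measurable (borel \<Otimes>\<^sub>M borel)"
    using h(1) by (simp add: split_beta' borel_prod)
  have N_meas: "N \<in> borel_measurable borel"
    unfolding N_def[abs_def] by (rule lborel.borel_measurable_nn_integral) (simp add: split_beta')
  have N_bound: "(\<integral>\<^sup>+ t. indicator {0<..<T} t * N t \<partial>lborel) \<le> ennreal C" if T: "T > 0" for T
  proof -
    have h_slice: "h t \<in> borel_measurable borel" for t
      by (rule borel_measurable_slice[OF h(1)])
    have S: "strip 0 T \<in> sets borel"
      by (simp add: strip_def open_strip_UNIV borel_open)
    have "(\<integral>\<^sup>+ t. indicator {0<..<T} t * N t \<partial>lborel)
        = (\<integral>\<^sup>+ t. \<integral>\<^sup>+ x. indicator {0<..<T} t * ennreal ((h t x)\<^sup>2) \<partial>lborel \<partial>lborel)"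
      unfolding N_def using h_slice by (intro nn_integral_cong nn_integral_cmult[symmetric]) measurable
    also have "\<dots> = (\<integral>\<^sup>+ p. indicator {0<..<T} (fst p) * ennreal ((h (fst p) (snd p))\<^sup>2) \<partial>lborel)"
      by (subst lborel_prod[symmetric], subst lborel.nn_integral_fst[symmetric]) simp_all
    also have "\<dots> = (\<integral>\<^sup>+ p. ennreal ((weak_dx v (fst p) (snd p))\<^sup>2) * indicator (strip 0 T) p \<partial>lborel)"
      using h(2) by (intro nn_integral_cong_AE) (auto elim!: eventually_mono simp: strip_def indicator_def)
    also have "\<dots> = (\<integral>\<^sup>+ p. ennreal ((weak_dx v (fst p) (snd p))\<^sup>2) \<partial>lebesgue_on (strip 0 T))"
      using S by (subst nn_integral_restrict_space) (auto simp: nn_integral_completion)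
    also have "\<dots> \<le> ennreal C" by (rule dissipation[OF T])
    finally show ?thesis .
  qed

  \<comment> \<open>Persistence of a large deviation on a space-time box\<close>
  define d where "d t x = \<rho> t x - \<rho>\<^sub>b t x" for t x
  have d_cont: "continuous_on UNIV (d t)" if "t > 0" for t
    unfolding d_def using that
    by (intro continuous_intros continuous_on_slice[OF \<rho>_cont, of t] continuous_on_slice[OF \<rho>\<^sub>b_cont, of t]) auto
  have \<rho>_equi: "\<exists>\<delta>>0. \<forall>t>0. \<forall>x y. \<bar>x - y\<bar> < \<delta> \<longrightarrow> \<bar>\<rho> t x - \<rho> t y\<bar> < \<epsilon>" if "\<epsilon> > 0" for \<epsilon>
    using weak_dx_equicontinuous[OF \<rho>\<beta>_weak \<rho>\<beta>_cont C \<rho>\<beta>_energy]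
    by (intro powr_equicontinuous_imp[OF \<beta> \<rho> _ that]) (auto simp: rho_pow_def)
  have small: "\<exists>T0>0. \<forall>t0\<ge>T0. \<forall>x0. \<bar>d t0 x0\<bar> < \<delta>" if \<delta>: "\<delta> > 0" for \<delta>
  proof -
    have "\<delta> / 8 > 0" using \<delta> by simp
    obtain \<delta>1 where \<delta>1: "\<delta>1 > 0"
      "\<And>t x y. t > 0 \<Longrightarrow> \<bar>x - y\<bar> < \<delta>1 \<Longrightarrow> \<bar>\<rho> t x - \<rho> t y\<bar> < \<delta> / 8"
      using \<rho>_equi[OF \<open>\<delta> / 8 > 0\<close>] by blast
    obtain \<delta>2 where \<delta>2: "\<delta>2 > 0"
      "\<And>t x y. t \<ge> 0 \<Longrightarrow> \<bar>x - y\<bar> < \<delta>2 \<Longrightarrow> \<bar>\<rho>\<^sub>b t x - \<rho>\<^sub>b t y\<bar> < \<delta> / 8"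
      using wave_props(3)[OF \<open>\<delta> / 8 > 0\<close>] by blast
    \<comment> \<open>At distance \<open>r\<close> density and wave oscillate by less than
      \<open>\<delta> / 8\<close> each, hence \<open>d\<close> by at most
      \<open>\<delta> / 4\<close>.\<close>
    define r where "r = min \<delta>1 \<delta>2 / 2"
    have r: "r > 0" "r < \<delta>1" "r < \<delta>2" using \<delta>1(1) \<delta>2(1) by (auto simp: r_def min_def)
    have d_equi: "\<bar>d t x - d t y\<bar> \<le> \<delta> / 4" if "t > 0" "\<bar>x - y\<bar> \<le> r" for t x y
    proof -
      have "\<bar>\<rho> t x - \<rho> t y\<bar> < \<delta> / 8" "\<bar>\<rho>\<^sub>b t x - \<rho>\<^sub>b t y\<bar> < \<delta> / 8"
        using \<delta>1(2)[of t x y] \<delta>2(2)[of t x y] that r by auto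
      then show ?thesis unfolding d_def abs_le_iff abs_less_iff by linarith
    qed
    obtain B where B: "B \<ge> 0" "\<And>a x. \<bar>deriv (mollifier r a) x\<bar> \<le> B * indicator {a..a + r} x"
      using deriv_mollifier_bound[OF r(1)] by blast
    define A where "A t x0 = (LINT x|lborel. d t x * mollifier r x0 x)" for t x0
    define Lip where "Lip = B * ((C / 2 + (C + rp) * U) * r + C / 2)"
    have A_lip: "\<bar>A t2 x0 - A t1 x0\<bar> \<le> Lip * (t2 - t1)" if t: "0 < t1" "t1 \<le> t2" for t1 t2 x0
    proof -
      have A_eq: "(LINT x|lebesgue. (\<rho> t x - \<rho>\<^sub>b t x) * mollifier r x0 x) = A t x0" if "t > 0" for t
        using borel_measurable_integrable[OF integrable_mult_mollifier[OF d_cont[OF that] r(1), of x0]]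
        unfolding A_def d_def by (rule integral_completion)
      have "Linf_L2 (t2 + 1) W"
        using sol t unfolding weak_solution_towards_def solution_class_def W_def by simp
      then have "case_prod W \<in> borel_measurable (lebesgue_on (strip 0 (t2 + 1)))"
        unfolding Linf_L2_def by blast
      then have W_meas: "case_prod W \<in> borel_measurable (lebesgue_on (strip t1 t2))"
        by (rule measurable_restrict_mono) (use t in \<open>auto simp: strip_def\<close>)
      have mass: "weak_mass_equation \<rho>\<^sub>b u\<^sub>b \<rho> u"
        using sol unfolding weak_solution_towards_def by (elim conjE)
      have \<rho>\<^sub>b': "0 \<le> \<rho>\<^sub>b t x \<and> \<rho>\<^sub>b t x \<le> rp" if "0 < t" for t x
        using \<rho>\<^sub>b[OF that, of x] assms(4) by auto
      have "0 < t2" using t by simp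
      show ?thesis
        unfolding A_eq[OF t(1), symmetric] A_eq[OF \<open>0 < t2\<close>, symmetric] Lip_def
        by (rule mass_average_lipschitz[OF mass t \<rho> \<rho>\<^sub>b' U W_meas[unfolded W_def]
            W_energy[unfolded W_def] r(1) B])
    qed
    \<comment> \<open>During a window of length \<open>3 * e\<close> the averages \<open>A\<close>
      drift by at most \<open>\<delta> / 4\<close>; the summand 1 keeps the denominator
      positive.\<close>
    define e where "e = \<delta> / (12 * (\<bar>Lip\<bar> + 1))"
    have e: "e > 0" "\<bar>Lip\<bar> * (3 * e) \<le> \<delta> / 4"
      using \<delta> by (auto simp: e_def field_simps add_pos_nonneg)
    \<comment> \<open>Three losses of \<open>\<delta> / 4\<close> occur: from \<open>d\<close> at
      \<open>(t0, x0)\<close> to its average, from time \<open>t0\<close> to \<open>t\<close>, and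
      from the average back to \<open>d\<close>. A quarter of \<open>\<delta>\<close> is
      left.\<close>
    have window: "s * d t x \<ge> \<delta> / 4"
      if t0: "t0 > 0" and s: "\<bar>s\<bar> = 1" "s * d t0 x0 \<ge> \<delta>"
        and t: "t \<in> {t0..t0 + 3 * e}" and x: "x \<in> {x0..x0 + r}" for t0 s x0 t x
    proof -
      have near: "\<bar>A t' x0 - d t' y\<bar> \<le> \<delta> / 4" if "t' > 0" "y \<in> {x0..x0 + r}" for t' y
      proof -
        have "d t' y - \<delta> / 4 \<le> d t' z \<and> d t' z \<le> d t' y + \<delta> / 4" if "z \<in> {x0..x0 + r}" for z
        proof -
          have "\<bar>d t' z - d t' y\<bar> \<le> \<delta> / 4"
            using that \<open>y \<in> {x0..x0 + r}\<close> \<open>t' > 0\<close> by (intro d_equi) (auto simp: abs_le_iff)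
          then show ?thesis unfolding abs_le_iff by linarith
        qed
        then have "d t' y - \<delta> / 4 \<le> A t' x0" "A t' x0 \<le> d t' y + \<delta> / 4"
          unfolding A_def using d_cont[OF that(1)] r(1)
          by (blast intro: mollifier_average_ge mollifier_average_le)+
        then show ?thesis unfolding abs_le_iff by linarith
      qed
      have "\<bar>A t x0 - A t0 x0\<bar> \<le> Lip * (t - t0)" using A_lip[of t0 t x0] t0 t by auto
      also have "\<dots> \<le> \<bar>Lip\<bar> * (3 * e)" using t by (intro mult_mono) auto
      finally have diffs: "\<bar>A t x0 - A t0 x0\<bar> \<le> \<delta> / 4" using e(2) by linarith
      have near_t: "\<bar>A t x0 - d t x\<bar> \<le> \<delta> / 4" "\<bar>A t0 x0 - d t0 x0\<bar> \<le> \<delta> / 4"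
        using near[of t x] near[of t0 x0] t0 t x r(1) by auto
      consider "s = 1" | "s = - 1" using s(1) by linarith
      then show ?thesis
      proof cases
        case 1
        show ?thesis using diffs near_t s(2) unfolding 1 abs_le_iff by linarith
      next
        case 2
        show ?thesis using diffs near_t s(2) unfolding 2 abs_le_iff by linarith
      qed
    qed

    \<comment> \<open>Dissipation forced by the box\<close>
    have "\<delta> / 4 > 0" using \<delta> by simp
    obtain c where c: "c > 0" "\<And>y z s. y \<in> {0..C} \<Longrightarrow> z \<in> {rm..rp} \<Longrightarrow> \<bar>s\<bar> = 1 \<Longrightarrow>
        s * (y - z) \<ge> \<delta> / 4 \<Longrightarrow> s * (y powr \<kappa> - z powr \<kappa>) \<ge> c"
      using powr_diff_coercive[OF \<kappa> assms(4) \<open>\<delta> / 4 > 0\<close>, of C rp] by blast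
    \<comment> \<open>Budget of the long average: \<open>c / 4\<close> from this slack and
      \<open>c / 4\<close> from the potential. The short average is at least \<open>c\<close>, so
      the gap is at least \<open>m = c / 2\<close>.\<close>
    have "c / 4 > 0" using c(1) by simp
    obtain k where k: "k \<ge> 0" "\<And>y z. y \<in> {0..C} \<Longrightarrow> z \<in> {rm..rp} \<Longrightarrow>
        \<bar>y powr \<kappa> - z powr \<kappa>\<bar> \<le> c / 4 + k * rel_potential \<gamma> y z"
      using powr_diff_le_rel_potential[OF \<kappa> assms(1,4) \<open>c / 4 > 0\<close>, of C rp] by blast
    obtain D where D: "D > 0" "\<And>L a x. L > 0 \<Longrightarrow> mollifier L a x \<le> D / L"
      using mollifier_le by blast
    \<comment> \<open>Long enough that the share \<open>k * (D / L) * C\<close> of the potential is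
      at most \<open>c / 4\<close>; the summand 1 makes \<open>L\<close> positive.\<close>
    define L where "L = 4 * k * D * C / c + 1"
    have L: "L > 0" "k * (D / L) * C \<le> c / 4"
    proof -
      have "0 \<le> 4 * k * D * C / c" using k(1) D(1) C c(1) by simp
      then show "L > 0" by (simp add: L_def)
      have "4 * k * D * C \<le> L * c" using c(1) by (simp add: L_def field_simps)
      then show "k * (D / L) * C \<le> c / 4" using \<open>L > 0\<close> by (simp add: field_simps)
    qed
    define m where "m = c / 2"
    \<comment> \<open>Both mollifiers start at \<open>x0\<close> and span at most
      \<open>r + L\<close>, the length \<open>K * m\<close> allowed by
      \<open>weak_dx_time_window\<close>.\<close>
    define K where "K = (r + L) / m"
    have mK: "m > 0" "K > 0" "r + L = K * m" using c(1) r(1) L(1) by (auto simp: m_def K_def)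
    \<comment> \<open>Multiplied by \<open>K / 2\<close> this threshold becomes
      \<open>m * e / 4\<close>, half of what the window estimate forces.\<close>
    have "m * e / (2 * K) > 0" using mK e(1) by simp
    then obtain T0 where T0: "T0 > 0" "\<And>a b. a \<ge> T0 \<Longrightarrow> b \<ge> a \<Longrightarrow>
        (\<integral>\<^sup>+ t. indicator {a..b} t * N t \<partial>lborel) \<le> ennreal (m * e / (2 * K))"
      using nn_integral_tail[OF N_meas C N_bound] by blast
    have "\<bar>d t0 x0\<bar> < \<delta>" if "t0 \<ge> T0" for t0 x0
    proof (rule ccontr)
      assume contra: "\<not> \<bar>d t0 x0\<bar> < \<delta>"
      define s where "s = sgn (d t0 x0)"
      have s: "\<bar>s\<bar> = 1" "s * d t0 x0 \<ge> \<delta>"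
        using contra \<delta> by (auto simp: s_def abs_sgn_eq sgn_mult_self_eq mult.commute abs_sgn)
      have t0: "t0 > 0" using that T0(1) by simp
      have lower: "AE t in lborel. t \<in> {t0..t0 + 3 * e} \<longrightarrow>
          s * (LINT x|lborel. v t x * (mollifier r x0 x - mollifier L x0 x)) \<ge> m"
        using P_energy
      proof eventually_elim
        case (elim t)
        show ?case
        proof
          assume t: "t \<in> {t0..t0 + 3 * e}"
          then have tpos: "t > 0" using t0 by auto
          have v: "continuous_on UNIV (v t)"
            using continuous_on_slice[OF v_cont] tpos by auto
          then have sv: "continuous_on UNIV (\<lambda>x. s * v t x)" by (intro continuous_intros)
          have "c \<le> (LINT x|lborel. s * v t x * mollifier r x0 x)"
            using window[OF t0 s t] \<rho>[OF tpos] \<rho>\<^sub>b[OF tpos] s(1)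
            by (intro mollifier_average_ge[OF sv r(1)]) (auto simp: v_eq d_def intro!: c(2))
          then have near: "c \<le> s * (LINT x|lborel. v t x * mollifier r x0 x)"
            by (simp add: mult.assoc)
          have "\<rho> t \<in> borel_measurable borel" "\<rho>\<^sub>b t \<in> borel_measurable borel"
            using continuous_on_slice[OF \<rho>_cont] continuous_on_slice[OF \<rho>\<^sub>b_cont] tpos
            by (auto intro!: borel_measurable_continuous_onI)
          then have P_meas: "P t \<in> borel_measurable borel"
            unfolding P_def[abs_def] rel_potential_def by measurable
          have P_le: "(\<integral>\<^sup>+ x. ennreal (P t x) \<partial>lborel) \<le> ennreal C" using elim tpos by simp
          have P_int: "integrable lborel (P t)"
            using P_meas P[OF tpos] P_le
            by (intro integrableI_nonneg) (auto intro: le_less_trans)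
          then have "(LINT x|lborel. P t x) \<le> C"
            using P_le P[OF tpos] C by (simp add: nn_integral_eq_integral)
          \<comment> \<open>Only the potential is weighted by the supremum \<open>D / L\<close> of
            the mollifier; the constant \<open>c / 4\<close> keeps the mollifier and integrates to
            itself by unit mass.\<close>
          have bound: "s * v t x * mollifier L x0 x \<le> c / 4 * mollifier L x0 x + k * (D / L) * P t x" for x
          proof -
            have "s * v t x \<le> \<bar>v t x\<bar>" using s(1) abs_ge_self[of "s * v t x"] by (simp add: abs_mult)
            also have "\<dots> \<le> c / 4 + k * P t x"
              unfolding v_eq P_def using \<rho>[OF tpos] \<rho>\<^sub>b[OF tpos] by (intro k(2)) auto
            finally have "s * v t x * mollifier L x0 x \<le> (c / 4 + k * P t x) * mollifier L x0 x"
              using mollifier_nonneg[OF L(1)] by (rule mult_right_mono)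
            also have "\<dots> = c / 4 * mollifier L x0 x + k * P t x * mollifier L x0 x"
              by (rule distrib_right)
            also have "\<dots> \<le> c / 4 * mollifier L x0 x + k * P t x * (D / L)"
              using k(1) P[OF tpos] D(2)[OF L(1)] by (intro add_left_mono mult_left_mono) auto
            finally show ?thesis by (simp add: mult_ac)
          qed
          have kL: "integrable lborel (mollifier L x0)" "(LINT x|lborel. mollifier L x0 x) = 1"
            using has_bochner_integral_mollifier[OF L(1)]
            by (auto simp: has_bochner_integral_iff)
          have "(LINT x|lborel. s * v t x * mollifier L x0 x)
              \<le> (LINT x|lborel. c / 4 * mollifier L x0 x + k * (D / L) * P t x)"
            using bound kL P_int by (intro integral_mono integrable_mult_mollifier[OF sv L(1)]) auto
          also have "\<dots> = c / 4 + k * (D / L) * (LINT x|lborel. P t x)"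
            using kL P_int by simp
          also have "\<dots> \<le> c / 4 + k * (D / L) * C"
            using k(1) D(1) L(1) \<open>(LINT x|lborel. P t x) \<le> C\<close> by (intro add_left_mono mult_left_mono) auto
          also have "\<dots> \<le> c / 4 + c / 4" using L(2) by (rule add_left_mono)
          finally have "s * (LINT x|lborel. v t x * mollifier L x0 x) \<le> c / 2"
            by (simp add: mult.assoc)
          with near show "s * (LINT x|lborel. v t x * (mollifier r x0 x - mollifier L x0 x)) \<ge> m"
            unfolding integral_mult_mollifier_diff[OF v r(1) L(1)] m_def right_diff_distrib[of s] by linarith
        qed
      qed
      have "max (x0 + r) (x0 + L) - min x0 x0 \<le> K * m"
        using mK(3) r(1) L(1) by (simp add: max_def)
      from weak_dx_time_window[OF v_weak v_cont h t0 e(1) mK(2) r(1) L(1) this s(1) lower]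
      have "ennreal (m * e / 2) \<le> (\<integral>\<^sup>+ t. indicator {t0..t0 + 3 * e} t
          * (\<integral>\<^sup>+ x. ennreal (K / 2 * (h t x)\<^sup>2) \<partial>lborel) \<partial>lborel)" .
      also have "\<dots> = (\<integral>\<^sup>+ t. ennreal (K / 2) * (indicator {t0..t0 + 3 * e} t * N t) \<partial>lborel)"
      proof (rule nn_integral_cong)
        fix t
        have [measurable]: "h t \<in> borel_measurable borel" by (rule borel_measurable_slice[OF h(1)])
        have "(\<integral>\<^sup>+ x. ennreal (K / 2 * (h t x)\<^sup>2) \<partial>lborel) = ennreal (K / 2) * N t"
          unfolding N_def using mK(2)
          by (subst nn_integral_cmult[symmetric]) (auto simp flip: ennreal_mult)
        then show "indicator {t0..t0 + 3 * e} t * (\<integral>\<^sup>+ x. ennreal (K / 2 * (h t x)\<^sup>2) \<partial>lborel)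
            = ennreal (K / 2) * (indicator {t0..t0 + 3 * e} t * N t)"
          by (simp add: mult_ac)
      qed
      also have "\<dots> = ennreal (K / 2) * (\<integral>\<^sup>+ t. indicator {t0..t0 + 3 * e} t * N t \<partial>lborel)"
        using N_meas by (intro nn_integral_cmult) measurable
      also have "\<dots> \<le> ennreal (K / 2) * ennreal (m * e / (2 * K))"
        using T0(2)[of t0 "t0 + 3 * e"] that e(1) by (intro mult_left_mono) auto
      also have "\<dots> = ennreal (m * e / 4)"
        using mK e(1) by (simp flip: ennreal_mult)
      finally have "m * e / 2 \<le> m * e / 4"
        using mK(1) e(1) by (subst (asm) ennreal_le_iff) auto
      then show False using mK(1) e(1) by simp
    qed
    then show ?thesis using T0(1) by blast
  qed
  show "((\<lambda>t. SUP x. ereal \<bar>\<rho> t x - \<rho>\<^sub>b t x\<bar>) \<longlongrightarrow> 0) at_top"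
  proof (rule order_tendstoI)
    fix a :: ereal assume "a < 0"
    moreover have "0 \<le> (SUP x. ereal \<bar>\<rho> t x - \<rho>\<^sub>b t x\<bar>)" for t
      by (rule SUP_upper2[of 0]) auto
    ultimately show "\<forall>\<^sub>F t in at_top. a < (SUP x. ereal \<bar>\<rho> t x - \<rho>\<^sub>b t x\<bar>)"
      by (intro always_eventually allI) (rule less_le_trans)
  next
    fix a :: ereal assume "0 < a"
    \<comment> \<open>An intermediate real keeps the inequality strict after the supremum over
      \<open>x\<close>, which is taken in the extended reals.\<close>
    then obtain \<delta> where \<delta>: "0 < ereal \<delta>" "ereal \<delta> < a" using ereal_dense2 by blast
    then obtain T0 where T0: "\<And>t x. t \<ge> T0 \<Longrightarrow> \<bar>d t x\<bar> < \<delta>" using small[of \<delta>] by auto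
    have "(SUP x. ereal \<bar>\<rho> t x - \<rho>\<^sub>b t x\<bar>) < a" if "t \<ge> T0" for t
    proof -
      have "(SUP x. ereal \<bar>\<rho> t x - \<rho>\<^sub>b t x\<bar>) \<le> ereal \<delta>"
        using T0[OF that] by (intro SUP_least) (auto simp: d_def less_imp_le)
      then show ?thesis using \<delta>(2) by (rule le_less_trans)
    qed
    then show "\<forall>\<^sub>F t in at_top. (SUP x. ereal \<bar>\<rho> t x - \<rho>\<^sub>b t x\<bar>) < a"
      by (auto simp: eventually_at_top_linorder)
  qed
qed simp

end
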